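(* Let $L>0$, $I=(-L/2,L/2)$, and let $V:[-L/2,L/2]\to\mathbb{R}$ be a bounded single-well potential whose transition point is $\tau=0$. Then \[\Lambda(V,\alpha)\ \ge\ \Lambda(0,\alpha)\qquad\text{for each }\alpha\in[0,\infty],\] with equality if and only if $V$ is constant. Moreover, for each $\alpha\in(-\infty,\infty]$ there exist bounded single-well potentials $V$ on $[-L/2,L/2]$ with a transition point $\tau\neq 0$ such that $\Lambda(V,\alpha)<\Lambda(0,\alpha)$.
   Context: For a bounded potential $V:[-L/2,L/2]\to\mathbb{R}$ and $\alpha\in(-\infty,\infty]$, consider the eigenvalue problem $-u''+Vu=\lambda u$ on $(-L/2,L/2)$ with Robin boundary conditions $u'(-L/2)=\alpha u(-L/2)$ and $u'(L/2)=-\alpha u(L/2)$; the convention $\alpha=\infty$ means Dirichlet conditions $u(\pm L/2)=0$. Its spectrum consists of simple eigenvalues $\lambda_1(V,\alpha)<\lambda_2(V,\alpha)<\cdots\to\infty$, and $\Lambda(V,\alpha)=\lambda_2(V,\alpha)-\lambda_1(V,\alpha)$ is the spectral gap. A potential $V$ is a single-well potential on the closed interval $[-L/2,L/2]$ if there is $\tau\in[-L/2,L/2]$ such that $V$ is nonincreasing for $x\le\tau$ and nondecreasing for $x\ge\tau$; such $\tau$ is called a transition point.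
   Formalization: In the equality case, "V is constant" is taken as constant almost everywhere on [-L/2,L/2]: pointwise it fails, e.g. V=0 except V(-L/2)=1 is a bounded single well with τ=0, has the same spectrum as 0, and is not constant. *)

theory Defs
  imports "HOL-Analysis.Analysis"
begin

definition robin_bc :: "real \<Rightarrow> ereal \<Rightarrow> (real \<Rightarrow> real) \<Rightarrow> (real \<Rightarrow> real) \<Rightarrow> bool" where
  "robin_bc L \<alpha> u u' \<longleftrightarrow>
     (case \<alpha> of
        ereal a \<Rightarrow> u' (-L/2) = a * u (-L/2) \<and> u' (L/2) = - a * u (L/2)
      | PInfty \<Rightarrow> u (-L/2) = 0 \<and> u (L/2) = 0
      | MInfty \<Rightarrow> False)"

text \<open>u is an eigenfunction of -u'' + V u = lam u on (-L/2, L/2) with the boundary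
  conditions: u is C^1 on the closed interval (one-sided derivatives at the endpoints),
  u' is an indefinite integral of (V - lam) u (so u'' = (V - lam) u a.e.), and u is not
  identically zero.\<close>
definition is_eigenpair :: "real \<Rightarrow> (real \<Rightarrow> real) \<Rightarrow> ereal \<Rightarrow> real \<Rightarrow> (real \<Rightarrow> real) \<Rightarrow> bool" where
  "is_eigenpair L V \<alpha> lam u \<longleftrightarrow>
     (\<exists>u'. (\<forall>x\<in>{-L/2..L/2}. (u has_real_derivative u' x) (at x within {-L/2..L/2}))
         \<and> continuous_on {-L/2..L/2} u'
         \<and> (\<forall>x\<in>{-L/2..L/2}.
               ((\<lambda>t. (V t - lam) * u t) has_integral (u' x - u' (-L/2))) {-L/2..x})
         \<and> robin_bc L \<alpha> u u'
         \<and> (\<exists>x\<in>{-L/2..L/2}. u x \<noteq> 0))"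

definition eigenvalues :: "real \<Rightarrow> (real \<Rightarrow> real) \<Rightarrow> ereal \<Rightarrow> real set" where
  "eigenvalues L V \<alpha> = {lam. \<exists>u. is_eigenpair L V \<alpha> lam u}"

definition lambda1 :: "real \<Rightarrow> (real \<Rightarrow> real) \<Rightarrow> ereal \<Rightarrow> real" where
  "lambda1 L V \<alpha> = Inf (eigenvalues L V \<alpha>)"

definition lambda2 :: "real \<Rightarrow> (real \<Rightarrow> real) \<Rightarrow> ereal \<Rightarrow> real" where
  "lambda2 L V \<alpha> = Inf (eigenvalues L V \<alpha> - {lambda1 L V \<alpha>})"

definition spectral_gap :: "real \<Rightarrow> (real \<Rightarrow> real) \<Rightarrow> ereal \<Rightarrow> real" where
  "spectral_gap L V \<alpha> = lambda2 L V \<alpha> - lambda1 L V \<alpha>"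

definition single_well :: "real \<Rightarrow> (real \<Rightarrow> real) \<Rightarrow> real \<Rightarrow> bool" where
  "single_well L V \<tau> \<longleftrightarrow> \<tau> \<in> {-L/2..L/2}
     \<and> (\<forall>x y. -L/2 \<le> x \<and> x \<le> y \<and> y \<le> \<tau> \<longrightarrow> V y \<le> V x)
     \<and> (\<forall>x y. \<tau> \<le> x \<and> x \<le> y \<and> y \<le> L/2 \<longrightarrow> V x \<le> V y)"

end

theory Submission
  imports Defs
begin

text \<open>Let \<open>u1 > 0\<close> and \<open>u2\<close> be the first two eigenfunctions of a well \<open>V\<close> centered at \<open>0\<close>, and let \<open>z\<close> be the
  interior zero of \<open>u2\<close>; by reflection \<open>z \<ge> 0\<close>. Choose a constant \<open>b\<close> so that the ground state \<open>w\<close> of the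
  potential \<open>b\<close> on \<open>[z, l]\<close> has the logarithmic derivative of \<open>u1\<close> at \<open>z\<close>, continue \<open>w\<close> to \<open>[0, z]\<close>, and
  then choose \<open>c\<close> so that \<open>w\<close> extends to \<open>[-l, 0]\<close> with potential \<open>c\<close>. The step potential obtained has the
  same first eigenvalue, and monotonicity of \<open>V\<close> gives \<open>w'/w \<le> u1'/u1\<close> left of \<open>z\<close> and \<open>\<ge>\<close> right of \<open>z\<close>. Hence
  \<open>w u2 / u1\<close> is a subsolution for the step, so the second eigenvalue can only drop. For the step itself
  the trigonometric eigenvalue equations, together with concavity of the Robin phase \<open>k l - \<theta>(k)\<close>, give
  a gap larger than that of a constant potential. For the last claim, a small step located slightly
  left of \<open>0\<close> lowers the gap to first order, since \<open>u2\<close> vanishes at \<open>0\<close> and \<open>u1\<close> does not.\<close>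

section \<open>Calculus off a countable set\<close>

text \<open>A monotone potential may jump at countably many points, where \<open>u''\<close> need
  not exist. Solutions are therefore pairs \<open>(u, v)\<close> of a first-order system, and sign
  arguments use Wronskians that are monotone off a countable set. The matching point has to be
  \<open>z\<close> and not the centre: \<open>f = w u2 / u1\<close> satisfies
  \<open>f'' = (W - l2) f + 2 (w / u1)' (u2 / u1)' u1\<close>. Since \<open>u2 / u1\<close>
  increases, the extra term has the sign of \<open>f\<close> on both sides only if
  \<open>w / u1\<close> turns from decreasing to increasing exactly where \<open>u2\<close> changes
  sign. As the step shares the first eigenvalue, only the second one has to be compared. Boundary
  conditions enter as angles, so that Dirichlet conditions need separate care only where one divides
  by a function vanishing at an end. Eigenvalues are found by shooting: the end angle of the Pruefer
  equation is continuous and strictly increasing in the spectral parameter. The sign \<alpha> \<ge>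
  0 is what makes the shift \<open>arctan (\<alpha> / k)\<close> convex in the frequency, hence the
  phase concave.\<close>

lemma last_point_in_closed:
  fixes f :: "real \<Rightarrow> real"
  assumes cont: "continuous_on {a..b} f" and C: "closed C" and x: "x \<in> {a..b}" "f x \<in> C"
  obtains c where "a \<le> c" "c \<le> b" "f c \<in> C" "\<And>t. c < t \<Longrightarrow> t \<le> b \<Longrightarrow> f t \<notin> C"
proof -
  let ?X = "{a..b} \<inter> f -` C"
  have "closed ?X" using continuous_closed_preimage[OF cont _ C] by simp
  moreover have "bounded ?X" by (rule bounded_subset[of "{a..b}"]) auto
  ultimately have "compact ?X" by (simp add: compact_eq_bounded_closed)
  moreover have "?X \<noteq> {}" using x by auto
  ultimately obtain c where "c \<in> ?X" "\<forall>t\<in>?X. t \<le> c"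
    using compact_attains_sup[of ?X] by blast
  then have c: "c \<in> ?X" "\<And>t. t \<in> ?X \<Longrightarrow> t \<le> c" by blast+
  show ?thesis
  proof (rule that[of c])
    show "f t \<notin> C" if t: "c < t" "t \<le> b" for t
    proof
      assume "f t \<in> C"
      then have "t \<in> ?X" using c(1) t by auto
      then show False using c(2)[of t] t by simp
    qed
  qed (use c(1) in auto)
qed

text \<open>After a tilt that makes all derivatives off \<open>S\<close> strictly positive, the
  values taken on \<open>S\<close> are still countable, so some level \<open>y\<close> strictly
  between \<open>g b\<close> and \<open>g a\<close> is missed by them. The last point where the
  tilted function reaches \<open>y\<close> then lies off \<open>S\<close>, and the positive
  derivative there lifts the function above \<open>y\<close> further right.\<close>

lemma nondecreasing_off_countable:
  fixes f :: "real \<Rightarrow> real"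
  assumes ab: "a \<le> b" and cont: "continuous_on {a..b} f" and S: "countable S"
    and der: "\<And>x. a < x \<Longrightarrow> x < b \<Longrightarrow> x \<notin> S \<Longrightarrow> \<exists>d\<ge>0. (f has_real_derivative d) (at x)"
  shows "f a \<le> f b"
proof (rule ccontr)
  assume "\<not> f a \<le> f b"
  then have lt: "f b < f a" by simp
  then have "a < b" using ab by (cases "a = b") auto
  \<comment> \<open>Half the mean rate of the supposed descent: positive, yet too small to undo it,
    so \<open>g b < g a\<close> survives the tilt.\<close>
  define e where "e = (f a - f b) / (2 * (b - a))"
  define g where "g x = f x + e * x" for x
  have e: "e > 0" using lt \<open>a < b\<close> by (simp add: e_def)
  have gab: "g b < g a"
  proof -
    have "e * (b - a) = (f a - f b) / 2" using \<open>a < b\<close> by (simp add: e_def field_simps)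
    then show ?thesis using lt by (simp add: g_def algebra_simps) 
  qed
  have gcont: "continuous_on {a..b} g" unfolding g_def by (intro continuous_intros cont)
  have "uncountable {g b<..<g a}" using gab by (simp add: uncountable_open_interval)
  moreover have "countable (g ` S)" using S by simp
  ultimately have "\<not> {g b<..<g a} \<subseteq> g ` S" using countable_subset by blast
  then obtain y where y: "y \<in> {g b<..<g a}" "y \<notin> g ` S" by blast
  then have y: "g b < y" "y < g a" "y \<notin> g ` S" by simp_all
  obtain c where c: "a \<le> c" "c \<le> b" "g c \<in> {y..}" and after': "\<And>t. c < t \<Longrightarrow> t \<le> b \<Longrightarrow> g t \<notin> {y..}"
    by (rule last_point_in_closed[OF gcont closed_atLeast, of a y]) (use ab y in auto)
  have after: "g x < y" if "c < x" "x \<le> b" for x using after'[OF that] by simp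
  have "c \<noteq> b" using c y by auto
  then have cb: "a \<le> c" "c < b" using c by auto
  have gc: "g c = y"
  proof (rule antisym)
    show "y \<le> g c" using c by simp
    show "g c \<le> y"
    proof (rule ccontr)
      assume "\<not> g c \<le> y"
      then have 1: "y < g c" by simp
      have "continuous_on {c..b} g" by (rule continuous_on_subset[OF gcont]) (use cb in auto)
      then obtain x where x: "c \<le> x" "x \<le> b" "g x = y"
        using IVT2'[of g b y c] 1 y cb by auto
      then show False using after[of x] 1 by (cases "x = c") auto
    qed
  qed
  have "c \<noteq> a" using gc y by auto
  then have ca: "a < c" using cb by simp
  have "c \<notin> S" using gc y by auto
  then obtain d where d: "d \<ge> 0" "(f has_real_derivative d) (at c)" using der[OF ca cb(2)] by auto
  have gd: "(g has_real_derivative d + e) (at c)"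
    unfolding g_def by (auto intro!: derivative_eq_intros d(2))
  have "0 < d + e" using d e by simp
  from DERIV_pos_inc_right[OF gd this]
  obtain r where r: "r > 0" "\<And>h. 0 < h \<Longrightarrow> h < r \<Longrightarrow> g c < g (c + h)" by auto
  define h where "h = min (r/2) (b - c)"
  have "0 < h" "h < r" "c + h \<le> b" using r cb by (auto simp: h_def)
  then show False using r(2)[of h] after[of "c + h"] gc by auto
qed

lemma nonincreasing_off_countable:
  fixes f :: "real \<Rightarrow> real"
  assumes "a \<le> b" "continuous_on {a..b} f" "countable S"
    and der: "\<And>x. a < x \<Longrightarrow> x < b \<Longrightarrow> x \<notin> S \<Longrightarrow> \<exists>d\<le>0. (f has_real_derivative d) (at x)"
  shows "f b \<le> f a"
proof -
  have "- f a \<le> - f b"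
  proof (rule nondecreasing_off_countable[OF assms(1) _ assms(3)])
    show "continuous_on {a..b} (\<lambda>x. - f x)" by (intro continuous_intros assms)
    fix x assume "a < x" "x < b" "x \<notin> S"
    then obtain d where "d \<le> 0" "(f has_real_derivative d) (at x)" using der by blast
    then show "\<exists>d\<ge>0. ((\<lambda>x. - f x) has_real_derivative d) (at x)"
      by (intro exI[of _ "-d"]) (auto intro!: derivative_eq_intros)
  qed
  then show ?thesis by simp
qed

lemma constant_off_countable:
  fixes f :: "real \<Rightarrow> real"
  assumes "a \<le> b" "continuous_on {a..b} f" "countable S"
    and der: "\<And>x. a < x \<Longrightarrow> x < b \<Longrightarrow> x \<notin> S \<Longrightarrow> (f has_real_derivative 0) (at x)"
  shows "f b = f a"
proof (rule antisym)
  show "f b \<le> f a" by (rule nonincreasing_off_countable[OF assms(1-3)]) (use der in blast)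
  show "f a \<le> f b" by (rule nondecreasing_off_countable[OF assms(1-3)]) (use der in blast)
qed

lemma ex_off_countable:
  fixes a b :: real
  assumes "a < b" "countable S"
  shows "\<exists>x. a < x \<and> x < b \<and> x \<notin> S"
proof -
  have "\<not> {a<..<b} \<subseteq> S"
    using assms uncountable_open_interval[of a b] countable_subset by blast
  then show ?thesis by auto
qed

text \<open>Monotonicity holds throughout, and a single point with positive derivative already makes
  the total increase strict.\<close>

lemma increasing_off_countable:
  fixes f :: "real \<Rightarrow> real"
  assumes ab: "a < b" and cont: "continuous_on {a..b} f" and S: "countable S"
    and der: "\<And>x. a < x \<Longrightarrow> x < b \<Longrightarrow> x \<notin> S \<Longrightarrow> \<exists>d>0. (f has_real_derivative d) (at x)"
  shows "f a < f b"
proof -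
  have mono: "f x \<le> f y" if "a \<le> x" "x \<le> y" "y \<le> b" for x y
  proof (rule nondecreasing_off_countable[OF that(2) _ S])
    show "continuous_on {x..y} f" by (rule continuous_on_subset[OF cont]) (use that in auto)
    fix t assume "x < t" "t < y" "t \<notin> S"
    moreover have "a < t" "t < b" using that \<open>x < t\<close> \<open>t < y\<close> by linarith+
    ultimately obtain d where "d > 0" "(f has_real_derivative d) (at t)" using der by blast
    then show "\<exists>d\<ge>0. (f has_real_derivative d) (at t)" by (intro exI[of _ d]) simp
  qed
  obtain x where x: "a < x" "x < b" "x \<notin> S" using ex_off_countable[OF ab S] by auto
  obtain d where d: "d > 0" "(f has_real_derivative d) (at x)" using der[OF x] by auto
  from DERIV_pos_inc_right[OF d(2,1)]
  obtain r where r: "r > 0" "\<And>h. 0 < h \<Longrightarrow> h < r \<Longrightarrow> f x < f (x + h)" by auto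
  define h where "h = min (r/2) (b - x)"
  have h: "0 < h" "h < r" "x + h \<le> b" using r x by (auto simp: h_def)
  show ?thesis using r(2)[OF h(1,2)] mono[of a x] mono[of "x + h" b] h x by auto
qed

lemma zero_off_countable:
  fixes f :: "real \<Rightarrow> real"
  assumes "countable S" "\<And>x. a < x \<Longrightarrow> x < b \<Longrightarrow> isCont f x"
    "\<And>x. a < x \<Longrightarrow> x < b \<Longrightarrow> x \<notin> S \<Longrightarrow> f x = 0" "a < x" "x < b"
  shows "f x = 0"
proof (rule ccontr)
  assume "f x \<noteq> 0"
  have "f \<midarrow>x\<rightarrow> f x" using assms by (simp add: isCont_def)
  then have "\<forall>\<^sub>F y in at x. f y \<noteq> 0" using \<open>f x \<noteq> 0\<close> by (rule tendsto_imp_eventually_ne)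
  then obtain e where e: "e > 0" "\<And>y. y \<noteq> x \<Longrightarrow> dist y x < e \<Longrightarrow> f y \<noteq> 0"
    by (auto simp: eventually_at)
  obtain y where y: "x < y" "y < min (x + e) b" "y \<notin> S" using ex_off_countable[of x "min (x + e) b" S] e assms by auto
  then have "dist y x < e" "y \<noteq> x" by (auto simp: dist_real_def)
  then show False using e(2)[of y] assms(3)[of y] assms(4) y by simp
qed

section \<open>Bounded potentials with countably many discontinuities\<close>

text \<open>Monotone pieces have only countably many jumps, so wells and steps both fit; boundedness
  supplies global Lipschitz constants. The function lives on the whole line, so an interval
  potential has to be extended first.\<close>

definition tame :: "(real \<Rightarrow> real) \<Rightarrow> bool" where
  "tame q \<longleftrightarrow> bounded (range q) \<and> countable {x. \<not> isCont q x}"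

lemma tame_bound: "tame q \<Longrightarrow> \<exists>M>0. \<forall>x. \<bar>q x\<bar> \<le> M"
  unfolding tame_def bounded_pos by auto

lemma tame_borel: "tame q \<Longrightarrow> q \<in> borel_measurable borel"
  unfolding tame_def
  by (rule borel_measurable_continuous_countable_exceptions[of "{x. \<not> isCont q x}"])
    (auto simp: continuous_at_imp_continuous_on)

lemma tame_const [simp]: "tame (\<lambda>_. c)"
  unfolding tame_def by auto

lemma tame_sub_const:
  assumes "tame q"
  shows "tame (\<lambda>x. q x - c)"
proof -
  obtain M where M: "\<And>x. \<bar>q x\<bar> \<le> M" using tame_bound[OF assms] by auto
  have "bounded (range (\<lambda>x. q x - c))"
    unfolding bounded_real
  proof (intro exI[of _ "M + \<bar>c\<bar>"] ballI)
    fix y assume "y \<in> range (\<lambda>x. q x - c)"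
    then obtain x where "y = q x - c" by auto
    then show "\<bar>y\<bar> \<le> M + \<bar>c\<bar>" using M[of x] by linarith
  qed
  moreover have "{x. \<not> isCont (\<lambda>x. q x - c) x} \<subseteq> {x. \<not> isCont q x}" by (auto intro: continuous_intros)
  then have "countable {x. \<not> isCont (\<lambda>x. q x - c) x}"
    using assms countable_subset unfolding tame_def by blast
  ultimately show ?thesis by (simp add: tame_def)
qed

lemma tame_reflect:
  assumes "tame q"
  shows "tame (\<lambda>x. q (- x))"
proof -
  have "bounded (range (\<lambda>x. q (- x)))"
    by (rule bounded_subset[of "range q"]) (use assms in \<open>auto simp: tame_def\<close>)
  moreover have sub: "{x. \<not> isCont (\<lambda>x. q (- x)) x} \<subseteq> uminus ` {x. \<not> isCont q x}"
  proof
    fix x assume x: "x \<in> {x. \<not> isCont (\<lambda>x. q (- x)) x}"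
    have "\<not> isCont q (- x)"
    proof
      assume "isCont q (- x)"
      then have "isCont (\<lambda>x. q (- x)) x" by (intro isCont_o2[of x uminus q] continuous_intros)
      then show False using x by simp
    qed
    then show "x \<in> uminus ` {x. \<not> isCont q x}" by (intro image_eqI[of _ _ "- x"]) auto
  qed
  have "countable {x. \<not> isCont (\<lambda>x. q (- x)) x}"
    by (rule countable_subset[OF sub countable_image]) (use assms in \<open>simp add: tame_def\<close>)
  ultimately show ?thesis by (simp add: tame_def)
qed

lemma isCont_step: "x \<noteq> m \<Longrightarrow> isCont (\<lambda>x::real. if x < m then c else (d::real)) x"
proof (cases "x < m")
  case True
  have "\<forall>\<^sub>F y in nhds x. y \<in> {..<m}" using True by (intro eventually_nhds_in_open) auto
  then have "\<forall>\<^sub>F y in nhds x. (if y < m then c else d) = c"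
    by eventually_elim auto
  then show ?thesis using isCont_cong[of _ "\<lambda>_. c"] by fastforce
next
  case False
  assume "x \<noteq> m"
  then have "\<forall>\<^sub>F y in nhds x. y \<in> {m<..}" using False by (intro eventually_nhds_in_open) auto
  then have "\<forall>\<^sub>F y in nhds x. (if y < m then c else d) = d"
    by eventually_elim auto
  then show ?thesis using isCont_cong[of _ "\<lambda>_. d"] by fastforce
qed

lemma tame_step: "tame (\<lambda>x::real. if x < m then c else d)"
proof -
  have "{x. \<not> isCont (\<lambda>x::real. if x < m then c else d) x} \<subseteq> {m}" using isCont_step by blast
  then have "countable {x. \<not> isCont (\<lambda>x::real. if x < m then c else d) x}"
    using countable_subset by blast
  moreover have "bounded (range (\<lambda>x::real. if x < m then c else d))"
    by (rule bounded_subset[of "{c,d}"]) auto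
  ultimately show ?thesis by (simp add: tame_def)
qed

lemma tame_times_continuous_integrable:
  assumes q: "tame q" and g: "continuous_on {a..b} g"
  shows "(\<lambda>x. q x * g x) integrable_on {a..b::real}"
proof -
  obtain M where M: "M > 0" "\<And>x. \<bar>q x\<bar> \<le> M" using tame_bound[OF q] by auto
  have "q \<in> borel_measurable lebesgue" using tame_borel[OF q] by (simp add: measurable_completion)
  then have "q \<in> borel_measurable (lebesgue_on {a..b})"
    by (simp add: measurable_restrict_space1)
  moreover have "g \<in> borel_measurable (lebesgue_on {a..b})"
    by (rule continuous_imp_measurable_on_sets_lebesgue[OF g]) simp
  ultimately have m: "(\<lambda>x. q x * g x) \<in> borel_measurable (lebesgue_on {a..b})" by simp
  show ?thesis
  proof (rule measurable_bounded_by_integrable_imp_integrable[OF m])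
    show "(\<lambda>x. M * \<bar>g x\<bar>) integrable_on {a..b}"
      by (intro integrable_continuous_real continuous_intros g)
    show "norm (q x * g x) \<le> M * \<bar>g x\<bar>" for x
      using M(2)[of x] by (simp add: abs_mult mult_right_mono)
  qed simp
qed

lemma integral_deriv_interior:
  fixes f :: "real \<Rightarrow> real"
  assumes "f integrable_on {a..b}" "a < x" "x < b" "isCont f x"
  shows "((\<lambda>u. integral {a..u} f) has_real_derivative f x) (at x)"
proof -
  have "((\<lambda>u. integral {a..u} f) has_vector_derivative f x) (at x within {a..b} - {})"
    by (rule integral_has_vector_derivative_continuous_at)
      (use assms in \<open>auto intro: continuous_at_imp_continuous_at_within\<close>)
  then have "((\<lambda>u. integral {a..u} f) has_real_derivative f x) (at x within {a..b})"
    by (simp add: has_real_derivative_iff_has_vector_derivative)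
  moreover have "at x within {a..b} = at x" using assms by (simp add: at_within_Icc_at)
  ultimately show ?thesis by simp
qed

text \<open>The difference of \<open>f\<close> and the indefinite integral of \<open>q g\<close> is
  continuous with derivative zero off a countable set, hence constant. The factored integrand
  ensures integrability.\<close>

lemma ftc_off_countable:
  fixes f g :: "real \<Rightarrow> real"
  assumes ab: "a \<le> b" and f: "continuous_on {a..b} f" and S: "countable S"
    and q: "tame q" and g: "continuous_on {a..b} g"
    and der: "\<And>x. a < x \<Longrightarrow> x < b \<Longrightarrow> x \<notin> S \<Longrightarrow> (f has_real_derivative q x * g x) (at x)"
  shows "((\<lambda>x. q x * g x) has_integral f b - f a) {a..b}"
proof -
  let ?h = "\<lambda>x. q x * g x"
  have int: "?h integrable_on {a..b}" by (rule tame_times_continuous_integrable[OF q g])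
  let ?F = "\<lambda>x. f x - integral {a..x} ?h"
  have "?F b = ?F a"
  proof (rule constant_off_countable[OF ab])
    show "continuous_on {a..b} ?F"
      by (intro continuous_intros f indefinite_integral_continuous_1[OF int])
    show "countable (S \<union> {x. \<not> isCont q x})" using S q by (simp add: tame_def)
    fix x assume x: "a < x" "x < b" "x \<notin> S \<union> {x. \<not> isCont q x}"
    have "isCont g x" using continuous_on_interior[OF g, of x] x by simp
    then have "isCont ?h x" using x by (intro continuous_intros) auto
    from integral_deriv_interior[OF int x(1,2) this] der[of x] x
    show "(?F has_real_derivative 0) (at x)" by (auto intro!: derivative_eq_intros)
  qed
  then have "integral {a..b} ?h = f b - f a" by simp
  then show ?thesis using int by (simp add: has_integral_iff)
qed

section \<open>Solutions and Wronskians\<close>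

text \<open>The system \<open>u' = v\<close>, \<open>v' = q u\<close>; the spectral parameter is
  absorbed into \<open>q\<close>. Allowing exceptional points in both equations makes gluing
  immediate, and the first equation is recovered everywhere afterwards.\<close>

definition sol :: "(real \<Rightarrow> real) \<Rightarrow> real \<Rightarrow> real \<Rightarrow> (real \<Rightarrow> real) \<Rightarrow> (real \<Rightarrow> real) \<Rightarrow> bool" where
  "sol q a b u v \<longleftrightarrow> continuous_on {a..b} u \<and> continuous_on {a..b} v \<and>
     (\<exists>S. countable S \<and> (\<forall>x. a < x \<and> x < b \<and> x \<notin> S \<longrightarrow>
        (u has_real_derivative v x) (at x) \<and> (v has_real_derivative q x * u x) (at x)))"

lemma solI:
  assumes "continuous_on {a..b} u" "continuous_on {a..b} v" "countable S"
    "\<And>x. a < x \<Longrightarrow> x < b \<Longrightarrow> x \<notin> S \<Longrightarrow> (u has_real_derivative v x) (at x)"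
    "\<And>x. a < x \<Longrightarrow> x < b \<Longrightarrow> x \<notin> S \<Longrightarrow> (v has_real_derivative q x * u x) (at x)"
  shows "sol q a b u v"
  using assms unfolding sol_def by blast

lemma sol_cont:
  assumes "sol q a b u v"
  shows "continuous_on {a..b} u" "continuous_on {a..b} v"
  using assms unfolding sol_def by auto

lemma solE:
  assumes "sol q a b u v"
  obtains S where "countable S"
    "\<And>x. a < x \<Longrightarrow> x < b \<Longrightarrow> x \<notin> S \<Longrightarrow> (u has_real_derivative v x) (at x)"
    "\<And>x. a < x \<Longrightarrow> x < b \<Longrightarrow> x \<notin> S \<Longrightarrow> (v has_real_derivative q x * u x) (at x)"
  using assms unfolding sol_def by auto

lemma sol_subinterval:
  assumes "sol q a b u v" "a \<le> c" "d \<le> b"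
  shows "sol q c d u v"
proof -
  from assms(1) obtain S where "countable S"
    "\<And>x. a < x \<Longrightarrow> x < b \<Longrightarrow> x \<notin> S \<Longrightarrow> (u has_real_derivative v x) (at x)"
    "\<And>x. a < x \<Longrightarrow> x < b \<Longrightarrow> x \<notin> S \<Longrightarrow> (v has_real_derivative q x * u x) (at x)"
    by (rule solE) blast
  moreover have "{c..d} \<subseteq> {a..b}" using assms by auto
  ultimately show ?thesis using assms sol_cont[OF assms(1)]
    by (intro solI[of _ _ _ _ S]) (auto intro: continuous_on_subset)
qed

lemma sol_cong:
  assumes "sol q a b u v" "countable T" "\<And>x. a < x \<Longrightarrow> x < b \<Longrightarrow> x \<notin> T \<Longrightarrow> q x = r x"
  shows "sol r a b u v"
proof -
  from assms(1) obtain S where S: "countable S"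
    "\<And>x. a < x \<Longrightarrow> x < b \<Longrightarrow> x \<notin> S \<Longrightarrow> (u has_real_derivative v x) (at x)"
    "\<And>x. a < x \<Longrightarrow> x < b \<Longrightarrow> x \<notin> S \<Longrightarrow> (v has_real_derivative q x * u x) (at x)"
    by (rule solE) blast
  show ?thesis
  proof (rule solI[of _ _ _ _ "S \<union> T"])
    show "(v has_real_derivative r x * u x) (at x)" if "a < x" "x < b" "x \<notin> S \<union> T" for x
      using S(3)[of x] assms(3)[of x] that by auto
  qed (use S assms(2) sol_cont[OF assms(1)] in auto)
qed

lemma sol_lincomb:
  assumes "sol q a b u v" "sol q a b w y"
  shows "sol q a b (\<lambda>x. c * u x + d * w x) (\<lambda>x. c * v x + d * y x)"
proof -
  from assms(1) obtain S where S: "countable S"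
    "\<And>x. a < x \<Longrightarrow> x < b \<Longrightarrow> x \<notin> S \<Longrightarrow> (u has_real_derivative v x) (at x)"
    "\<And>x. a < x \<Longrightarrow> x < b \<Longrightarrow> x \<notin> S \<Longrightarrow> (v has_real_derivative q x * u x) (at x)"
    by (rule solE) blast
  from assms(2) obtain T where T: "countable T"
    "\<And>x. a < x \<Longrightarrow> x < b \<Longrightarrow> x \<notin> T \<Longrightarrow> (w has_real_derivative y x) (at x)"
    "\<And>x. a < x \<Longrightarrow> x < b \<Longrightarrow> x \<notin> T \<Longrightarrow> (y has_real_derivative q x * w x) (at x)"
    by (rule solE) blast
  show ?thesis
  proof (rule solI[of _ _ _ _ "S \<union> T"])
    show "continuous_on {a..b} (\<lambda>x. c * u x + d * w x)" "continuous_on {a..b} (\<lambda>x. c * v x + d * y x)"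
      by (intro continuous_intros sol_cont[OF assms(1)] sol_cont[OF assms(2)])+
    show "countable (S \<union> T)" using S T by simp
    fix x assume x: "a < x" "x < b" "x \<notin> S \<union> T"
    show "((\<lambda>x. c * u x + d * w x) has_real_derivative c * v x + d * y x) (at x)"
      using S(2)[of x] T(2)[of x] x by (auto intro!: derivative_eq_intros)
    show "((\<lambda>x. c * v x + d * y x) has_real_derivative q x * (c * u x + d * w x)) (at x)"
      using S(3)[of x] T(3)[of x] x by (auto intro!: derivative_eq_intros simp: algebra_simps)
  qed
qed

lemma sol_scale:
  assumes "sol q a b u v"
  shows "sol q a b (\<lambda>x. c * u x) (\<lambda>x. c * v x)"
  using sol_lincomb[OF assms assms, of c 0] by simp

lemma sol_reflect:
  assumes "sol q a b u v"
  shows "sol (\<lambda>x. q (- x)) (- b) (- a) (\<lambda>x. u (- x)) (\<lambda>x. - v (- x))"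
proof -
  from assms(1) obtain S where S: "countable S"
    "\<And>x. a < x \<Longrightarrow> x < b \<Longrightarrow> x \<notin> S \<Longrightarrow> (u has_real_derivative v x) (at x)"
    "\<And>x. a < x \<Longrightarrow> x < b \<Longrightarrow> x \<notin> S \<Longrightarrow> (v has_real_derivative q x * u x) (at x)"
    by (rule solE) blast
  note c = sol_cont[OF assms]
  have img: "uminus ` {- b..- a} \<subseteq> {a..b}" by auto
  show ?thesis
  proof (rule solI[of _ _ _ _ "uminus ` S"])
    show "continuous_on {- b..- a} (\<lambda>x. u (- x))" "continuous_on {- b..- a} (\<lambda>x. - v (- x))"
      by (auto intro!: continuous_intros continuous_on_compose2[OF c(1)] continuous_on_compose2[OF c(2)])
    show "countable (uminus ` S)" using S by simp
    fix x assume x: "- b < x" "x < - a" "x \<notin> uminus ` S"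
    then have nx: "a < - x" "- x < b" "- x \<notin> S" by (auto simp: image_iff)
    show "((\<lambda>x. u (- x)) has_real_derivative - v (- x)) (at x)"
      using S(2)[OF nx] by (simp add: DERIV_mirror)
    show "((\<lambda>x. - v (- x)) has_real_derivative q (- x) * u (- x)) (at x)"
      using DERIV_minus[OF S(3)[OF nx, unfolded DERIV_mirror]] by simp
  qed
qed

lemma sol_glue:
  assumes l: "sol q a m u1 v1" and r: "sol q m b u2 v2" and am: "a \<le> m" "m \<le> b"
    and eq: "u1 m = u2 m" "v1 m = v2 m"
  shows "sol q a b (\<lambda>x. if x \<le> m then u1 x else u2 x) (\<lambda>x. if x \<le> m then v1 x else v2 x)"
proof -
  from l obtain S where S: "countable S"
    "\<And>x. a < x \<Longrightarrow> x < m \<Longrightarrow> x \<notin> S \<Longrightarrow> (u1 has_real_derivative v1 x) (at x)"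
    "\<And>x. a < x \<Longrightarrow> x < m \<Longrightarrow> x \<notin> S \<Longrightarrow> (v1 has_real_derivative q x * u1 x) (at x)"
    by (rule solE) blast
  from r obtain T where T: "countable T"
    "\<And>x. m < x \<Longrightarrow> x < b \<Longrightarrow> x \<notin> T \<Longrightarrow> (u2 has_real_derivative v2 x) (at x)"
    "\<And>x. m < x \<Longrightarrow> x < b \<Longrightarrow> x \<notin> T \<Longrightarrow> (v2 has_real_derivative q x * u2 x) (at x)"
    by (rule solE) blast
  have split: "{a..b} = {a..m} \<union> {m..b}" using am by auto
  have cont: "continuous_on {a..b} (\<lambda>x. if x \<le> m then f x else g x)"
    if "continuous_on {a..m} f" "continuous_on {m..b} g" "f m = g m" for f g :: "real \<Rightarrow> real"
    unfolding split using that by (intro continuous_on_cases) (auto intro: antisym)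
  have left: "((\<lambda>x. if x \<le> m then f x else g x) has_real_derivative d) (at x)"
    if "x < m" "(f has_real_derivative d) (at x)" for f g :: "real \<Rightarrow> real" and x d
    by (rule has_field_derivative_transform_within_open[OF that(2), of "{..<m}"]) (use that in auto)
  have right: "((\<lambda>x. if x \<le> m then f x else g x) has_real_derivative d) (at x)"
    if "m < x" "(g has_real_derivative d) (at x)" for f g :: "real \<Rightarrow> real" and x d
    by (rule has_field_derivative_transform_within_open[OF that(2), of "{m<..}"]) (use that in auto)
  show ?thesis
  proof (rule solI[of _ _ _ _ "insert m (S \<union> T)"])
    show "continuous_on {a..b} (\<lambda>x. if x \<le> m then u1 x else u2 x)"
      "continuous_on {a..b} (\<lambda>x. if x \<le> m then v1 x else v2 x)"
      using sol_cont[OF l] sol_cont[OF r] eq by (auto intro!: cont)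
    show "countable (insert m (S \<union> T))" using S T by simp
    fix x assume x: "a < x" "x < b" "x \<notin> insert m (S \<union> T)"
    consider "x < m" | "m < x" using x by fastforce
    then have "((\<lambda>x. if x \<le> m then u1 x else u2 x) has_real_derivative (if x \<le> m then v1 x else v2 x)) (at x)
      \<and> ((\<lambda>x. if x \<le> m then v1 x else v2 x) has_real_derivative q x * (if x \<le> m then u1 x else u2 x)) (at x)"
    proof cases
      case 1
      then show ?thesis using left[OF 1 S(2)[of x]] left[OF 1 S(3)[of x]] x by simp
    next
      case 2
      then show ?thesis using right[OF 2 T(2)[of x]] right[OF 2 T(3)[of x]] x by simp
    qed
    then show "((\<lambda>x. if x \<le> m then u1 x else u2 x) has_real_derivative (if x \<le> m then v1 x else v2 x)) (at x)"
      "((\<lambda>x. if x \<le> m then v1 x else v2 x) has_real_derivative q x * (if x \<le> m then u1 x else u2 x)) (at x)"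
      by blast+
  qed
qed

text \<open>The exceptional points disappear for \<open>u\<close>: it is an indefinite integral of
  the continuous function \<open>v\<close>, which is differentiable everywhere, one-sidedly at the
  ends.\<close>

lemma sol_deriv_within:
  assumes s: "sol q a b u v" and x: "x \<in> {a..b}"
  shows "(u has_real_derivative v x) (at x within {a..b})"
proof -
  from s obtain S where S: "countable S"
    "\<And>x. a < x \<Longrightarrow> x < b \<Longrightarrow> x \<notin> S \<Longrightarrow> (u has_real_derivative v x) (at x)"
    by (rule solE) blast
  have eq: "integral {a..y} v = u y - u a" if y: "y \<in> {a..b}" for y
  proof -
    have "((\<lambda>x. 1 * v x) has_integral u y - u a) {a..y}"
      by (rule ftc_off_countable[OF _ _ S(1) tame_const])
        (use y sol_cont[OF s] S(2) in \<open>auto intro: continuous_on_subset\<close>)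
    then show ?thesis by (simp add: integral_unique)
  qed
  have "((\<lambda>x. integral {a..x} v) has_real_derivative v x) (at x within {a..b})"
    by (rule integral_has_real_derivative[OF sol_cont(2)[OF s] x])
  then have "((\<lambda>x. u a + integral {a..x} v) has_real_derivative v x) (at x within {a..b})"
    by (auto intro!: derivative_eq_intros)
  then show ?thesis
    by (rule has_field_derivative_transform_within[of _ _ _ _ 1]) (use x eq in auto)
qed

lemma sol_deriv:
  assumes s: "sol q a b u v" and x: "a < x" "x < b"
  shows "(u has_real_derivative v x) (at x)"
  using sol_deriv_within[OF s, of x] x by (simp add: at_within_Icc_at)

lemma sol_integral:
  assumes s: "sol q a b u v" and q: "tame q" and x: "x \<in> {a..b}"
  shows "((\<lambda>t. q t * u t) has_integral v x - v a) {a..x}"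
proof -
  from s obtain S where S: "countable S"
    "\<And>x. a < x \<Longrightarrow> x < b \<Longrightarrow> x \<notin> S \<Longrightarrow> (v has_real_derivative q x * u x) (at x)"
    by (rule solE) blast
  show ?thesis
    by (rule ftc_off_countable[OF _ _ S(1) q])
      (use x sol_cont[OF s] S(2) in \<open>auto intro: continuous_on_subset\<close>)
qed

text \<open>Converse of \<open>sol_deriv_within\<close> and \<open>sol_integral\<close> together;
  this is the passage from the integrated form of the equation in
  \<open>is_eigenpair\<close>.\<close>

lemma sol_of_integral:
  assumes q: "tame q" and ab: "a \<le> b"
    and u: "\<And>x. x \<in> {a..b} \<Longrightarrow> (u has_real_derivative v x) (at x within {a..b})"
    and v: "continuous_on {a..b} v"
    and int: "\<And>x. x \<in> {a..b} \<Longrightarrow> ((\<lambda>t. q t * u t) has_integral v x - v a) {a..x}"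
  shows "sol q a b u v"
proof (rule solI[of _ _ _ _ "{x. \<not> isCont q x}"])
  show cu: "continuous_on {a..b} u"
    by (rule DERIV_continuous_on) (rule u)
  show "continuous_on {a..b} v" by (rule v)
  show "countable {x. \<not> isCont q x}" using q by (simp add: tame_def)
  fix x assume x: "a < x" "x < b" "x \<notin> {x. \<not> isCont q x}"
  show "(u has_real_derivative v x) (at x)" using u[of x] x by (simp add: at_within_Icc_at)
  have "isCont u x" using continuous_on_interior[OF cu, of x] x by simp
  then have "((\<lambda>y. integral {a..y} (\<lambda>t. q t * u t)) has_real_derivative q x * u x) (at x)"
    using tame_times_continuous_integrable[OF q cu] x
    by (intro integral_deriv_interior continuous_intros) auto
  then have "((\<lambda>y. v a + integral {a..y} (\<lambda>t. q t * u t)) has_real_derivative q x * u x) (at x)"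
    by (auto intro!: derivative_eq_intros)
  then show "(v has_real_derivative q x * u x) (at x)"
  proof (rule has_field_derivative_transform_within_open[of _ _ _ "{a<..<b}"])
    show "v a + integral {a..y} (\<lambda>t. q t * u t) = v y" if "y \<in> {a<..<b}" for y
      using integral_unique[OF int[of y]] that by simp
  qed (use x in auto)
qed

text \<open>The Lagrange identity, with \<open>v\<close> and \<open>y\<close> in the role of
  \<open>u'\<close> and \<open>w'\<close>. The monotonicity lemmas below read off the sign of its
  right-hand side.\<close>

lemma wronskian_deriv:
  assumes s: "sol q a b u v" and t: "sol r a b w y"
  obtains S where "countable S" "continuous_on {a..b} (\<lambda>x. u x * y x - v x * w x)"
    "\<And>x. a < x \<Longrightarrow> x < b \<Longrightarrow> x \<notin> S \<Longrightarrow>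
       ((\<lambda>x. u x * y x - v x * w x) has_real_derivative (r x - q x) * (u x * w x)) (at x)"
proof -
  from s obtain S where S: "countable S"
    "\<And>x. a < x \<Longrightarrow> x < b \<Longrightarrow> x \<notin> S \<Longrightarrow> (u has_real_derivative v x) (at x)"
    "\<And>x. a < x \<Longrightarrow> x < b \<Longrightarrow> x \<notin> S \<Longrightarrow> (v has_real_derivative q x * u x) (at x)"
    by (rule solE) blast
  from t obtain T where T: "countable T"
    "\<And>x. a < x \<Longrightarrow> x < b \<Longrightarrow> x \<notin> T \<Longrightarrow> (w has_real_derivative y x) (at x)"
    "\<And>x. a < x \<Longrightarrow> x < b \<Longrightarrow> x \<notin> T \<Longrightarrow> (y has_real_derivative r x * w x) (at x)"
    by (rule solE) blast
  show ?thesis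
  proof (rule that[of "S \<union> T"])
    show "countable (S \<union> T)" using S T by simp
    show "continuous_on {a..b} (\<lambda>x. u x * y x - v x * w x)"
      using sol_cont[OF s] sol_cont[OF t] by (intro continuous_intros)
    fix x assume x: "a < x" "x < b" "x \<notin> S \<union> T"
    show "((\<lambda>x. u x * y x - v x * w x) has_real_derivative (r x - q x) * (u x * w x)) (at x)"
      using S(2,3)[of x] T(2,3)[of x] x by (auto intro!: derivative_eq_intros simp: algebra_simps)
  qed
qed

lemma wronskian_le:
  assumes s: "sol q a b u v" and t: "sol r a b w y" and ab: "a \<le> b"
    and ge: "\<And>x. a < x \<Longrightarrow> x < b \<Longrightarrow> (r x - q x) * (u x * w x) \<ge> 0"
  shows "u a * y a - v a * w a \<le> u b * y b - v b * w b"
proof -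
  obtain S where S: "countable S" "continuous_on {a..b} (\<lambda>x. u x * y x - v x * w x)"
    "\<And>x. a < x \<Longrightarrow> x < b \<Longrightarrow> x \<notin> S \<Longrightarrow>
       ((\<lambda>x. u x * y x - v x * w x) has_real_derivative (r x - q x) * (u x * w x)) (at x)"
    by (rule wronskian_deriv[OF s t]) blast
  show ?thesis
    by (rule nondecreasing_off_countable[OF ab S(2,1)]) (use S(3) ge in blast)
qed

lemma wronskian_ge:
  assumes s: "sol q a b u v" and t: "sol r a b w y" and ab: "a \<le> b"
    and le: "\<And>x. a < x \<Longrightarrow> x < b \<Longrightarrow> (r x - q x) * (u x * w x) \<le> 0"
  shows "u a * y a - v a * w a \<ge> u b * y b - v b * w b"
proof -
  have "w a * v a - y a * u a \<le> w b * v b - y b * u b"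
    by (rule wronskian_le[OF t s ab]) (use le in \<open>simp add: algebra_simps\<close>)
  then show ?thesis by (simp add: algebra_simps)
qed

lemma wronskian_less:
  assumes s: "sol q a b u v" and t: "sol r a b w y" and ab: "a < b"
    and gt: "\<And>x. a < x \<Longrightarrow> x < b \<Longrightarrow> (r x - q x) * (u x * w x) > 0"
  shows "u a * y a - v a * w a < u b * y b - v b * w b"
proof -
  obtain S where S: "countable S" "continuous_on {a..b} (\<lambda>x. u x * y x - v x * w x)"
    "\<And>x. a < x \<Longrightarrow> x < b \<Longrightarrow> x \<notin> S \<Longrightarrow>
       ((\<lambda>x. u x * y x - v x * w x) has_real_derivative (r x - q x) * (u x * w x)) (at x)"
    by (rule wronskian_deriv[OF s t]) blast
  show ?thesis
    by (rule increasing_off_countable[OF ab S(2,1)]) (use S(3) gt in blast)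
qed

lemma wronskian_greater:
  assumes s: "sol q a b u v" and t: "sol r a b w y" and ab: "a < b"
    and lt: "\<And>x. a < x \<Longrightarrow> x < b \<Longrightarrow> (r x - q x) * (u x * w x) < 0"
  shows "u a * y a - v a * w a > u b * y b - v b * w b"
proof -
  have "w a * v a - y a * u a < w b * v b - y b * u b"
    by (rule wronskian_less[OF t s ab]) (use lt in \<open>simp add: algebra_simps\<close>)
  then show ?thesis by (simp add: algebra_simps)
qed

text \<open>Gronwall's argument for the squared distance of the two solutions in the phase plane;
  the inhomogeneity is the difference of the potentials times the second solution.\<close>

lemma sol_close:
  assumes s: "sol q a b u v" and t: "sol r a b w y"
    and q: "\<And>x. a < x \<Longrightarrow> x < b \<Longrightarrow> \<bar>q x\<bar> \<le> M" and M: "0 \<le> M"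
    and d: "\<And>x. a < x \<Longrightarrow> x < b \<Longrightarrow> \<bar>q x - r x\<bar> \<le> d" and w: "\<And>x. a < x \<Longrightarrow> x < b \<Longrightarrow> \<bar>w x\<bar> \<le> B"
    and B: "0 \<le> B" "0 \<le> d"
    and init: "u a = w a" "v a = y a" and x: "x \<in> {a..b}"
  shows "(u x - w x)\<^sup>2 + (v x - y x)\<^sup>2 \<le> (d * B)\<^sup>2 * (x - a) * exp ((M + 2) * (x - a))"
proof -
  from s obtain S where S: "countable S"
    "\<And>x. a < x \<Longrightarrow> x < b \<Longrightarrow> x \<notin> S \<Longrightarrow> (u has_real_derivative v x) (at x)"
    "\<And>x. a < x \<Longrightarrow> x < b \<Longrightarrow> x \<notin> S \<Longrightarrow> (v has_real_derivative q x * u x) (at x)"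
    by (rule solE) blast
  from t obtain T where T: "countable T"
    "\<And>x. a < x \<Longrightarrow> x < b \<Longrightarrow> x \<notin> T \<Longrightarrow> (w has_real_derivative y x) (at x)"
    "\<And>x. a < x \<Longrightarrow> x < b \<Longrightarrow> x \<notin> T \<Longrightarrow> (y has_real_derivative r x * w x) (at x)"
    by (rule solE) blast
  \<comment> \<open>One unit from \<open>2 p o'\<close>, \<open>M\<close> from the potential, and
    one unit from splitting the product with the inhomogeneity into squares.\<close>
  define K where "K = M + 2"
  define E where "E x = (u x - w x)\<^sup>2 + (v x - y x)\<^sup>2" for x
  define G where "G x = exp (- (K * (x - a))) * E x - (d * B)\<^sup>2 * (x - a)" for x
  have sub: "{a..x} \<subseteq> {a..b}" using x by auto
  have "G x \<le> G a"
  proof (rule nonincreasing_off_countable[of a x G "S \<union> T"])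
    show "continuous_on {a..x} G"
      unfolding G_def E_def
      by (intro continuous_intros continuous_on_subset[OF sol_cont(1)[OF s] sub] continuous_on_subset[OF sol_cont(2)[OF s] sub]
        continuous_on_subset[OF sol_cont(1)[OF t] sub] continuous_on_subset[OF sol_cont(2)[OF t] sub])
    show "countable (S \<union> T)" using S T by simp
    fix z assume z: "a < z" "z < x" "z \<notin> S \<union> T"
    have zb: "z < b" using z x by auto
    define p where "p = u z - w z"
    define o' where "o' = v z - y z"
    define g where "g = 2 * p * o' + 2 * o' * (q z * u z - r z * w z)"
    have "(E has_real_derivative g) (at z)"
      unfolding E_def g_def p_def o'_def using S(2,3)[of z] T(2,3)[of z] z zb
      by (auto intro!: derivative_eq_intros simp: algebra_simps power2_eq_square)
    then have der: "(G has_real_derivative exp (- (K * (z - a))) * (g - K * E z) - (d * B)\<^sup>2) (at z)"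
      unfolding G_def by (auto intro!: derivative_eq_intros simp: algebra_simps)
    have g': "g = 2 * p * o' + 2 * o' * (q z * p + (q z - r z) * w z)"
      by (simp add: g_def p_def algebra_simps)
    have 1: "2 * p * o' \<le> p\<^sup>2 + o'\<^sup>2" using sum_squares_bound[of p o'] by simp
    have 2: "2 * o' * (q z * p) \<le> M * (p\<^sup>2 + o'\<^sup>2)"
    proof -
      have "2 * o' * (q z * p) = q z * (2 * p * o')" by simp
      also have "\<dots> \<le> \<bar>q z\<bar> * \<bar>2 * p * o'\<bar>"
        unfolding abs_mult[symmetric] by (rule abs_ge_self)
      also have "\<dots> \<le> M * (p\<^sup>2 + o'\<^sup>2)"
      proof (rule mult_mono)
        show "\<bar>q z\<bar> \<le> M" using q z zb by simp
        show "\<bar>2 * p * o'\<bar> \<le> p\<^sup>2 + o'\<^sup>2"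
          using sum_squares_bound[of p o'] sum_squares_bound[of p "- o'"] by (auto simp: abs_if)
      qed (use M in auto)
      finally show ?thesis .
    qed
    have 3: "2 * o' * ((q z - r z) * w z) \<le> o'\<^sup>2 + (d * B)\<^sup>2"
    proof -
      have "((q z - r z) * w z)\<^sup>2 \<le> (d * B)\<^sup>2"
        by (rule power2_le_iff_abs_le[THEN iffD2])
          (use B d[of z] w[of z] z zb in \<open>auto simp: abs_mult intro!: mult_mono\<close>)
      then show ?thesis using sum_squares_bound[of o' "(q z - r z) * w z"] by linarith
    qed
    have Ez: "E z = p\<^sup>2 + o'\<^sup>2" by (simp add: E_def p_def o'_def)
    have gle: "g \<le> K * E z + (d * B)\<^sup>2"
    proof -
      have "g = 2 * p * o' + 2 * o' * (q z * p) + 2 * o' * ((q z - r z) * w z)" unfolding g' by (simp add: algebra_simps)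
      also have "\<dots> \<le> (p\<^sup>2 + o'\<^sup>2) + M * (p\<^sup>2 + o'\<^sup>2) + (o'\<^sup>2 + (d * B)\<^sup>2)" using 1 2 3 by linarith
      also have "\<dots> \<le> K * E z + (d * B)\<^sup>2" unfolding Ez K_def by (simp add: algebra_simps)
      finally show ?thesis .
    qed
    have "exp (- (K * (z - a))) * (g - K * E z) \<le> exp (- (K * (z - a))) * (d * B)\<^sup>2"
      using gle by (intro mult_left_mono) auto
    also have "\<dots> \<le> 1 * (d * B)\<^sup>2"
      by (rule mult_right_mono) (use z M in \<open>auto simp: K_def\<close>)
    finally show "\<exists>e\<le>0. (G has_real_derivative e) (at z)" using der
      by (intro exI[of _ "exp (- (K * (z - a))) * (g - K * E z) - (d * B)\<^sup>2"]) auto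
  qed (use x in auto)
  also have "G a = 0" by (simp add: G_def E_def init)
  finally have "exp (- (K * (x - a))) * E x \<le> (d * B)\<^sup>2 * (x - a)" by (simp add: G_def)
  then have "exp (K * (x - a)) * (exp (- (K * (x - a))) * E x) \<le> exp (K * (x - a)) * ((d * B)\<^sup>2 * (x - a))"
    by (intro mult_left_mono) auto
  moreover have "exp (K * (x - a)) * (exp (- (K * (x - a))) * E x) = E x"
    by (simp add: exp_minus)
  ultimately show ?thesis by (simp add: E_def K_def algebra_simps)
qed

text \<open>Uniqueness as the special case of \<open>sol_close\<close> in which the second solution
  is zero and both error bounds vanish.\<close>

lemma sol_zero_right:
  assumes s: "sol q a b u v" and q: "\<And>x. \<bar>q x\<bar> \<le> M" and init: "u a = 0" "v a = 0" and x: "x \<in> {a..b}"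
  shows "u x = 0" "v x = 0"
proof -
  have z: "sol q a b (\<lambda>_. 0) (\<lambda>_. 0)" by (rule solI[of _ _ _ _ "{}"]) auto
  have "0 \<le> M" using q[of 0] by simp
  then have "(u x - 0)\<^sup>2 + (v x - 0)\<^sup>2 \<le> (0 * 0)\<^sup>2 * (x - a) * exp ((M + 2) * (x - a))"
    by (intro sol_close[OF s z q _ _ _ _ _ _ _ x]) (use init in auto)
  then show "u x = 0" "v x = 0" by (auto simp: sum_power2_le_zero_iff)
qed

lemma sol_zero:
  assumes s: "sol q a b u v" and q: "tame q" and init: "u c = 0" "v c = 0" "c \<in> {a..b}" and x: "x \<in> {a..b}"
  shows "u x = 0 \<and> v x = 0"
proof -
  obtain M where M: "\<And>x. \<bar>q x\<bar> \<le> M" using tame_bound[OF q] by auto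
  show ?thesis
  proof (cases "c \<le> x")
    case True
    have "sol q c b u v" by (rule sol_subinterval[OF s]) (use init in auto)
    from sol_zero_right[OF this M init(1,2), of x] True x show ?thesis by auto
  next
    case False
    have "sol q a c u v" by (rule sol_subinterval[OF s]) (use init in auto)
    from sol_zero_right[OF sol_reflect[OF this], of M "- x"] False x init M show ?thesis by auto
  qed
qed

section \<open>The Pruefer angle\<close>

text \<open>The right-hand side is \<open>cos^2 - q sin^2\<close>, the equation for the angle of \<open>(v, u)\<close> when \<open>u' = v\<close>, \<open>v' = q u\<close>.\<close>

definition pruefer :: "(real \<Rightarrow> real) \<Rightarrow> real \<Rightarrow> real \<Rightarrow> real \<Rightarrow> (real \<Rightarrow> real) \<Rightarrow> bool" where
  "pruefer q a b g th \<longleftrightarrow> continuous_on {a..b} th \<and> th a = g \<and>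
     (\<exists>S. countable S \<and> (\<forall>x. a < x \<and> x < b \<and> x \<notin> S \<longrightarrow>
        (th has_real_derivative 1 - (1 + q x) * (sin (th x))\<^sup>2) (at x)))"

lemma prueferE:
  assumes "pruefer q a b g th"
  obtains S where "countable S" "continuous_on {a..b} th" "th a = g"
    "\<And>x. a < x \<Longrightarrow> x < b \<Longrightarrow> x \<notin> S \<Longrightarrow> (th has_real_derivative 1 - (1 + q x) * (sin (th x))\<^sup>2) (at x)"
  using assms unfolding pruefer_def by auto

lemma pruefer_subinterval:
  assumes "pruefer q a b g th" "a \<le> c" "d \<le> b"
  shows "pruefer q c d (th c) th"
proof -
  from assms(1) obtain S where "countable S" "continuous_on {a..b} th"
    "\<And>x. a < x \<Longrightarrow> x < b \<Longrightarrow> x \<notin> S \<Longrightarrow> (th has_real_derivative 1 - (1 + q x) * (sin (th x))\<^sup>2) (at x)"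
    by (rule prueferE) blast
  moreover have "{c..d} \<subseteq> {a..b}" using assms by auto
  ultimately show ?thesis using assms unfolding pruefer_def
    by (intro conjI exI[of _ S]) (auto intro: continuous_on_subset)
qed

lemma sin_lipschitz: "\<bar>sin x - sin y\<bar> \<le> \<bar>x - y\<bar>" for x y :: real
proof -
  have "\<bar>sin x - sin y\<bar> = 2 * \<bar>sin ((x - y) / 2)\<bar> * \<bar>cos ((x + y) / 2)\<bar>"
    by (simp add: sin_diff_sin abs_mult)
  also have "\<dots> \<le> 2 * \<bar>(x - y) / 2\<bar> * 1"
    using abs_sin_x_le_abs_x[of "(x - y) / 2"] by (intro mult_mono abs_cos_le_one mult_left_mono) auto
  finally show ?thesis by simp
qed

lemma pruefer_rhs_lipschitz:
  assumes "\<bar>c\<bar> \<le> (M::real)"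
  shows "\<bar>(1 - (1 + c) * (sin x)\<^sup>2) - (1 - (1 + c) * (sin y)\<^sup>2)\<bar> \<le> 2 * (1 + M) * \<bar>x - y\<bar>"
proof -
  have "(1 - (1 + c) * (sin x)\<^sup>2) - (1 - (1 + c) * (sin y)\<^sup>2) = (1 + c) * ((sin y - sin x) * (sin y + sin x))"
    by (simp add: algebra_simps power2_eq_square)
  also have "\<bar>\<dots>\<bar> = \<bar>1 + c\<bar> * (\<bar>sin y - sin x\<bar> * \<bar>sin y + sin x\<bar>)" by (simp add: abs_mult)
  also have "\<dots> \<le> (1 + M) * (\<bar>x - y\<bar> * 2)"
  proof (intro mult_mono)
    show "\<bar>sin y - sin x\<bar> \<le> \<bar>x - y\<bar>" using sin_lipschitz[of y x] by simp
    have "\<bar>sin y + sin x\<bar> \<le> \<bar>sin y\<bar> + \<bar>sin x\<bar>" by (rule abs_triangle_ineq)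
    then show "\<bar>sin y + sin x\<bar> \<le> 2" using abs_sin_le_one[of x] abs_sin_le_one[of y] by linarith
  qed (use assms in auto)
  finally show ?thesis by (simp add: algebra_simps)
qed

text \<open>Banach's fixed point theorem for the integral equation, in the space of bounded
  continuous functions on the line. The right-hand side is globally Lipschitz in the angle, so no
  continuation of local solutions is required.\<close>

lemma pruefer_exists:
  assumes q: "tame q" and ab: "a < b"
  shows "\<exists>th. pruefer q a b g th"
proof -
  obtain M where M: "M > 0" "\<And>x. \<bar>q x\<bar> \<le> M" using tame_bound[OF q] by auto
  define K where "K = 2 * (1 + M)"
  have K: "K > 0" using M by (simp add: K_def)
  \<comment> \<open>Clamping to the interval turns functions on \<open>{a..b}\<close> into bounded
    functions on the whole line.\<close>
  define c where "c x = max a (min b x)" for x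
  have c: "a \<le> c x" "c x \<le> b" for x using ab by (auto simp: c_def)
  have c_id: "c x = x" if "x \<in> {a..b}" for x using that by (auto simp: c_def)
  have c_cont: "continuous_on UNIV c" unfolding c_def by (intro continuous_intros)
  \<comment> \<open>The exponential weight makes the Picard operator a contraction on the whole interval.\<close>
  define A where "A \<phi> t = g + exp (2 * K * (t - a)) * \<phi> t" for \<phi> :: "real \<Rightarrow> real" and t
  define f where "f \<phi> t = 1 - (1 + q t) * (sin (A \<phi> t))\<^sup>2" for \<phi> :: "real \<Rightarrow> real" and t
  define G where "G \<phi> x = exp (- (2 * K * (c x - a))) * integral {a..c x} (f \<phi>)" for \<phi> x
  have int: "f \<phi> integrable_on {a..d}" if "continuous_on UNIV \<phi>" for \<phi> d
  proof -
    have cs: "continuous_on {a..d} (\<lambda>t. (sin (A \<phi> t))\<^sup>2)"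
      unfolding A_def by (intro continuous_intros continuous_on_subset[OF that]) auto
    have "(\<lambda>t. 1 - (sin (A \<phi> t))\<^sup>2) integrable_on {a..d}"
      by (intro integrable_continuous_real continuous_intros cs)
    then have "(\<lambda>t. (1 - (sin (A \<phi> t))\<^sup>2) - q t * (sin (A \<phi> t))\<^sup>2) integrable_on {a..d}"
      by (rule integrable_diff) (rule tame_times_continuous_integrable[OF q cs])
    then show ?thesis by (simp add: f_def[abs_def] algebra_simps)
  qed
  have Gc: "G \<phi> \<in> bcontfun" if "continuous_on UNIV \<phi>" for \<phi>
  proof (rule bcontfun_normI)
    have "continuous_on {a..b} (\<lambda>x. integral {a..x} (f \<phi>))"
      by (rule indefinite_integral_continuous_1[OF int[OF that]])
    then have "continuous_on UNIV (\<lambda>x. integral {a..c x} (f \<phi>))"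
      by (rule continuous_on_compose2[OF _ c_cont]) (use c in auto)
    then show "continuous_on UNIV (G \<phi>)" unfolding G_def by (intro continuous_intros c_cont)
    show "norm (G \<phi> x) \<le> 1 * ((2 + M) * (b - a))" for x
      unfolding G_def norm_mult
    proof (intro mult_mono)
      have "norm (integral {a..c x} (f \<phi>)) \<le> integral {a..c x} (\<lambda>_. 2 + M)"
      proof (rule integral_norm_bound_integral)
        fix t
        have "\<bar>f \<phi> t\<bar> \<le> 1 + \<bar>1 + q t\<bar> * (sin (A \<phi> t))\<^sup>2" unfolding f_def
          by (rule order_trans[OF abs_triangle_ineq4]) (simp add: abs_mult)
        also have "\<dots> \<le> 1 + (1 + M) * 1"
          using M(2)[of t] M(1) abs_square_le_1[of "sin (A \<phi> t)"]
          by (intro add_left_mono mult_mono) auto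
        finally show "norm (f \<phi> t) \<le> 2 + M" by simp
      qed (use int[OF that] in auto)
      also have "\<dots> = (2 + M) * (c x - a)" using c[of x] by simp
      also have "\<dots> \<le> (2 + M) * (b - a)" using c[of x] M by (intro mult_left_mono) auto
      finally show "norm (integral {a..c x} (f \<phi>)) \<le> (2 + M) * (b - a)" .
    qed (use c[of x] K in auto)
  qed
  define H where "H \<phi> = Bcontfun (G (apply_bcontfun \<phi>))" for \<phi>
  have H: "apply_bcontfun (H \<phi>) = G (apply_bcontfun \<phi>)" for \<phi>
    unfolding H_def by (rule Bcontfun_inverse) (rule Gc, simp)
  have contr: "dist (H \<phi>) (H \<psi>) \<le> 1/2 * dist \<phi> \<psi>" for \<phi> \<psi> :: "real \<Rightarrow>\<^sub>C real"
  proof (rule dist_bound)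
    fix x
    let ?d = "dist \<phi> \<psi>"
    have i1: "f \<phi> integrable_on {a..c x}" "f \<psi> integrable_on {a..c x}"
      by (auto intro: int)
    have der: "((\<lambda>t. ?d / 2 * exp (2 * K * (t - a))) has_real_derivative K * exp (2 * K * (t - a)) * ?d) (at t within {a..c x})" for t
      by (auto intro!: derivative_eq_intros)
    \<comment> \<open>The weight grows at rate \<open>2 K\<close> against a Lipschitz constant
      \<open>K\<close>; the quotient is the contraction factor \<open>1/2\<close>.\<close>
    have hi: "((\<lambda>t. K * exp (2 * K * (t - a)) * ?d) has_integral
        ?d / 2 * exp (2 * K * (c x - a)) - ?d / 2 * exp (2 * K * (a - a))) {a..c x}"
      by (rule fundamental_theorem_of_calculus) (use c der in \<open>auto simp: has_real_derivative_iff_has_vector_derivative\<close>)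
    have "norm (integral {a..c x} (\<lambda>t. f \<phi> t - f \<psi> t)) \<le> integral {a..c x} (\<lambda>t. K * exp (2 * K * (t - a)) * ?d)"
    proof (rule integral_norm_bound_integral)
      show "(\<lambda>t. f \<phi> t - f \<psi> t) integrable_on {a..c x}" using i1 by (rule integrable_diff)
      show "(\<lambda>t. K * exp (2 * K * (t - a)) * ?d) integrable_on {a..c x}" using hi by blast
      fix t
      have "\<bar>f \<phi> t - f \<psi> t\<bar> \<le> K * \<bar>A \<phi> t - A \<psi> t\<bar>"
        unfolding f_def K_def by (rule pruefer_rhs_lipschitz) (rule M)
      also have "\<bar>A \<phi> t - A \<psi> t\<bar> = exp (2 * K * (t - a)) * \<bar>\<phi> t - \<psi> t\<bar>"
        unfolding A_def by (simp add: abs_mult right_diff_distrib[symmetric])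
      also have "\<bar>\<phi> t - \<psi> t\<bar> \<le> ?d"
        using dist_bounded[of \<phi> t \<psi>] by (simp add: dist_real_def)
      finally show "norm (f \<phi> t - f \<psi> t) \<le> K * exp (2 * K * (t - a)) * ?d"
        using K by simp
    qed
    also have "\<dots> = ?d / 2 * exp (2 * K * (c x - a)) - ?d / 2"
      using integral_unique[OF hi] by simp
    also have "\<dots> \<le> ?d / 2 * exp (2 * K * (c x - a))" by simp
    finally have 1: "\<bar>integral {a..c x} (f \<phi>) - integral {a..c x} (f \<psi>)\<bar> \<le> ?d / 2 * exp (2 * K * (c x - a))"
      using integral_diff[OF i1] by simp
    have "dist (G \<phi> x) (G \<psi> x) = exp (- (2 * K * (c x - a))) * \<bar>integral {a..c x} (f \<phi>) - integral {a..c x} (f \<psi>)\<bar>"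
      unfolding G_def dist_real_def by (simp add: abs_mult right_diff_distrib[symmetric])
    also have "\<dots> \<le> exp (- (2 * K * (c x - a))) * (?d / 2 * exp (2 * K * (c x - a)))"
      using 1 by (intro mult_left_mono) auto
    also have "\<dots> = 1/2 * ?d" by (simp add: exp_minus)
    finally show "dist (apply_bcontfun (H \<phi>) x) (apply_bcontfun (H \<psi>) x) \<le> 1/2 * ?d" unfolding H .
  qed
  have "\<exists>!\<phi>. H \<phi> = \<phi>"
    by (rule banach_fix_type[of "1/2"]) (use contr in auto)
  then obtain \<phi> where \<phi>: "H \<phi> = \<phi>" by auto
  define th where "th = A (apply_bcontfun \<phi>)"
  have th_eq: "th x = g + integral {a..x} (f \<phi>)" if "x \<in> {a..b}" for x
  proof -
    have "apply_bcontfun \<phi> x = G \<phi> x" using H[of \<phi>] \<phi> by simp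
    then have "th x = g + exp (2 * K * (x - a)) * (exp (- (2 * K * (x - a))) * integral {a..x} (f \<phi>))"
      unfolding th_def A_def using c_id[OF that] by (simp add: G_def)
    then show ?thesis by (simp add: exp_minus)
  qed
  have th_cont: "continuous_on S th" for S unfolding th_def A_def by (intro continuous_intros) auto
  have "pruefer q a b g th"
    unfolding pruefer_def
  proof (intro conjI exI[of _ "{x. \<not> isCont q x}"] allI impI)
    show "continuous_on {a..b} th" by (rule th_cont)
    show "th a = g" using th_eq[of a] ab by simp
    show "countable {x. \<not> isCont q x}" using q by (simp add: tame_def)
    fix x assume x: "a < x \<and> x < b \<and> x \<notin> {x. \<not> isCont q x}"
    have ct: "isCont th x" using th_cont[of UNIV] by (simp add: continuous_on_eq_continuous_at)
    have ff: "f \<phi> = (\<lambda>t. 1 - (1 + q t) * (sin (th t))\<^sup>2)" by (simp add: f_def[abs_def] th_def)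
    have "isCont (f \<phi>) x" unfolding ff using x by (intro continuous_intros ct) auto
    then have "((\<lambda>x. integral {a..x} (f \<phi>)) has_real_derivative f \<phi> x) (at x)"
      using x by (intro integral_deriv_interior[of _ a b] int) auto
    then have "((\<lambda>x. g + integral {a..x} (f \<phi>)) has_real_derivative f \<phi> x) (at x)"
      by (auto intro!: derivative_eq_intros)
    then have "(th has_real_derivative f \<phi> x) (at x)"
      by (rule has_field_derivative_transform_within_open[of _ _ _ "{a<..<b}"]) (use x th_eq in auto)
    then show "(th has_real_derivative 1 - (1 + q x) * (sin (th x))\<^sup>2) (at x)" by (simp add: ff)
  qed
  then show ?thesis by blast
qed

section \<open>Differential inequalities and comparison of Pruefer angles\<close>

text \<open>Beyond the last point with \<open>D \<ge> 0\<close> the function is negative, the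
  inequality reads \<open>D' \<ge> K D\<close>, and \<open>exp (- K t) D\<close> cannot decrease
  from a nonnegative value to a negative one.\<close>

lemma diff_ineq_nonneg:
  fixes D :: "real \<Rightarrow> real"
  assumes cont: "continuous_on {a..b} D" and S: "countable S" and init: "D a \<ge> 0"
    and der: "\<And>x. a < x \<Longrightarrow> x < b \<Longrightarrow> x \<notin> S \<Longrightarrow> \<exists>d. (D has_real_derivative d) (at x) \<and> d \<ge> - (K * \<bar>D x\<bar>)"
    and x: "x \<in> {a..b}"
  shows "D x \<ge> 0"
proof (rule ccontr)
  assume neg: "\<not> D x \<ge> 0"
  have cx: "continuous_on {a..x} D" by (rule continuous_on_subset[OF cont]) (use x in auto)
  obtain c where ca: "a \<le> c" "c \<le> x" "D c \<in> {0..}" and after': "\<And>t. c < t \<Longrightarrow> t \<le> x \<Longrightarrow> D t \<notin> {0..}"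
    by (rule last_point_in_closed[OF cx closed_atLeast, of a 0]) (use init x in auto)
  have after: "D t < 0" if "c < t" "t \<le> x" for t using after'[OF that] by simp
  have "exp (- (K * c)) * D c \<le> exp (- (K * x)) * D x"
  proof (rule nondecreasing_off_countable[of c x "\<lambda>t. exp (- (K * t)) * D t" S])
    show "continuous_on {c..x} (\<lambda>t. exp (- (K * t)) * D t)"
      by (intro continuous_intros continuous_on_subset[OF cx]) (use ca in auto)
    fix t assume t: "c < t" "t < x" "t \<notin> S"
    then obtain d where d: "(D has_real_derivative d) (at t)" "d \<ge> - (K * \<bar>D t\<bar>)"
      using der[of t] ca x by auto
    have "D t < 0" using after t by simp
    then have "d - K * D t \<ge> 0" using d(2) by simp
    moreover have "((\<lambda>t. exp (- (K * t)) * D t) has_real_derivative exp (- (K * t)) * (d - K * D t)) (at t)"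
      by (auto intro!: derivative_eq_intros d(1) simp: algebra_simps)
    ultimately show "\<exists>d\<ge>0. ((\<lambda>t. exp (- (K * t)) * D t) has_real_derivative d) (at t)"
      by (intro exI[of _ "exp (- (K * t)) * (d - K * D t)"]) simp
  qed (use ca S in auto)
  moreover have "exp (- (K * c)) * D c \<ge> 0" using ca by simp
  moreover have "exp (- (K * x)) * D x < 0" using neg by (simp add: mult_pos_neg)
  ultimately show False by linarith
qed

text \<open>Once \<open>D \<ge> 0\<close> is known the inequality reads
  \<open>D' \<ge> - K D\<close>, so \<open>exp (K t) D\<close> is nondecreasing; a zero of
  \<open>D\<close> therefore forces zeros everywhere to its left.\<close>

lemma diff_ineq_touch:
  fixes D :: "real \<Rightarrow> real"
  assumes cont: "continuous_on {a..b} D" and S: "countable S" and init: "D a \<ge> 0"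
    and der: "\<And>x. a < x \<Longrightarrow> x < b \<Longrightarrow> x \<notin> S \<Longrightarrow> \<exists>d. (D has_real_derivative d) (at x) \<and> d \<ge> - (K * \<bar>D x\<bar>)"
    and x: "x \<in> {a..b}" "D x = 0" and t: "t \<in> {a..x}"
  shows "D t = 0"
proof -
  have nn: "D z \<ge> 0" if "z \<in> {a..b}" for z
    by (rule diff_ineq_nonneg[OF cont S init der that])
  have "exp (K * t) * D t \<le> exp (K * x) * D x"
  proof (rule nondecreasing_off_countable[of t x "\<lambda>t. exp (K * t) * D t" S])
    show "continuous_on {t..x} (\<lambda>t. exp (K * t) * D t)"
      by (intro continuous_intros continuous_on_subset[OF cont]) (use t x in auto)
    fix s assume s: "t < s" "s < x" "s \<notin> S"
    then obtain d where d: "(D has_real_derivative d) (at s)" "d \<ge> - (K * \<bar>D s\<bar>)"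
      using der[of s] t x by auto
    have "D s \<ge> 0" using nn s t x by auto
    then have "d + K * D s \<ge> 0" using d(2) by simp
    moreover have "((\<lambda>t. exp (K * t) * D t) has_real_derivative exp (K * s) * (d + K * D s)) (at s)"
      by (auto intro!: derivative_eq_intros d(1) simp: algebra_simps)
    ultimately show "\<exists>d\<ge>0. ((\<lambda>t. exp (K * t) * D t) has_real_derivative d) (at s)"
      by (intro exI[of _ "exp (K * s) * (d + K * D s)"]) simp
  qed (use t S in auto)
  then have "exp (K * t) * D t \<le> 0" using x by simp
  moreover have "D t \<ge> 0" using nn t x by auto
  ultimately show ?thesis by (simp add: mult_le_0_iff)
qed

text \<open>The difference of the right-hand sides splits into a Lipschitz part in the angle and a
  part caused by the potentials. The lower bound keeps the factor \<open>sin^2\<close>, which strict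
  comparison needs; the upper bound drops it and serves continuity in the parameter.\<close>

lemma pruefer_diff:
  assumes p1: "pruefer q1 a b g1 th1" and p2: "pruefer q2 a b g2 th2"
    and q: "\<And>x. a < x \<Longrightarrow> x < b \<Longrightarrow> q2 x \<le> q1 x" and M: "\<And>x. a < x \<Longrightarrow> x < b \<Longrightarrow> \<bar>q1 x\<bar> \<le> M"
  obtains S where "countable S" "continuous_on {a..b} (\<lambda>x. th2 x - th1 x)"
    "\<And>x. a < x \<Longrightarrow> x < b \<Longrightarrow> x \<notin> S \<Longrightarrow> \<exists>d. ((\<lambda>x. th2 x - th1 x) has_real_derivative d) (at x) \<and>
       d \<ge> - (2 * (1 + M) * \<bar>th2 x - th1 x\<bar>) + (q1 x - q2 x) * (sin (th2 x))\<^sup>2 \<and>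
       d \<le> 2 * (1 + M) * \<bar>th2 x - th1 x\<bar> + (q1 x - q2 x)"
proof -
  from p1 obtain S where S: "countable S" "continuous_on {a..b} th1"
    "\<And>x. a < x \<Longrightarrow> x < b \<Longrightarrow> x \<notin> S \<Longrightarrow> (th1 has_real_derivative 1 - (1 + q1 x) * (sin (th1 x))\<^sup>2) (at x)"
    by (rule prueferE) blast
  from p2 obtain T where T: "countable T" "continuous_on {a..b} th2"
    "\<And>x. a < x \<Longrightarrow> x < b \<Longrightarrow> x \<notin> T \<Longrightarrow> (th2 has_real_derivative 1 - (1 + q2 x) * (sin (th2 x))\<^sup>2) (at x)"
    by (rule prueferE) blast
  show ?thesis
  proof (rule that[of "S \<union> T"])
    show "countable (S \<union> T)" using S T by simp
    show "continuous_on {a..b} (\<lambda>x. th2 x - th1 x)" using S T by (intro continuous_intros)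
    fix x assume x: "a < x" "x < b" "x \<notin> S \<union> T"
    let ?d = "(1 - (1 + q2 x) * (sin (th2 x))\<^sup>2) - (1 - (1 + q1 x) * (sin (th1 x))\<^sup>2)"
    have der: "((\<lambda>x. th2 x - th1 x) has_real_derivative ?d) (at x)"
      using S(3)[of x] T(3)[of x] x by (auto intro!: derivative_eq_intros)
    have e: "?d = ((1 - (1 + q1 x) * (sin (th2 x))\<^sup>2) - (1 - (1 + q1 x) * (sin (th1 x))\<^sup>2)) + (q1 x - q2 x) * (sin (th2 x))\<^sup>2"
      by (simp add: algebra_simps)
    have l: "\<bar>(1 - (1 + q1 x) * (sin (th2 x))\<^sup>2) - (1 - (1 + q1 x) * (sin (th1 x))\<^sup>2)\<bar> \<le> 2 * (1 + M) * \<bar>th2 x - th1 x\<bar>"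
      by (rule pruefer_rhs_lipschitz) (use M x in auto)
    have "(q1 x - q2 x) * (sin (th2 x))\<^sup>2 \<le> (q1 x - q2 x) * 1"
      using q[of x] x abs_square_le_1[of "sin (th2 x)"] by (intro mult_left_mono) auto
    then show "\<exists>d. ((\<lambda>x. th2 x - th1 x) has_real_derivative d) (at x) \<and>
       d \<ge> - (2 * (1 + M) * \<bar>th2 x - th1 x\<bar>) + (q1 x - q2 x) * (sin (th2 x))\<^sup>2 \<and>
       d \<le> 2 * (1 + M) * \<bar>th2 x - th1 x\<bar> + (q1 x - q2 x)"
      using der abs_le_D1[OF l] abs_le_D2[OF l] unfolding e
      by (intro exI conjI) (assumption, auto simp del: distrib_left_numeral)
  qed
qed

lemma pruefer_compare:
  assumes p1: "pruefer q1 a b g1 th1" and p2: "pruefer q2 a b g2 th2"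
    and q: "\<And>x. a < x \<Longrightarrow> x < b \<Longrightarrow> q2 x \<le> q1 x" and q1: "tame q1" and g: "g1 \<le> g2" and x: "x \<in> {a..b}"
  shows "th1 x \<le> th2 x"
proof -
  obtain M where M: "M > 0" "\<And>x. \<bar>q1 x\<bar> \<le> M" using tame_bound[OF q1] by auto
  obtain S where S: "countable S" "continuous_on {a..b} (\<lambda>x. th2 x - th1 x)"
    "\<And>x. a < x \<Longrightarrow> x < b \<Longrightarrow> x \<notin> S \<Longrightarrow> \<exists>d. ((\<lambda>x. th2 x - th1 x) has_real_derivative d) (at x) \<and>
       d \<ge> - (2 * (1 + M) * \<bar>th2 x - th1 x\<bar>) + (q1 x - q2 x) * (sin (th2 x))\<^sup>2 \<and>
       d \<le> 2 * (1 + M) * \<bar>th2 x - th1 x\<bar> + (q1 x - q2 x)"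
    by (rule pruefer_diff[OF p1 p2 q M(2)]) blast+
  have "th2 x - th1 x \<ge> 0"
  proof (rule diff_ineq_nonneg[OF S(2,1) _ _ x, of "2 * (1 + M)"])
    show "0 \<le> th2 a - th1 a" using p1 p2 g by (simp add: pruefer_def)
    fix y assume y: "a < y" "y < b" "y \<notin> S"
    have "0 \<le> (q1 y - q2 y) * (sin (th2 y))\<^sup>2" using q[of y] y by simp
    then show "\<exists>d. ((\<lambda>x. th2 x - th1 x) has_real_derivative d) (at y) \<and> - (2 * (1 + M) * \<bar>th2 y - th1 y\<bar>) \<le> d"
      using S(3)[OF y] by (elim exE conjE) (intro exI conjI, assumption, linarith)
  qed
  then show ?thesis by simp
qed

text \<open>At multiples of \<open>pi\<close> the right-hand side equals 1 whatever the potential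
  is, so these levels are crossed upwards only. Staying on the level is excluded because its
  derivative would be 0 and not 1.\<close>

lemma pruefer_crossing:
  fixes k :: int
  assumes p: "pruefer q a b g th" and q: "tame q" and x: "a \<le> x" "x < y" "y \<le> b" and ge: "th x \<ge> of_int k * pi"
  shows "th y > of_int k * pi"
proof -
  obtain M where M: "M > 0" "\<And>x. \<bar>q x\<bar> \<le> M" using tame_bound[OF q] by auto
  from pruefer_subinterval[OF p x(1,3)] obtain S where S: "countable S" "continuous_on {x..y} th"
    "\<And>t. x < t \<Longrightarrow> t < y \<Longrightarrow> t \<notin> S \<Longrightarrow> (th has_real_derivative 1 - (1 + q t) * (sin (th t))\<^sup>2) (at t)"
    by (rule prueferE) blast
  let ?D = "\<lambda>t. th t - of_int k * pi"
  have cont: "continuous_on {x..y} ?D" by (intro continuous_intros S)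
  have init: "?D x \<ge> 0" using ge by simp
  have sk: "sin (of_int k * pi) = 0" by (simp add: sin_zero_iff_int2)
  have der: "\<exists>d. (?D has_real_derivative d) (at t) \<and> d \<ge> - (2 * (1 + M) * \<bar>?D t\<bar>)"
    if t: "x < t" "t < y" "t \<notin> S" for t
  proof (intro exI conjI)
    show "(?D has_real_derivative 1 - (1 + q t) * (sin (th t))\<^sup>2) (at t)"
      using S(3)[OF t] by (auto intro!: derivative_eq_intros)
    show "- (2 * (1 + M) * \<bar>?D t\<bar>) \<le> 1 - (1 + q t) * (sin (th t))\<^sup>2"
      using pruefer_rhs_lipschitz[OF M(2)[of t], of "th t" "of_int k * pi"] sk by simp
  qed
  have nn: "?D y \<ge> 0"
    by (rule diff_ineq_nonneg[OF cont S(1) init der]) (use x in auto)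
  moreover have "?D y \<noteq> 0"
  proof
    assume z: "?D y = 0"
    have zero: "?D t = 0" if "t \<in> {x..y}" for t
      by (rule diff_ineq_touch[OF cont S(1) init der _ z that]) (use x in auto)
    obtain t where t: "x < t" "t < y" "t \<notin> S" using ex_off_countable[OF x(2) S(1)] by auto
    have "sin (th t) = 0" using zero[of t] t sk by simp
    then have d1: "(th has_real_derivative 1) (at t)" using S(3)[OF t] by simp
    have "((\<lambda>_. of_int k * pi) has_real_derivative 1) (at t)"
      by (rule has_field_derivative_transform_within_open[OF d1, of "{x<..<y}"]) (use zero t in auto)
    then have "(1::real) = 0" by (rule DERIV_unique) simp
    then show False by simp
  qed
  ultimately show ?thesis by simp
qed

text \<open>Equality at \<open>b\<close> propagates back over the whole interval; then
  \<open>(q1 - q2) sin^2 = 0\<close> makes the sine vanish identically, while an angle at a multiple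
  of \<open>pi\<close> moves with speed 1.\<close>

lemma pruefer_strict:
  assumes p1: "pruefer q1 a b g th1" and p2: "pruefer q2 a b g th2"
    and q: "\<And>x. a < x \<Longrightarrow> x < b \<Longrightarrow> q2 x < q1 x" and q1: "tame q1" and ab: "a < b"
  shows "th1 b < th2 b"
proof -
  obtain M where M: "M > 0" "\<And>x. \<bar>q1 x\<bar> \<le> M" using tame_bound[OF q1] by auto
  obtain S where S: "countable S" "continuous_on {a..b} (\<lambda>x. th2 x - th1 x)"
    "\<And>x. a < x \<Longrightarrow> x < b \<Longrightarrow> x \<notin> S \<Longrightarrow> \<exists>d. ((\<lambda>x. th2 x - th1 x) has_real_derivative d) (at x) \<and>
       d \<ge> - (2 * (1 + M) * \<bar>th2 x - th1 x\<bar>) + (q1 x - q2 x) * (sin (th2 x))\<^sup>2 \<and>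
       d \<le> 2 * (1 + M) * \<bar>th2 x - th1 x\<bar> + (q1 x - q2 x)"
    by (rule pruefer_diff[OF p1 p2 less_imp_le[OF q] M(2)]) blast+
  from p2 obtain T where T: "countable T" "continuous_on {a..b} th2"
    "\<And>x. a < x \<Longrightarrow> x < b \<Longrightarrow> x \<notin> T \<Longrightarrow> (th2 has_real_derivative 1 - (1 + q2 x) * (sin (th2 x))\<^sup>2) (at x)"
    by (rule prueferE) blast
  have le: "th1 b \<le> th2 b"
    by (rule pruefer_compare[OF p1 p2 less_imp_le[OF q] q1]) (use ab in auto)
  moreover have "th1 b \<noteq> th2 b"
  proof
    assume eq: "th1 b = th2 b"
    have zero: "th2 t - th1 t = 0" if "t \<in> {a..b}" for t
    proof (rule diff_ineq_touch[OF S(2,1) _ _ _ _ that, of "2 * (1 + M)"])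
      show "0 \<le> th2 a - th1 a" using p1 p2 by (simp add: pruefer_def)
      fix y assume y: "a < y" "y < b" "y \<notin> S"
      have "0 \<le> (q1 y - q2 y) * (sin (th2 y))\<^sup>2" using q[of y] y by simp
      then show "\<exists>d. ((\<lambda>x. th2 x - th1 x) has_real_derivative d) (at y) \<and> - (2 * (1 + M) * \<bar>th2 y - th1 y\<bar>) \<le> d"
        using S(3)[OF y] by (elim exE conjE) (intro exI conjI, assumption, linarith)
    qed (use eq ab in auto)
    have sin0: "sin (th2 t) = 0" if t: "a < t" "t < b" "t \<notin> S" for t
    proof -
      obtain d where d: "((\<lambda>x. th2 x - th1 x) has_real_derivative d) (at t)"
        "d \<ge> - (2 * (1 + M) * \<bar>th2 t - th1 t\<bar>) + (q1 t - q2 t) * (sin (th2 t))\<^sup>2"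
        using S(3)[OF t] by auto
      have "((\<lambda>_. 0) has_real_derivative d) (at t)"
        by (rule has_field_derivative_transform_within_open[OF d(1), of "{a<..<b}"]) (use zero t in auto)
      then have "d = 0" by (rule DERIV_unique) simp
      then have "(q1 t - q2 t) * (sin (th2 t))\<^sup>2 \<le> 0" using d(2) zero[of t] t by simp
      then show ?thesis using q[OF t(1,2)] by (simp add: mult_le_0_iff)
    qed
    obtain t where t: "a < t" "t < b" "t \<notin> S \<union> T" using ex_off_countable[OF ab, of "S \<union> T"] S T by auto
    have d1: "(th2 has_real_derivative 1) (at t)" using T(3)[of t] sin0[of t] t by simp
    have "isCont (\<lambda>x. sin (th2 x)) x" if "a < x" "x < b" for x
      using continuous_on_interior[OF T(2), of x] that by (intro continuous_intros) simp
    then have all0: "sin (th2 x) = 0" if "a < x" "x < b" for x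
      using zero_off_countable[OF S(1), of a b "\<lambda>x. sin (th2 x)" x] sin0 that by blast
    have "((\<lambda>x. sin (th2 x)) has_real_derivative cos (th2 t)) (at t)"
      using DERIV_chain2[OF DERIV_sin d1] by simp
    then have "((\<lambda>_. 0) has_real_derivative cos (th2 t)) (at t)"
      by (rule has_field_derivative_transform_within_open[of _ _ _ "{a<..<b}"]) (use all0 t in auto)
    then have "cos (th2 t) = 0" by (rule DERIV_unique) simp
    then show False using all0[of t] t sin_cos_squared_add[of "th2 t"] by simp
  qed
  ultimately show ?thesis by simp
qed

text \<open>Gronwall again; it makes the end angle continuous in the spectral parameter.\<close>

lemma pruefer_lipschitz:
  assumes p1: "pruefer q1 a b g th1" and p2: "pruefer q2 a b g th2" and ab: "a < b"
    and q: "\<And>x. a < x \<Longrightarrow> x < b \<Longrightarrow> q2 x \<le> q1 x" "\<And>x. a < x \<Longrightarrow> x < b \<Longrightarrow> q1 x \<le> q2 x + d"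
    and M: "\<And>x. \<bar>q1 x\<bar> \<le> M" and q1: "tame q1"
  shows "th2 b - th1 b \<le> d * (b - a) * exp (2 * (1 + M) * (b - a))"
proof -
  obtain S where S: "countable S" "continuous_on {a..b} (\<lambda>x. th2 x - th1 x)"
    "\<And>x. a < x \<Longrightarrow> x < b \<Longrightarrow> x \<notin> S \<Longrightarrow> \<exists>d. ((\<lambda>x. th2 x - th1 x) has_real_derivative d) (at x) \<and>
       d \<ge> - (2 * (1 + M) * \<bar>th2 x - th1 x\<bar>) + (q1 x - q2 x) * (sin (th2 x))\<^sup>2 \<and>
       d \<le> 2 * (1 + M) * \<bar>th2 x - th1 x\<bar> + (q1 x - q2 x)"
    by (rule pruefer_diff[OF p1 p2 q(1) M]) blast+
  have d: "0 \<le> d" using q(1)[of "(a+b)/2"] q(2)[of "(a+b)/2"] ab by simp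
  have M0: "0 \<le> M" using M[of 0] by simp
  define K where "K = 2 * (1 + M)"
  have K: "0 \<le> K" using M0 by (simp add: K_def)
  define D where "D x = th2 x - th1 x" for x
  define G where "G x = exp (- (K * (x - a))) * D x - d * (x - a)" for x
  have "G b \<le> G a"
  proof (rule nonincreasing_off_countable[of a b G S])
    show "continuous_on {a..b} G" unfolding G_def D_def by (intro continuous_intros S)
    fix x assume x: "a < x" "x < b" "x \<notin> S"
    have Dx: "D x \<ge> 0" using pruefer_compare[OF p1 p2 q(1) q1, of x] x by (simp add: D_def)
    obtain e where e: "(D has_real_derivative e) (at x)" "e \<le> K * \<bar>D x\<bar> + (q1 x - q2 x)"
      using S(3)[OF x] unfolding D_def[abs_def] K_def by blast
    have "(G has_real_derivative exp (- (K * (x - a))) * (e - K * D x) - d) (at x)"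
      unfolding G_def by (auto intro!: derivative_eq_intros e(1) simp: algebra_simps)
    moreover have "exp (- (K * (x - a))) * (e - K * D x) \<le> 1 * d"
    proof -
      have "exp (- (K * (x - a))) * (e - K * D x) \<le> exp (- (K * (x - a))) * d"
        using e(2) Dx q(2)[of x] x by (intro mult_left_mono) auto
      also have "\<dots> \<le> 1 * d" using d x K by (intro mult_right_mono) auto
      finally show ?thesis .
    qed
    ultimately show "\<exists>d\<le>0. (G has_real_derivative d) (at x)"
      by (intro exI[of _ "exp (- (K * (x - a))) * (e - K * D x) - d"]) auto
  qed (use ab S in auto)
  also have "G a = 0" using p1 p2 by (simp add: G_def D_def pruefer_def)
  finally have "exp (- (K * (b - a))) * D b \<le> d * (b - a)" by (simp add: G_def)
  then have "exp (K * (b - a)) * (exp (- (K * (b - a))) * D b) \<le> exp (K * (b - a)) * (d * (b - a))"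
    by (intro mult_left_mono) auto
  moreover have "exp (K * (b - a)) * (exp (- (K * (b - a))) * D b) = D b" by (simp add: exp_minus)
  ultimately have "D b \<le> d * (b - a) * exp (K * (b - a))" by (simp only: ac_simps)
  then show ?thesis by (simp only: D_def K_def)
qed

section \<open>Existence and nodal characterisation of the first two eigenvalues\<close>

text \<open>The amplitude of the polar form solves the linear equation
  \<open>R' = (1 + q) sin cos R\<close>, so it is an explicit exponential and never
  vanishes.\<close>

lemma pruefer_sol:
  assumes p: "pruefer q a b g th" and q: "tame q" and ab: "a < b"
  obtains R where "R a = 1" "\<And>x. R x > (0::real)"
    "sol q a b (\<lambda>x. R x * sin (th x)) (\<lambda>x. R x * cos (th x))"
proof -
  from p obtain S where S: "countable S" "continuous_on {a..b} th" "th a = g"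
    "\<And>x. a < x \<Longrightarrow> x < b \<Longrightarrow> x \<notin> S \<Longrightarrow> (th has_real_derivative 1 - (1 + q x) * (sin (th x))\<^sup>2) (at x)"
    by (rule prueferE) blast
  define f where "f t = (1 + q t) * (sin (th t) * cos (th t))" for t
  define R where "R x = exp (integral {a..x} f)" for x
  have sc: "continuous_on {a..b} (\<lambda>t. sin (th t) * cos (th t))" by (intro continuous_intros S)
  have "(\<lambda>t. sin (th t) * cos (th t) + q t * (sin (th t) * cos (th t))) integrable_on {a..b}"
    by (intro integrable_add integrable_continuous_real sc tame_times_continuous_integrable q)
  then have int: "f integrable_on {a..b}" by (simp add: f_def[abs_def] algebra_simps)
  have Rc: "continuous_on {a..b} R"
    unfolding R_def by (intro continuous_intros indefinite_integral_continuous_1[OF int])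
  show ?thesis
  proof (rule that[of R])
    show "R a = 1" by (simp add: R_def)
    show "R x > 0" for x by (simp add: R_def)
    show "sol q a b (\<lambda>x. R x * sin (th x)) (\<lambda>x. R x * cos (th x))"
    proof (rule solI[of _ _ _ _ "S \<union> {x. \<not> isCont q x}"])
      show "continuous_on {a..b} (\<lambda>x. R x * sin (th x))" "continuous_on {a..b} (\<lambda>x. R x * cos (th x))"
        by (intro continuous_intros Rc S)+
      show "countable (S \<union> {x. \<not> isCont q x})" using S q by (simp add: tame_def)
      fix x assume x: "a < x" "x < b" "x \<notin> S \<union> {x. \<not> isCont q x}"
      have d: "(th has_real_derivative 1 - (1 + q x) * (sin (th x))\<^sup>2) (at x)" using S(4)[of x] x by simp
      have "isCont f x" unfolding f_def using x DERIV_isCont[OF d] by (intro continuous_intros) auto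
      then have "((\<lambda>x. integral {a..x} f) has_real_derivative f x) (at x)"
        using x by (intro integral_deriv_interior[OF int]) auto
      then have Rd: "(R has_real_derivative R x * f x) (at x)"
        unfolding R_def by (auto intro!: derivative_eq_intros)
      have cs: "(cos (th x))\<^sup>2 = 1 - (sin (th x))\<^sup>2" by (simp add: cos_squared_eq)
      have "((\<lambda>x. R x * sin (th x)) has_real_derivative
          R x * f x * sin (th x) + cos (th x) * (1 - (1 + q x) * (sin (th x))\<^sup>2) * R x) (at x)"
        by (auto intro!: derivative_eq_intros Rd d)
      moreover have "R x * f x * sin (th x) + cos (th x) * (1 - (1 + q x) * (sin (th x))\<^sup>2) * R x = R x * cos (th x)"
        by (simp add: f_def algebra_simps power2_eq_square)
      ultimately show "((\<lambda>x. R x * sin (th x)) has_real_derivative R x * cos (th x)) (at x)" by simp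
      have "((\<lambda>x. R x * cos (th x)) has_real_derivative
          R x * f x * cos (th x) + (- sin (th x)) * (1 - (1 + q x) * (sin (th x))\<^sup>2) * R x) (at x)"
        by (auto intro!: derivative_eq_intros Rd d)
      moreover have "R x * f x * cos (th x) + (- sin (th x)) * (1 - (1 + q x) * (sin (th x))\<^sup>2) * R x
         = R x * sin (th x) * ((1 + q x) * (cos (th x))\<^sup>2 - (1 - (1 + q x) * (sin (th x))\<^sup>2))"
        by (simp add: f_def algebra_simps power2_eq_square)
      moreover have "\<dots> = q x * (R x * sin (th x))" unfolding cs by (simp add: algebra_simps)
      ultimately show "((\<lambda>x. R x * cos (th x)) has_real_derivative q x * (R x * sin (th x))) (at x)" by simp
    qed
  qed
qed

text \<open>For a very negative parameter the straight line from \<open>pi - \<delta>\<close> down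
  to \<open>\<delta>\<close> is an upper barrier: along it the sine is at least
  \<open>sin \<delta>\<close>, so the equation pushes angles down faster than the line
  descends.\<close>

lemma pruefer_low:
  assumes q: "tame q" and ab: "a < b" and g: "g < pi" and c: "0 < c"
  shows "\<exists>lam th. pruefer (\<lambda>x. q x - lam) a b g th \<and> th b < c"
proof -
  obtain M where M: "M > 0" "\<And>x. \<bar>q x\<bar> \<le> M" using tame_bound[OF q] by auto
  define \<delta> where "\<delta> = min (min (c / 2) (pi - g)) (pi / 4)"
  have \<delta>: "0 < \<delta>" "\<delta> < c" "g \<le> pi - \<delta>" "\<delta> \<le> pi / 4"
    using g c pi_gt_zero unfolding \<delta>_def by linarith+
  define s where "s = (pi - 2 * \<delta>) / (b - a)"
  have s: "s > 0" using \<delta> ab pi_gt_zero by (simp add: s_def)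
  have sd: "sin \<delta> > 0" using \<delta> pi_gt_zero by (intro sin_gt_zero) auto
  \<comment> \<open>Makes \<open>1 + Q \<ge> (1 + s) / sin^2 \<delta>\<close>, hence the speed on
    the barrier at most \<open>1 - (1 + s) = - s\<close>.\<close>
  define lam where "lam = 1 - M - (1 + s) / (sin \<delta>)\<^sup>2"
  define Q where "Q x = q x - lam" for x
  have tQ: "tame Q" unfolding Q_def by (rule tame_sub_const[OF q])
  have Qge: "1 + Q x \<ge> (1 + s) / (sin \<delta>)\<^sup>2" for x using M(2)[of x] by (simp add: Q_def lam_def abs_le_iff)
  obtain N where N: "N > 0" "\<And>x. \<bar>Q x\<bar> \<le> N" using tame_bound[OF tQ] by auto
  obtain th where th: "pruefer Q a b g th" using pruefer_exists[OF tQ ab] by blast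
  from th obtain S where S: "countable S" "continuous_on {a..b} th" "th a = g"
    "\<And>x. a < x \<Longrightarrow> x < b \<Longrightarrow> x \<notin> S \<Longrightarrow> (th has_real_derivative 1 - (1 + Q x) * (sin (th x))\<^sup>2) (at x)"
    by (rule prueferE) blast
  define l where "l x = pi - \<delta> - s * (x - a)" for x
  have lb: "l b = \<delta>" using ab by (simp add: l_def s_def)
  have "l b - th b \<ge> 0"
  proof (rule diff_ineq_nonneg[of a b "\<lambda>x. l x - th x" S "2 * (1 + N)"])
    show "continuous_on {a..b} (\<lambda>x. l x - th x)" unfolding l_def by (intro continuous_intros S)
    show "0 \<le> l a - th a" using \<delta> S by (simp add: l_def)
    fix x assume x: "a < x" "x < b" "x \<notin> S"
    have "s * (x - a) \<le> s * (b - a)" "s * (x - a) \<ge> 0" using x s by auto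
    then have lx: "\<delta> \<le> l x" "l x \<le> pi - \<delta>" using lb by (auto simp: l_def algebra_simps)
    have "sin \<delta> \<le> sin (l x)"
    proof (cases "l x \<le> pi / 2")
      case True
      then show ?thesis using lx \<delta> by (intro sin_monotone_2pi_le) auto
    next
      case False
      then have "sin \<delta> \<le> sin (pi - l x)" using lx \<delta> by (intro sin_monotone_2pi_le) auto
      then show ?thesis by simp
    qed
    then have "(sin \<delta>)\<^sup>2 \<le> (sin (l x))\<^sup>2" using sd by (intro power_mono) auto
    then have "(1 + s) / (sin \<delta>)\<^sup>2 * (sin \<delta>)\<^sup>2 \<le> (1 + Q x) * (sin (l x))\<^sup>2"
      using Qge[of x] s by (intro mult_mono) (auto intro: order_trans[OF _ Qge])
    then have 1: "1 - (1 + Q x) * (sin (l x))\<^sup>2 \<le> - s" using sd by simp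
    have 2: "(1 - (1 + Q x) * (sin (th x))\<^sup>2) - (1 - (1 + Q x) * (sin (l x))\<^sup>2) \<le> 2 * (1 + N) * \<bar>th x - l x\<bar>"
      using pruefer_rhs_lipschitz[OF N(2)[of x], of "th x" "l x"] by (rule abs_le_D1)
    have 3: "((\<lambda>x. l x - th x) has_real_derivative - s - (1 - (1 + Q x) * (sin (th x))\<^sup>2)) (at x)"
      unfolding l_def using S(4)[OF x] by (auto intro!: derivative_eq_intros)
    have "- (2 * (1 + N) * \<bar>l x - th x\<bar>) \<le> - s - (1 - (1 + Q x) * (sin (th x))\<^sup>2)"
      using 1 2 unfolding abs_minus_commute[of "l x"] by linarith
    then show "\<exists>d. ((\<lambda>x. l x - th x) has_real_derivative d) (at x) \<and> - (2 * (1 + N) * \<bar>l x - th x\<bar>) \<le> d"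
      using 3 by blast
  qed (use S ab in auto)
  then have "th b < c" using lb \<delta> by simp
  then show ?thesis using th unfolding Q_def by blast
qed

text \<open>Sturm comparison with the sine arch spanning \<open>{a..b}\<close>. The arch vanishes at
  both ends, so the strict growth of the Wronskian contradicts the nonnegative end values of
  \<open>u\<close>.\<close>

lemma sturm_oscillation:
  assumes s: "sol q a b u v" and ab: "a < b" and pos: "\<And>x. a < x \<Longrightarrow> x < b \<Longrightarrow> u x > 0"
    and q: "\<And>x. a < x \<Longrightarrow> x < b \<Longrightarrow> q x < - (pi / (b - a))\<^sup>2"
  shows False
proof -
  define k where "k = pi / (b - a)"
  have k: "k > 0" "k * (b - a) = pi" using ab by (auto simp: k_def)
  have sn: "sol (\<lambda>_. - k\<^sup>2) a b (\<lambda>x. sin (k * (x - a))) (\<lambda>x. k * cos (k * (x - a)))"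
    by (rule solI[of _ _ _ _ "{}"])
      (auto intro!: continuous_intros derivative_eq_intros simp: power2_eq_square algebra_simps)
  have "u a * (k * cos (k * (a - a))) - v a * sin (k * (a - a)) < u b * (k * cos (k * (b - a))) - v b * sin (k * (b - a))"
  proof (rule wronskian_less[OF s sn ab])
    fix x assume x: "a < x" "x < b"
    have "k * (x - a) < k * (b - a)" by (rule mult_strict_left_mono) (use x k in auto)
    then have "k * (x - a) < pi" by (simp only: k(2))
    then have "sin (k * (x - a)) > 0" using x k by (intro sin_gt_zero) auto
    then show "0 < (- k\<^sup>2 - q x) * (u x * sin (k * (x - a)))"
      using pos[OF x] q[OF x] by (auto simp: k_def intro!: mult_pos_pos)
  qed
  then have "k * u a < - (k * u b)" by (simp add: k(2) mult.commute)
  moreover have "u a \<ge> 0"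
  proof (rule ccontr)
    assume "\<not> u a \<ge> 0"
    have "((\<lambda>x. u x) \<longlongrightarrow> u a) (at a within {a..b})"
      using sol_cont(1)[OF s] ab by (auto simp: continuous_on_def)
    then have "(u \<longlongrightarrow> u a) (at_right a)" using ab by (simp add: at_within_Icc_at_right)
    moreover have "\<forall>\<^sub>F x in at_right a. u x \<ge> 0"
      using eventually_at_right_less ab pos by (auto simp: eventually_at_right intro!: exI[of _ b] less_imp_le)
    ultimately have "0 \<le> u a" using tendsto_lowerbound trivial_limit_at_right_real by blast
    then show False using \<open>\<not> u a \<ge> 0\<close> by simp
  qed
  moreover have "u b \<ge> 0"
  proof -
    have "(u \<longlongrightarrow> u b) (at b within {a..b})"
      using sol_cont(1)[OF s] ab by (auto simp: continuous_on_def)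
    then have "(u \<longlongrightarrow> u b) (at_left b)" using ab by (simp add: at_within_Icc_at_left)
    moreover have "\<forall>\<^sub>F x in at_left b. u x \<ge> 0"
      using ab pos by (auto simp: eventually_at_left intro!: exI[of _ a] less_imp_le)
    ultimately show "0 \<le> u b" using tendsto_lowerbound trivial_limit_at_left_real by blast
  qed
  ultimately show False using k by (smt (verit) mult_nonneg_nonneg)
qed

text \<open>The parameter is so large that Sturm comparison forces a zero in each half of the
  interval; the angle thus gains at least \<open>pi\<close> on each half.\<close>

lemma pruefer_high:
  assumes q: "tame q" and ab: "a < b" and g: "0 \<le> g"
  shows "\<exists>lam th. pruefer (\<lambda>x. q x - lam) a b g th \<and> 2 * pi \<le> th b"
proof -
  obtain M where M: "M > 0" "\<And>x. \<bar>q x\<bar> \<le> M" using tame_bound[OF q] by auto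
  define m where "m = (a + b) / 2"
  have m: "a < m" "m < b" "m - a = (b - a) / 2" "b - m = (b - a) / 2" using ab by (auto simp: m_def field_simps)
  define lam where "lam = M + 1 + (pi / ((b - a) / 2))\<^sup>2"
  define Q where "Q x = q x - lam" for x
  have tQ: "tame Q" unfolding Q_def by (rule tame_sub_const[OF q])
  have Q: "Q x < - (pi / ((b - a) / 2))\<^sup>2" for x using M(2)[of x] by (simp add: Q_def lam_def abs_le_iff)
  have Qm: "Q x < - (pi / (m - a))\<^sup>2" "Q x < - (pi / (b - m))\<^sup>2" for x unfolding m(3,4) by (rule Q)+
  obtain th where th: "pruefer Q a b g th" using pruefer_exists[OF tQ ab] by blast
  obtain R where R: "\<And>x. R x > (0::real)" "sol Q a b (\<lambda>x. R x * sin (th x)) (\<lambda>x. R x * cos (th x))"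
    by (rule pruefer_sol[OF th tQ ab]) blast
  have tha: "th a = g" using th by (simp add: pruefer_def)
  have "2 * pi \<le> th b"
  proof (rule ccontr)
    assume "\<not> 2 * pi \<le> th b"
    then have lt: "th b < 2 * pi" by simp
    show False
    proof (cases "th m \<ge> pi")
      case True
      have "sol Q m b (\<lambda>x. - 1 * (R x * sin (th x))) (\<lambda>x. - 1 * (R x * cos (th x)))"
        by (rule sol_scale, rule sol_subinterval[OF R(2)]) (use m in auto)
      then show False
      proof (rule sturm_oscillation)
        fix x assume x: "m < x" "x < b"
        have "th x > pi" using pruefer_crossing[OF th tQ, of m x 1] True x m by simp
        moreover have "th x < 2 * pi"
        proof (rule ccontr)
          assume "\<not> th x < 2 * pi"
          then have "th b > 2 * pi" using pruefer_crossing[OF th tQ, of x b 2] x m by simp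
          then show False using lt by simp
        qed
        ultimately have "sin (th x) < 0" by (rule sin_lt_zero)
        then show "0 < - 1 * (R x * sin (th x))" using R(1)[of x] by (simp add: mult_pos_neg)
      qed (use m(1,2) Qm in blast)+
    next
      case False
      have "sol Q a m (\<lambda>x. R x * sin (th x)) (\<lambda>x. R x * cos (th x))"
        by (rule sol_subinterval[OF R(2)]) (use m in auto)
      then show False
      proof (rule sturm_oscillation)
        fix x assume x: "a < x" "x < m"
        have "th x > 0" using pruefer_crossing[OF th tQ, of a x 0] tha g x m by simp
        moreover have "th x < pi"
        proof (rule ccontr)
          assume "\<not> th x < pi"
          then have "th m > pi" using pruefer_crossing[OF th tQ, of x m 1] x m by simp
          then show False using False by simp
        qed
        ultimately have "sin (th x) > 0" by (rule sin_gt_zero)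
        then show "0 < R x * sin (th x)" using R(1)[of x] by simp
      qed (use m(1,2) Qm in blast)+
    qed
  qed
  then show ?thesis using th unfolding Q_def by blast
qed

text \<open>Shooting: the end angle is monotone and Lipschitz in the parameter between a low and a
  high value, so the intermediate value theorem applies. Uniqueness makes the end angle independent
  of the chosen solution. The range up to \<open>2 * pi\<close> covers the two targets
  \<open>h\<close> and \<open>h + pi\<close>.\<close>

lemma pruefer_attains:
  assumes q: "tame q" and ab: "a < b" and g: "0 \<le> g" "g < pi" and c: "0 < c" "c \<le> 2 * pi"
  shows "\<exists>lam th. pruefer (\<lambda>x. q x - lam) a b g th \<and> th b = c"
proof -
  obtain M where M: "M > 0" "\<And>x. \<bar>q x\<bar> \<le> M" using tame_bound[OF q] by auto
  define th where "th lam = (SOME t. pruefer (\<lambda>x. q x - lam) a b g t)" for lam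
  have th: "pruefer (\<lambda>x. q x - lam) a b g (th lam)" for lam
    unfolding th_def by (rule someI_ex[of "pruefer (\<lambda>x. q x - lam) a b g"]) (rule pruefer_exists[OF tame_sub_const[OF q] ab])
  define T where "T lam = th lam b" for lam
  have uniq: "t b = T lam" if "pruefer (\<lambda>x. q x - lam) a b g t" for t lam
    unfolding T_def using pruefer_compare[OF that th[of lam] _ tame_sub_const[OF q], of b]
      pruefer_compare[OF th[of lam] that _ tame_sub_const[OF q], of b] ab by simp
  have mono: "T l \<le> T l'" if "l \<le> l'" for l l'
    unfolding T_def by (rule pruefer_compare[OF th th _ tame_sub_const[OF q]]) (use that ab in auto)
  obtain l0 t0 where "pruefer (\<lambda>x. q x - l0) a b g t0" "t0 b < c" using pruefer_low[OF q ab g(2) c(1)] by blast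
  then have l0: "T l0 < c" using uniq by metis
  obtain l1 t1 where "pruefer (\<lambda>x. q x - l1) a b g t1" "2 * pi \<le> t1 b" using pruefer_high[OF q ab g(1)] by blast
  then have l1: "c \<le> T l1" using uniq c by fastforce
  have l01: "l0 \<le> l1" using mono[of l1 l0] l0 l1 by linarith
  define N where "N = M + \<bar>l0\<bar> + \<bar>l1\<bar>"
  define C where "C = (b - a) * exp (2 * (1 + N) * (b - a))"
  have C: "0 \<le> C" using ab by (simp add: C_def)
  have lip: "T l' - T l \<le> C * (l' - l)" if "l0 \<le> l" "l \<le> l'" "l' \<le> l1" for l l'
  proof -
    have "th l' b - th l b \<le> (l' - l) * (b - a) * exp (2 * (1 + N) * (b - a))"
    proof (rule pruefer_lipschitz[OF th th ab _ _ _ tame_sub_const[OF q]])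
      show "\<bar>q x - l\<bar> \<le> N" for x using M(2)[of x] that unfolding N_def by linarith
    qed (use that in auto)
    then show ?thesis by (simp only: T_def C_def ac_simps)
  qed
  have "C-lipschitz_on {l0..l1} T"
  proof (rule lipschitz_onI[OF _ C])
    fix x y assume "x \<in> {l0..l1}" "y \<in> {l0..l1}"
    then show "dist (T x) (T y) \<le> C * dist x y"
      using lip[of x y] lip[of y x] mono[of x y] mono[of y x] by (cases "x \<le> y") (auto simp: dist_real_def abs_if)
  qed
  then have "continuous_on {l0..l1} T" by (rule lipschitz_on_continuous_on)
  then obtain l where "T l = c" using IVT'[of T l0 c l1] l0 l1 l01 by auto
  then show ?thesis using th[of l] unfolding T_def by blast
qed

section \<open>Boundary value problems and their first two states\<close>

text \<open>The boundary conditions say that \<open>(u, v)\<close> is parallel to \<open>(sin g, cos g)\<close> at \<open>a\<close> and to \<open>(sin h, cos h)\<close> at \<open>b\<close>;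
  this treats Robin and Dirichlet conditions alike.\<close>

definition bvp :: "(real \<Rightarrow> real) \<Rightarrow> real \<Rightarrow> real \<Rightarrow> real \<Rightarrow> real \<Rightarrow> real \<Rightarrow> (real \<Rightarrow> real) \<Rightarrow> (real \<Rightarrow> real) \<Rightarrow> bool" where
  "bvp q a b g h lam u v \<longleftrightarrow> sol (\<lambda>x. q x - lam) a b u v \<and> u a * cos g = v a * sin g \<and>
     u b * cos h = v b * sin h \<and> (\<exists>x\<in>{a..b}. u x \<noteq> 0)"

text \<open>Here and in \<open>second_state\<close> the sign pattern stands in for the index of the
  eigenvalue. The second state is negative on the left, so that its quotient by the ground state is
  increasing.\<close>

definition ground_state :: "(real \<Rightarrow> real) \<Rightarrow> real \<Rightarrow> real \<Rightarrow> real \<Rightarrow> real \<Rightarrow> real \<Rightarrow> (real \<Rightarrow> real) \<Rightarrow> (real \<Rightarrow> real) \<Rightarrow> bool" where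
  "ground_state q a b g h lam u v \<longleftrightarrow> bvp q a b g h lam u v \<and> (\<forall>x. a < x \<and> x < b \<longrightarrow> u x > 0)"

definition second_state :: "(real \<Rightarrow> real) \<Rightarrow> real \<Rightarrow> real \<Rightarrow> real \<Rightarrow> real \<Rightarrow> real \<Rightarrow> (real \<Rightarrow> real) \<Rightarrow> (real \<Rightarrow> real) \<Rightarrow> real \<Rightarrow> bool" where
  "second_state q a b g h lam u v z \<longleftrightarrow> bvp q a b g h lam u v \<and> a < z \<and> z < b \<and>
     (\<forall>x. a < x \<and> x < z \<longrightarrow> u x < 0) \<and> (\<forall>x. z < x \<and> x < b \<longrightarrow> u x > 0)"

lemma ground_stateD:
  assumes "ground_state q a b g h lam u v"
  shows "bvp q a b g h lam u v" "a < x \<Longrightarrow> x < b \<Longrightarrow> u x > 0"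
  using assms by (auto simp: ground_state_def)

lemma second_stateD:
  assumes "second_state q a b g h lam u v z"
  shows "bvp q a b g h lam u v" "a < z" "z < b" "a < x \<Longrightarrow> x < z \<Longrightarrow> u x < 0" "z < x \<Longrightarrow> x < b \<Longrightarrow> u x > 0"
  using assms by (auto simp: second_state_def)

lemma second_state_zero:
  assumes "second_state q a b g h lam u v z"
  shows "u z = 0"
proof (rule antisym)
  note s = second_stateD[OF assms]
  have "continuous_on {a..b} u" using s(1) by (simp add: bvp_def sol_def)
  then have "isCont u z" using continuous_on_interior[of "{a..b}" u z] s(2,3) by simp
  then have lim: "(u \<longlongrightarrow> u z) (at_left z)" "(u \<longlongrightarrow> u z) (at_right z)"
    by (auto simp: isCont_def filterlim_at_split)
  show "u z \<le> 0"
    by (rule tendsto_upperbound[OF lim(1)]) (use s in \<open>auto simp: eventually_at_left intro!: exI[of _ a] less_imp_le\<close>)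
  show "0 \<le> u z"
    by (rule tendsto_lowerbound[OF lim(2)]) (use s in \<open>auto simp: eventually_at_right intro!: exI[of _ b] less_imp_le\<close>)
qed

text \<open>The left boundary condition fixes the initial direction, so every solution is a constant
  multiple of the polar one.\<close>

lemma bvp_pruefer:
  assumes B: "bvp q a b g h lam u v" and th: "pruefer (\<lambda>x. q x - lam) a b g th"
    and q: "tame q" and ab: "a < b"
  obtains R where "\<And>x. x \<in> {a..b} \<Longrightarrow> u x = R x * sin (th x)" "\<And>x. x \<in> {a..b} \<Longrightarrow> v x = R x * cos (th x)"
    "(\<forall>x. R x > 0) \<or> (\<forall>x. R x < (0::real))"
proof -
  note tQ = tame_sub_const[OF q, of lam]
  obtain R where R: "R a = 1" "\<And>x. R x > (0::real)" "sol (\<lambda>x. q x - lam) a b (\<lambda>x. R x * sin (th x)) (\<lambda>x. R x * cos (th x))"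
    by (rule pruefer_sol[OF th tQ ab]) blast
  have u: "sol (\<lambda>x. q x - lam) a b u v" and bc: "u a * cos g = v a * sin g" and nz: "\<exists>x\<in>{a..b}. u x \<noteq> 0"
    using B by (auto simp: bvp_def)
  \<comment> \<open>Component of the initial vector \<open>(v, u)\<close> along the unit vector
    \<open>(cos g, sin g)\<close>, to which it is parallel.\<close>
  define k where "k = u a * sin g + v a * cos g"
  have tha: "th a = g" using th by (simp add: pruefer_def)
  have ka: "u a = k * sin g" "v a = k * cos g"
  proof -
    have one: "(sin g)\<^sup>2 + (cos g)\<^sup>2 = 1" by simp
    have "k * sin g = u a * (sin g)\<^sup>2 + (v a * sin g) * cos g" by (simp add: k_def algebra_simps power2_eq_square)
    also have "\<dots> = u a * ((sin g)\<^sup>2 + (cos g)\<^sup>2)" unfolding bc[symmetric] by (simp only: distrib_left power2_eq_square ac_simps)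
    finally show "u a = k * sin g" by (simp only: one mult_1_right)
    have "k * cos g = (u a * cos g) * sin g + v a * (cos g)\<^sup>2" by (simp add: k_def algebra_simps power2_eq_square)
    also have "\<dots> = v a * ((sin g)\<^sup>2 + (cos g)\<^sup>2)" unfolding bc by (simp only: distrib_left power2_eq_square ac_simps)
    finally show "v a = k * cos g" by (simp only: one mult_1_right)
  qed
  have z: "1 * u x + (- k) * (R x * sin (th x)) = 0 \<and> 1 * v x + (- k) * (R x * cos (th x)) = 0" if "x \<in> {a..b}" for x
    using sol_zero[OF sol_lincomb[OF u R(3), of 1 "- k"] tQ, of a x] ka R(1) tha ab that by simp
  have "k \<noteq> 0" using z nz by fastforce
  show ?thesis
  proof (rule that[of "\<lambda>x. k * R x"])
    show "(\<forall>x. k * R x > 0) \<or> (\<forall>x. k * R x < 0)"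
      using \<open>k \<noteq> 0\<close> R(2) by (cases "k > 0") (auto simp: mult_pos_pos mult_neg_pos)
  qed (use z in auto)
qed

text \<open>The right boundary condition fixes the end angle modulo \<open>pi\<close>. The angle is
  positive at \<open>b\<close> and \<open>h \<le> pi\<close>, so the integer multiple cannot be
  negative.\<close>

lemma bvp_angle:
  assumes B: "bvp q a b g h lam u v" and th: "pruefer (\<lambda>x. q x - lam) a b g th"
    and q: "tame q" and ab: "a < b" and g: "0 \<le> g" and h: "0 < h" "h \<le> pi"
  shows "\<exists>n::nat. th b = h + of_nat n * pi"
proof -
  obtain R where R: "\<And>x. x \<in> {a..b} \<Longrightarrow> u x = R x * sin (th x)" "\<And>x. x \<in> {a..b} \<Longrightarrow> v x = R x * cos (th x)"
    "(\<forall>x. R x > 0) \<or> (\<forall>x. R x < (0::real))" by (rule bvp_pruefer[OF B th q ab]) blast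
  have "R b \<noteq> 0" using R(3) by (metis less_irrefl)
  moreover have "R b * (sin (th b) * cos h) = R b * (cos (th b) * sin h)"
    using B R(1,2)[of b] ab by (simp add: bvp_def)
  ultimately have "sin (th b - h) = 0" by (simp add: sin_diff)
  then obtain j :: int where j: "th b - h = of_int j * pi" by (auto simp: sin_zero_iff_int2)
  have "th a = g" using th by (simp add: pruefer_def)
  then have "th b > 0" using pruefer_crossing[OF th tame_sub_const[OF q], of a b 0] ab g by simp
  then have "(of_int j + 1) * pi > 0" using j h by (simp add: algebra_simps)
  then have "(of_int j + 1 :: real) > 0" using pi_gt_zero by (simp add: zero_less_mult_iff)
  then have "j \<ge> 0" by linarith
  then show ?thesis using j by (intro exI[of _ "nat j"]) simp
qed

lemma pruefer_ground:
  assumes th: "pruefer q a b g th" and q: "tame q" and g: "0 \<le> g"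
    and h: "th b \<le> pi" and x: "a < x" "x < b"
  shows "0 < th x" "th x < pi"
proof -
  have "th a = g" using th by (simp add: pruefer_def)
  then show "0 < th x" using pruefer_crossing[OF th q, of a x 0] x g by simp
  show "th x < pi" using pruefer_crossing[OF th q, of x b 1] x h by (cases "th x < pi") auto
qed

lemma pruefer_cross_point:
  assumes th: "pruefer q a b g th" and ab: "a < b" and g: "g < c" and h: "th b > c"
  shows "\<exists>z. a < z \<and> z < b \<and> th z = c"
proof -
  have "th a = g" "continuous_on {a..b} th" using th by (auto simp: pruefer_def)
  then obtain z where z: "a \<le> z" "z \<le> b" "th z = c" using IVT'[of th a c b] g h ab by auto
  have "z \<noteq> a" "z \<noteq> b" using z g h \<open>th a = g\<close> by auto
  then show ?thesis using z by (intro exI[of _ z]) auto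
qed

text \<open>The initial data are prescribed because they are matched at interior points when the
  step is built, and shared by perturbed and unperturbed states later.\<close>

lemma ground_state_exists:
  assumes q: "tame q" and ab: "a < b" and g: "0 \<le> g" "g < pi" and h: "0 < h" "h \<le> pi"
  shows "\<exists>lam u v. ground_state q a b g h lam u v \<and> u a = sin g \<and> v a = cos g"
proof -
  obtain lam th where th: "pruefer (\<lambda>x. q x - lam) a b g th" "th b = h"
    using pruefer_attains[OF q ab g h(1)] h pi_gt_zero by force
  note tQ = tame_sub_const[OF q, of lam]
  obtain R where R: "R a = 1" "\<And>x. R x > (0::real)" "sol (\<lambda>x. q x - lam) a b (\<lambda>x. R x * sin (th x)) (\<lambda>x. R x * cos (th x))"
    by (rule pruefer_sol[OF th(1) tQ ab]) blast
  have tha: "th a = g" using th by (simp add: pruefer_def)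
  have pos: "R x * sin (th x) > 0" if "a < x" "x < b" for x
    using pruefer_ground[OF th(1) tQ g(1) _ that] th(2) h R(2)[of x] by (intro mult_pos_pos sin_gt_zero) auto
  have "bvp q a b g h lam (\<lambda>x. R x * sin (th x)) (\<lambda>x. R x * cos (th x))"
    unfolding bvp_def using R(3) tha th(2) pos[of "(a+b)/2"] ab
    by (auto intro!: bexI[of _ "(a+b)/2"])
  then show ?thesis unfolding ground_state_def using pos R(1) tha by (intro exI conjI) (assumption, auto)
qed

lemma second_state_exists:
  assumes q: "tame q" and ab: "a < b" and g: "0 \<le> g" "g < pi" and h: "0 < h" "h \<le> pi"
  shows "\<exists>lam u v z. second_state q a b g h lam u v z \<and> u a = - sin g \<and> v a = - cos g"
proof -
  obtain lam th where th: "pruefer (\<lambda>x. q x - lam) a b g th" "th b = h + pi"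
    using pruefer_attains[OF q ab g, of "h + pi"] h pi_gt_zero by force
  note tQ = tame_sub_const[OF q, of lam]
  obtain R where R: "R a = 1" "\<And>x. R x > (0::real)" "sol (\<lambda>x. q x - lam) a b (\<lambda>x. R x * sin (th x)) (\<lambda>x. R x * cos (th x))"
    by (rule pruefer_sol[OF th(1) tQ ab]) blast
  have tha: "th a = g" using th by (simp add: pruefer_def)
  obtain z where z: "a < z" "z < b" "th z = pi"
    using pruefer_cross_point[OF th(1) ab g(2)] th(2) h by auto
  have left: "- 1 * (R x * sin (th x)) < 0" if x: "a < x" "x < z" for x
  proof -
    have "0 < th x" using pruefer_crossing[OF th(1) tQ, of a x 0] tha g x z by simp
    moreover have "th x < pi"
      using pruefer_crossing[OF th(1) tQ, of x z 1] x z by (cases "th x < pi") auto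
    ultimately show ?thesis using sin_gt_zero R(2)[of x] by simp
  qed
  have right: "- 1 * (R x * sin (th x)) > 0" if x: "z < x" "x < b" for x
  proof -
    have "pi < th x" using pruefer_crossing[OF th(1) tQ, of z x 1] x z by simp
    moreover have "th x < 2 * pi"
      using pruefer_crossing[OF th(1) tQ, of x b 2] x z th(2) h by (cases "th x < 2 * pi") auto
    ultimately show ?thesis using sin_lt_zero R(2)[of x] by (simp add: mult_pos_neg)
  qed
  have "bvp q a b g h lam (\<lambda>x. - 1 * (R x * sin (th x))) (\<lambda>x. - 1 * (R x * cos (th x)))"
    unfolding bvp_def using sol_scale[OF R(3), of "- 1"] tha th(2) left[of "(a+z)/2"] z
    by (auto intro!: bexI[of _ "(a+z)/2"])
  then show ?thesis unfolding second_state_def using left right z R(1) tha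
    by (intro exI[of _ lam] exI[of _ "\<lambda>x. - 1 * (R x * sin (th x))"] exI[of _ "\<lambda>x. - 1 * (R x * cos (th x))"] exI[of _ z]) auto
qed

lemma ground_state_angle:
  assumes G: "ground_state q a b g h lam u v" and th: "pruefer (\<lambda>x. q x - lam) a b g th"
    and q: "tame q" and ab: "a < b" and g: "0 \<le> g" "g < pi" and h: "0 < h" "h \<le> pi"
  shows "th b = h"
proof -
  note B = ground_stateD(1)[OF G] and pos = ground_stateD(2)[OF G]
  obtain n :: nat where n: "th b = h + of_nat n * pi" using bvp_angle[OF B th q ab g(1) h] by blast
  obtain R where R: "\<And>x. x \<in> {a..b} \<Longrightarrow> u x = R x * sin (th x)" "\<And>x. x \<in> {a..b} \<Longrightarrow> v x = R x * cos (th x)"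
    "(\<forall>x. R x > 0) \<or> (\<forall>x. R x < (0::real))" by (rule bvp_pruefer[OF B th q ab]) blast
  have "n = 0"
  proof (rule ccontr)
    assume "n \<noteq> 0"
    then have "1 * pi \<le> real n * pi" by (intro mult_right_mono) auto
    then have "th b > pi" using n h by linarith
    then obtain z where "a < z" "z < b" "th z = pi" using pruefer_cross_point[OF th ab g(2)] by auto
    then show False using R(1)[of z] pos[of z] by simp
  qed
  then show ?thesis using n by simp
qed

text \<open>End angle \<open>h\<close> would leave the state with one sign, and an end angle above
  \<open>2 * pi\<close> would give two interior zeros, at angles \<open>pi\<close> and
  \<open>2 * pi\<close>; only one extra \<open>pi\<close> fits the sign pattern.\<close>

lemma second_state_angle:
  assumes S: "second_state q a b g h lam u v z" and th: "pruefer (\<lambda>x. q x - lam) a b g th"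
    and q: "tame q" and ab: "a < b" and g: "0 \<le> g" "g < pi" and h: "0 < h" "h \<le> pi"
  shows "th b = h + pi"
proof -
  note B = second_stateD(1)[OF S] and z = second_stateD(2,3)[OF S] and neg = second_stateD(4)[OF S] and pos = second_stateD(5)[OF S]
  note tQ = tame_sub_const[OF q, of lam]
  obtain n :: nat where n: "th b = h + of_nat n * pi" using bvp_angle[OF B th q ab g(1) h] by blast
  obtain R where R: "\<And>x. x \<in> {a..b} \<Longrightarrow> u x = R x * sin (th x)" "\<And>x. x \<in> {a..b} \<Longrightarrow> v x = R x * cos (th x)"
    "(\<forall>x. R x > 0) \<or> (\<forall>x. R x < (0::real))" by (rule bvp_pruefer[OF B th q ab]) blast
  have "n \<noteq> 0"
  proof
    assume "n = 0"
    then have sp: "sin (th x) > 0" if "a < x" "x < b" for x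
      using pruefer_ground[OF th tQ g(1) _ that] n h by (intro sin_gt_zero) auto
    define x y where "x = (a + z) / 2" and "y = (z + b) / 2"
    have xy: "a < x" "x < z" "z < y" "y < b" using z by (auto simp: x_def y_def)
    have "R x * sin (th x) < 0" "R y * sin (th y) > 0" using R(1)[of x] R(1)[of y] neg[of x] pos[of y] xy by auto
    then have "R x < 0" "R y > 0" using sp[of x] sp[of y] xy by (auto simp: mult_less_0_iff zero_less_mult_iff)
    then show False using R(3) by (meson less_asym)
  qed
  moreover have "n < 2"
  proof (rule ccontr)
    assume "\<not> n < 2"
    then have "2 * pi \<le> real n * pi" by (intro mult_right_mono) auto
    then have "th b > 2 * pi" using n h by linarith
    then obtain y where y: "a < y" "y < b" "th y = 2 * pi" using pruefer_cross_point[OF th ab, of "2 * pi"] g pi_gt_zero by force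
    have "pruefer (\<lambda>x. q x - lam) a y g th" using pruefer_subinterval[OF th, of a y] y th by (simp add: pruefer_def)
    then obtain x where x: "a < x" "x < y" "th x = pi" using pruefer_cross_point[of _ a y g th pi] y g pi_gt_zero by force
    have "u x = 0" "u y = 0" using R(1)[of x] R(1)[of y] x y by auto
    then have "x = z" "y = z" using neg pos x y by (metis less_irrefl not_less_iff_gr_or_eq order_less_trans)+
    then show False using x by simp
  qed
  ultimately have "n = 1" by simp
  then show ?thesis using n by simp
qed

text \<open>The end angle is strictly increasing in the parameter and equals
  \<open>h + n * pi\<close> at eigenvalues. The values \<open>n = 0\<close> and \<open>n = 1\<close>
  belong to the two states, so both infima are attained.\<close>

lemma bvp_spectrum:
  assumes q: "tame q" and ab: "a < b" and g: "0 \<le> g" "g < pi" and h: "0 < h" "h \<le> pi"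
    and G: "ground_state q a b g h l1 u1 v1" and S: "second_state q a b g h l2 u2 v2 z"
  defines "E \<equiv> {lam. \<exists>u v. bvp q a b g h lam u v}"
  shows "l1 < l2" "Inf E = l1" "Inf (E - {l1}) = l2"
proof -
  note B1 = ground_stateD(1)[OF G] and B2 = second_stateD(1)[OF S]
  have ex: "\<exists>th. pruefer (\<lambda>x. q x - l) a b g th" for l
    by (rule pruefer_exists[OF tame_sub_const[OF q] ab])
  obtain t1 where t1: "pruefer (\<lambda>x. q x - l1) a b g t1" using ex by blast
  obtain t2 where t2: "pruefer (\<lambda>x. q x - l2) a b g t2" using ex by blast
  have b1: "t1 b = h" by (rule ground_state_angle[OF G t1 q ab g h])
  have b2: "t2 b = h + pi" by (rule second_state_angle[OF S t2 q ab g h])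
  have mono: "t b < t' b" if "pruefer (\<lambda>x. q x - l) a b g t" "pruefer (\<lambda>x. q x - l') a b g t'" "l < l'" for t t' l l'
    by (rule pruefer_strict[OF that(1,2) _ tame_sub_const[OF q] ab]) (use that in auto)
  show 12: "l1 < l2"
  proof (rule ccontr)
    assume "\<not> l1 < l2"
    then consider "l2 < l1" | "l1 = l2" by linarith
    then show False
    proof cases
      case 1 then show False using mono[OF t2 t1] b1 b2 pi_gt_zero by linarith
    next
      case 2
      then have "second_state q a b g h l1 u2 v2 z" using S by simp
      then have "t1 b = h + pi" by (rule second_state_angle[OF _ t1 q ab g h])
      then show False using b1 by simp
    qed
  qed
  have ang: "\<exists>t. \<exists>n::nat. pruefer (\<lambda>x. q x - l) a b g t \<and> t b = h + of_nat n * pi" if "l \<in> E" for l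
    using ex[of l] that bvp_angle[OF _ _ q ab g(1) h] unfolding E_def by blast
  have ge1: "l1 \<le> l" if l: "l \<in> E" for l
  proof (rule ccontr)
    assume "\<not> l1 \<le> l"
    obtain t and n :: nat where t: "pruefer (\<lambda>x. q x - l) a b g t" "t b = h + of_nat n * pi" using ang[OF l] by blast
    have "t b < t1 b" using mono[OF t(1) t1] \<open>\<not> l1 \<le> l\<close> by simp
    then show False using t b1 by (simp add: mult_less_0_iff)
  qed
  have ge2: "l2 \<le> l" if l: "l \<in> E - {l1}" for l
  proof (rule ccontr)
    assume "\<not> l2 \<le> l"
    obtain t and n :: nat where t: "pruefer (\<lambda>x. q x - l) a b g t" "t b = h + of_nat n * pi" using ang l by blast
    have "t b < t2 b" using mono[OF t(1) t2] \<open>\<not> l2 \<le> l\<close> by simp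
    then have "of_nat n * pi < 1 * pi" using t b2 by simp
    then have "n < 1" by (simp only: mult_less_cancel_right) (use pi_gt_zero in auto)
    moreover have "l1 < l" using ge1[of l] l by auto
    then have "t1 b < t b" using mono[OF t1 t(1)] by simp
    then have "n \<noteq> 0" using t b1 by (cases n) auto
    ultimately show False by simp
  qed
  show "Inf E = l1" by (rule cInf_eq_minimum) (use B1 ge1 in \<open>auto simp: E_def\<close>)
  show "Inf (E - {l1}) = l2" by (rule cInf_eq_minimum) (use B2 ge2 12 in \<open>auto simp: E_def\<close>)
qed

section \<open>Comparison with a step potential\<close>

lemma bc_wronskian_zero:
  fixes u v w y h :: real
  assumes "u * cos h = v * sin h" "w * cos h = y * sin h"
  shows "u * y - v * w = 0"
proof -
  have "(u * y - v * w) * cos h = (u * cos h) * y - v * (w * cos h)" by (simp add: algebra_simps)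
  also have "\<dots> = 0" by (simp add: assms)
  finally have 1: "(u * y - v * w) * cos h = 0" .
  have "(u * y - v * w) * sin h = u * (y * sin h) - (v * sin h) * w" by (simp add: algebra_simps)
  also have "\<dots> = 0" by (simp add: assms[symmetric])
  finally have 2: "(u * y - v * w) * sin h = 0" .
  show ?thesis
  proof (rule ccontr)
    assume "u * y - v * w \<noteq> 0"
    then have "cos h = 0" "sin h = 0" using 1 2 by auto
    then show False using sin_cos_squared_add[of h] by simp
  qed
qed

lemma reflect_bc:
  fixes u v h :: real
  assumes "u * cos h = v * sin h"
  shows "u * cos (pi - h) = - v * sin (pi - h)"
  using assms by (simp add: cos_diff sin_diff)

text \<open>Under a Dirichlet condition the quotient is of type 0/0 and its limit is the quotient of
  the derivatives. This keeps the boundary term of the comparison finite at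
  \<open>b\<close>.\<close>

lemma sol_ratio_limit:
  assumes u: "sol q a b u v" and w: "sol r a b w y" and ab: "a < b"
    and bu: "u b * cos h = v b * sin h" and bw: "w b * cos h = y b * sin h"
    and nz: "u b \<noteq> 0 \<or> v b \<noteq> 0"
  shows "\<exists>l. ((\<lambda>x. w x / u x) \<longlongrightarrow> l) (at_left b)"
proof (cases "u b = 0")
  case False
  have "(f \<longlongrightarrow> f b) (at_left b)" if "continuous_on {a..b} f" for f :: "real \<Rightarrow> real"
    using that ab by (auto simp: continuous_on_def at_within_Icc_at_left[OF ab, symmetric])
  then have "((\<lambda>x. w x / u x) \<longlongrightarrow> w b / u b) (at_left b)"
    using False sol_cont(1)[OF u] sol_cont(1)[OF w] by (intro tendsto_divide) auto
  then show ?thesis by blast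
next
  case True
  then have vb: "v b \<noteq> 0" using nz by simp
  then have "sin h = 0" using True bu by simp
  moreover from this have "cos h \<noteq> 0" using sin_cos_squared_add[of h] by auto
  ultimately have wb: "w b = 0" using bw by simp
  have d: "((\<lambda>x. f x / (x - b)) \<longlongrightarrow> g b) (at_left b)" if s: "sol p a b f g" and f0: "f b = 0" for p f g
    using sol_deriv_within[OF s, of b] ab f0
    by (simp add: has_field_derivative_iff at_within_Icc_at_left)
  have "((\<lambda>x. (w x / (x - b)) / (u x / (x - b))) \<longlongrightarrow> y b / v b) (at_left b)"
    by (intro tendsto_divide d[OF w wb] d[OF u True] vb)
  then have "((\<lambda>x. w x / u x) \<longlongrightarrow> y b / v b) (at_left b)"
    by (rule Lim_transform_eventually) (auto simp: eventually_at_filter)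
  then show ?thesis by blast
qed

text \<open>With \<open>f = w u2 / u1\<close>, the quantity \<open>Z\<close> below is the Wronskian of \<open>f\<close> and \<open>s\<close>; written in
  this form it involves no second derivative of \<open>u1\<close> or \<open>u2\<close>.\<close>

lemma comparison_right:
  assumes u1: "sol (\<lambda>x. V x - l1) z b u1 v1" and u2: "sol (\<lambda>x. V x - l2) z b u2 v2"
    and w: "sol (\<lambda>x. W x - l1) z b w y" and s: "sol (\<lambda>x. W x - m) z b s t" and zb: "z < b"
    and bc: "u1 b * cos h = v1 b * sin h" "u2 b * cos h = v2 b * sin h"
      "w b * cos h = y b * sin h" "s b * cos h = t b * sin h"
    and nz: "u1 b \<noteq> 0 \<or> v1 b \<noteq> 0"
    and pos: "\<And>x. z \<le> x \<Longrightarrow> x < b \<Longrightarrow> u1 x > 0" "\<And>x. z \<le> x \<Longrightarrow> x < b \<Longrightarrow> w x > 0"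
      "\<And>x. z < x \<Longrightarrow> x < b \<Longrightarrow> u2 x > 0" "\<And>x. z < x \<Longrightarrow> x < b \<Longrightarrow> s x > 0"
    and u2z: "u2 z = 0" and sz: "s z \<ge> 0" and l12: "l1 < l2" and m: "l2 \<le> m"
    and om: "\<And>x. z \<le> x \<Longrightarrow> x \<le> b \<Longrightarrow> u1 x * y x - v1 x * w x \<ge> 0"
  shows "s z = 0 \<and> m = l2 \<and> (\<forall>x. z < x \<and> x < b \<longrightarrow> u1 x * y x - v1 x * w x = 0)"
proof -
  define H where "H x = u1 x * v2 x - v1 x * u2 x" for x
  define P where "P x = w x * t x - y x * s x" for x
  define om' where "om' x = u1 x * y x - v1 x * w x" for x
  define Z where "Z x = u2 x / u1 x * P x - w x / u1 x * (s x / u1 x) * H x" for x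
  have Hb: "H b = 0" unfolding H_def by (rule bc_wronskian_zero[OF bc(1,2)])
  have Pb: "P b = 0" unfolding P_def by (rule bc_wronskian_zero[OF bc(3,4)])
  have Hpos: "H x > 0" if x: "z \<le> x" "x < b" for x
  proof -
    have "u1 x * v2 x - v1 x * u2 x > u1 b * v2 b - v1 b * u2 b"
    proof (rule wronskian_greater[OF sol_subinterval[OF u1] sol_subinterval[OF u2]])
      fix t assume t: "x < t" "t < b"
      then have "u1 t * u2 t > 0" using pos(1)[of t] pos(3)[of t] x by simp
      then show "(V t - l2 - (V t - l1)) * (u1 t * u2 t) < 0" using l12 by (simp add: mult_neg_pos)
    qed (use x in auto)
    then show ?thesis using Hb by (simp add: H_def)
  qed
  obtain S1 where S1: "countable S1" "continuous_on {z..b} H"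
    "\<And>x. z < x \<Longrightarrow> x < b \<Longrightarrow> x \<notin> S1 \<Longrightarrow> (H has_real_derivative (l1 - l2) * (u1 x * u2 x)) (at x)"
    using wronskian_deriv[OF u1 u2] unfolding H_def[abs_def] by auto
  obtain S2 where S2: "countable S2" "continuous_on {z..b} P"
    "\<And>x. z < x \<Longrightarrow> x < b \<Longrightarrow> x \<notin> S2 \<Longrightarrow> (P has_real_derivative (l1 - m) * (w x * s x)) (at x)"
    using wronskian_deriv[OF w s] unfolding P_def[abs_def] by auto
  \<comment> \<open>The equation for \<open>f = w u2 / u1\<close> has potential
    \<open>W - l2\<close> and the extra term \<open>2 (u2 / u1)' (w / u1)' u1\<close>; the two
    summands come from that term and from \<open>l2 - m\<close>. Both are nonpositive.\<close>
  have Zder: "(Z has_real_derivative - 2 * H x * s x * om' x / (u1 x)^3 + (l2 - m) * (u2 x * w x * s x / u1 x)) (at x)"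
    if x: "z < x" "x < b" "x \<notin> S1 \<union> S2" for x
  proof -
    have u1p: "u1 x \<noteq> 0" using pos(1)[of x] x by simp
    note d = sol_deriv[OF u1 x(1,2)] sol_deriv[OF u2 x(1,2)] sol_deriv[OF w x(1,2)] sol_deriv[OF s x(1,2)]
    have dH: "(H has_real_derivative (l1 - l2) * (u1 x * u2 x)) (at x)" using S1(3) x by simp
    have dP: "(P has_real_derivative (l1 - m) * (w x * s x)) (at x)" using S2(3) x by simp
    have d1: "((\<lambda>x. u2 x / u1 x) has_real_derivative H x / (u1 x)\<^sup>2) (at x)"
      using DERIV_divide[OF d(2) d(1) u1p] by (simp add: H_def power2_eq_square algebra_simps)
    have d2: "((\<lambda>x. w x / u1 x) has_real_derivative om' x / (u1 x)\<^sup>2) (at x)"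
      using DERIV_divide[OF d(3) d(1) u1p] by (simp add: om'_def power2_eq_square algebra_simps)
    have d3: "((\<lambda>x. s x / u1 x) has_real_derivative (t x * u1 x - s x * v1 x) / (u1 x)\<^sup>2) (at x)"
      using DERIV_divide[OF d(4) d(1) u1p] by (simp add: power2_eq_square algebra_simps)
    have "(Z has_real_derivative (H x / (u1 x)\<^sup>2 * P x + (l1 - m) * (w x * s x) * (u2 x / u1 x)) -
        ((om' x / (u1 x)\<^sup>2 * (s x / u1 x) + (t x * u1 x - s x * v1 x) / (u1 x)\<^sup>2 * (w x / u1 x)) * H x
         + (l1 - l2) * (u1 x * u2 x) * (w x / u1 x * (s x / u1 x)))) (at x)"
      unfolding Z_def by (intro DERIV_diff DERIV_mult d1 d2 d3 dH dP)
    moreover have "(H x / (u1 x)\<^sup>2 * P x + (l1 - m) * (w x * s x) * (u2 x / u1 x)) -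
        ((om' x / (u1 x)\<^sup>2 * (s x / u1 x) + (t x * u1 x - s x * v1 x) / (u1 x)\<^sup>2 * (w x / u1 x)) * H x
         + (l1 - l2) * (u1 x * u2 x) * (w x / u1 x * (s x / u1 x)))
      = - 2 * H x * s x * om' x / (u1 x)^3 + (l2 - m) * (u2 x * w x * s x / u1 x)"
      using u1p unfolding P_def om'_def by (simp add: divide_simps power2_eq_square power3_eq_cube) (simp add: algebra_simps)
    ultimately show ?thesis by simp
  qed
  have nonpos: "- 2 * H x * s x * om' x / (u1 x)^3 \<le> 0" "(l2 - m) * (u2 x * w x * s x / u1 x) \<le> 0" if x: "z < x" "x < b" for x
  proof -
    have "H x > 0" "s x > 0" "om' x \<ge> 0" "u1 x > 0" "u2 x > 0" "w x > 0"
      using Hpos[of x] pos[of x] om[of x] x unfolding om'_def by auto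
    then have "H x * s x * om' x / (u1 x)^3 \<ge> 0" "u2 x * w x * s x / u1 x \<ge> 0" by auto
    then show "- 2 * H x * s x * om' x / (u1 x)^3 \<le> 0" "(l2 - m) * (u2 x * w x * s x / u1 x) \<le> 0"
      using m by (simp, intro mult_nonpos_nonneg) auto
  qed
  have Zcont: "continuous_on {x..c} Z" if "z \<le> x" "c < b" for x c
  proof -
    have sub: "{x..c} \<subseteq> {z..b}" using that by auto
    have "u1 t \<noteq> 0" if "t \<in> {x..c}" for t using pos(1)[of t] that \<open>z \<le> x\<close> \<open>c < b\<close> by auto
    then show ?thesis unfolding Z_def
      by (intro continuous_intros continuous_on_subset[OF sol_cont(1)[OF u1] sub] continuous_on_subset[OF sol_cont(1)[OF u2] sub]
        continuous_on_subset[OF sol_cont(1)[OF w] sub] continuous_on_subset[OF sol_cont(1)[OF s] sub]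
        continuous_on_subset[OF S1(2) sub] continuous_on_subset[OF S2(2) sub]) auto
  qed
  have Zmono: "Z c \<le> Z x" if xc: "z \<le> x" "x \<le> c" "c < b" for x c
  proof (rule nonincreasing_off_countable[OF xc(2) Zcont, of "S1 \<union> S2"])
    fix e assume e: "x < e" "e < c" "e \<notin> S1 \<union> S2"
    then have "z < e" "e < b" using xc by auto
    from add_nonpos_nonpos[OF nonpos[OF this]] Zder[OF this e(3)]
    show "\<exists>d\<le>0. (Z has_real_derivative d) (at e)" by blast
  qed (use xc S1 S2 in auto)
  have lim: "(f \<longlongrightarrow> f b) (at_left b)" if "continuous_on {z..b} f" for f :: "real \<Rightarrow> real"
    using that zb by (auto simp: continuous_on_def at_within_Icc_at_left[OF zb, symmetric])
  obtain L2 Lw Ls where L: "((\<lambda>x. u2 x / u1 x) \<longlongrightarrow> L2) (at_left b)" "((\<lambda>x. w x / u1 x) \<longlongrightarrow> Lw) (at_left b)"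
    "((\<lambda>x. s x / u1 x) \<longlongrightarrow> Ls) (at_left b)"
    using sol_ratio_limit[OF u1 u2 zb bc(1) _ nz] sol_ratio_limit[OF u1 w zb bc(1) _ nz]
      sol_ratio_limit[OF u1 s zb bc(1) _ nz] bc by metis
  \<comment> \<open>At \<open>b\<close> the quotients stay bounded while \<open>P\<close> and
    \<open>H\<close> vanish by the boundary conditions, so \<open>Z\<close> decreases to 0.\<close>
  have "(Z \<longlongrightarrow> L2 * P b - Lw * Ls * H b) (at_left b)"
    unfolding Z_def by (intro tendsto_intros L lim S1 S2)
  then have Zlim: "(Z \<longlongrightarrow> 0) (at_left b)" by (simp add: Hb Pb)
  have Zge: "Z x \<ge> 0" if x: "z \<le> x" "x < b" for x
  proof (rule tendsto_upperbound[OF Zlim])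
    show "\<forall>\<^sub>F c in at_left b. Z c \<le> Z x"
      using x Zmono by (auto simp: eventually_at_left intro!: exI[of _ x])
  qed simp
  \<comment> \<open>Only the term with \<open>H\<close> survives at the zero of \<open>u2\<close>.
    It is nonpositive, whereas \<open>Z \<ge> 0\<close>, which forces
    \<open>s z = 0\<close>.\<close>
  have Zz: "Z z = - (w z / u1 z * (s z / u1 z) * H z)" by (simp add: Z_def u2z)
  have wz: "w z > 0" "u1 z > 0" "H z > 0" using pos(1,2)[of z] Hpos[of z] zb by auto
  have "Z z \<ge> 0" using Zge zb by simp
  then have "w z / u1 z * (s z / u1 z) * H z \<le> 0" unfolding Zz by simp
  then have s0: "s z = 0" using wz sz by (auto simp: mult_le_0_iff divide_le_0_iff)
  then have "Z z = 0" using Zz by simp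
  then have Z0: "Z x = 0" if "z \<le> x" "x < b" for x using Zge[OF that] Zmono[of z x] that by simp
  \<comment> \<open>Now \<open>Z\<close> vanishes identically, so the two nonpositive parts of its
    derivative vanish separately.\<close>
  have both: "om' x = 0 \<and> m = l2" if x: "z < x" "x < b" "x \<notin> S1 \<union> S2" for x
  proof -
    have "((\<lambda>_. 0) has_real_derivative - 2 * H x * s x * om' x / (u1 x)^3 + (l2 - m) * (u2 x * w x * s x / u1 x)) (at x)"
      by (rule has_field_derivative_transform_within_open[OF Zder[OF x], of "{z<..<b}"]) (use Z0 x in auto)
    then have "- 2 * H x * s x * om' x / (u1 x)^3 + (l2 - m) * (u2 x * w x * s x / u1 x) = 0"
      by (rule DERIV_unique) simp
    then have "- 2 * H x * s x * om' x / (u1 x)^3 = 0" "(l2 - m) * (u2 x * w x * s x / u1 x) = 0"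
      using nonpos[OF x(1,2)] by linarith+
    moreover have "H x > 0" "s x > 0" "u1 x > 0" "u2 x > 0" "w x > 0"
      using Hpos[of x] pos[of x] x by auto
    ultimately show ?thesis by auto
  qed
  have cS: "countable (S1 \<union> S2)" using S1 S2 by simp
  obtain x0 where "z < x0" "x0 < b" "x0 \<notin> S1 \<union> S2" using ex_off_countable[OF zb cS] by auto
  then have "m = l2" using both by blast
  moreover have "om' x = 0" if "z < x" "x < b" for x
  proof (rule zero_off_countable[OF cS _ _ that])
    fix x assume x: "z < x" "x < b"
    have "isCont f x" if "continuous_on {z..b} f" for f :: "real \<Rightarrow> real"
      using continuous_on_interior[OF that, of x] x by simp
    then show "isCont om' x" unfolding om'_def
      using sol_cont[OF u1] sol_cont[OF w] by (intro continuous_intros) auto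
  qed (use both in blast)
  ultimately show ?thesis using s0 by (simp add: om'_def)
qed

text \<open>Mirror image of \<open>comparison_right\<close>: reflection reverses Wronskians, and the
  two second states change sign to become positive.\<close>

lemma comparison_left:
  assumes u1: "sol (\<lambda>x. V x - l1) a z u1 v1" and u2: "sol (\<lambda>x. V x - l2) a z u2 v2"
    and w: "sol (\<lambda>x. W x - l1) a z w y" and s: "sol (\<lambda>x. W x - m) a z s t" and az: "a < z"
    and bc: "u1 a * cos h = v1 a * sin h" "u2 a * cos h = v2 a * sin h"
      "w a * cos h = y a * sin h" "s a * cos h = t a * sin h"
    and nz: "u1 a \<noteq> 0 \<or> v1 a \<noteq> 0"
    and pos: "\<And>x. a < x \<Longrightarrow> x \<le> z \<Longrightarrow> u1 x > 0" "\<And>x. a < x \<Longrightarrow> x \<le> z \<Longrightarrow> w x > 0"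
      "\<And>x. a < x \<Longrightarrow> x < z \<Longrightarrow> u2 x < 0" "\<And>x. a < x \<Longrightarrow> x < z \<Longrightarrow> s x < 0"
    and u2z: "u2 z = 0" and sz: "s z \<le> 0" and l12: "l1 < l2" and m: "l2 \<le> m"
    and om: "\<And>x. a \<le> x \<Longrightarrow> x \<le> z \<Longrightarrow> u1 x * y x - v1 x * w x \<le> 0"
  shows "s z = 0 \<and> m = l2 \<and> (\<forall>x. a < x \<and> x < z \<longrightarrow> u1 x * y x - v1 x * w x = 0)"
proof -
  have neg: "sol q c d (\<lambda>x. - f x) (\<lambda>x. - g x)" if "sol q c d f g" for q c d f g
    using sol_scale[OF that, of "- 1"] by simp
  have "- s (- (- z)) = 0 \<and> m = l2 \<and> (\<forall>x. - z < x \<and> x < - a \<longrightarrow> u1 (- x) * (- y (- x)) - (- v1 (- x)) * w (- x) = 0)"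
  proof (rule comparison_right[OF sol_reflect[OF u1] neg[OF sol_reflect[OF u2]] sol_reflect[OF w] neg[OF sol_reflect[OF s]], where h = "pi - h"])
    show "u1 (- (- a)) * cos (pi - h) = - v1 (- (- a)) * sin (pi - h)"
      "- u2 (- (- a)) * cos (pi - h) = - (- v2 (- (- a))) * sin (pi - h)"
      "w (- (- a)) * cos (pi - h) = - y (- (- a)) * sin (pi - h)"
      "- s (- (- a)) * cos (pi - h) = - (- t (- (- a))) * sin (pi - h)"
      using reflect_bc[OF bc(1)] reflect_bc[OF bc(2)] reflect_bc[OF bc(3)] reflect_bc[OF bc(4)] by simp_all
    show "0 \<le> u1 (- x) * - y (- x) - - v1 (- x) * w (- x)" if "- z \<le> x" "x \<le> - a" for x
      using om[of "- x"] that by simp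
  qed (use az nz pos u2z sz l12 m in auto)
  then have a: "s z = 0" "m = l2"
    and b: "\<And>x. - z < x \<Longrightarrow> x < - a \<Longrightarrow> u1 (- x) * (- y (- x)) - (- v1 (- x)) * w (- x) = 0" by auto
  have "u1 x * y x - v1 x * w x = 0" if "a < x" "x < z" for x
    using b[of "- x"] that by simp
  then show ?thesis using a by blast
qed

text \<open>Supposing \<open>l2 \<le> m\<close>, the comparison is run on the side of
  \<open>z\<close> not containing \<open>z'\<close> in its interior, where \<open>s\<close> has the
  right sign. It yields \<open>s z = 0\<close>, so the two zeros coincide and the comparison becomes
  available on both sides.\<close>

lemma gap_comparison:
  assumes G: "ground_state V a b g h l1 u1 v1" and tV: "tame V" and S: "second_state V a b g h l2 u2 v2 z"
    and G': "ground_state W a b g h l1 w y" and S': "second_state W a b g h m s t z'"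
    and l12: "l1 < l2"
    and om: "\<And>x. z \<le> x \<Longrightarrow> x \<le> b \<Longrightarrow> u1 x * y x - v1 x * w x \<ge> 0"
      "\<And>x. a \<le> x \<Longrightarrow> x \<le> z \<Longrightarrow> u1 x * y x - v1 x * w x \<le> 0"
  shows "m \<le> l2 \<and> (m = l2 \<longrightarrow> (\<forall>x. a < x \<and> x < b \<longrightarrow> u1 x * y x - v1 x * w x = 0))"
proof -
  note u1 = ground_stateD[OF G] and w = ground_stateD[OF G']
  note u2 = second_stateD(1)[OF S] and z = second_stateD(2,3)[OF S] and u2s = second_stateD(4,5)[OF S]
  note s = second_stateD(1)[OF S'] and z' = second_stateD(2,3)[OF S'] and ss = second_stateD(4,5)[OF S']
  have ab: "a < b" using z by simp
  note tV1 = tame_sub_const[OF tV, of l1]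
  have sols: "sol (\<lambda>x. V x - l1) a b u1 v1" "sol (\<lambda>x. V x - l2) a b u2 v2"
    "sol (\<lambda>x. W x - l1) a b w y" "sol (\<lambda>x. W x - m) a b s t"
    using u1 u2 w s by (auto simp: bvp_def)
  have bcb: "u1 b * cos h = v1 b * sin h" "u2 b * cos h = v2 b * sin h"
      "w b * cos h = y b * sin h" "s b * cos h = t b * sin h"
    and bca: "u1 a * cos g = v1 a * sin g" "u2 a * cos g = v2 a * sin g"
      "w a * cos g = y a * sin g" "s a * cos g = t a * sin g"
    using u1 u2 w s by (auto simp: bvp_def)
  have nz: "u1 c \<noteq> 0 \<or> v1 c \<noteq> 0" if "c \<in> {a..b}" for c
    using sol_zero[OF sols(1) tV1 _ _ that, of z] u1(2)[of z] z by auto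
  have u2z: "u2 z = 0" by (rule second_state_zero[OF S])
  have sz': "s z' = 0" by (rule second_state_zero[OF S'])
  have R: "s z = 0 \<and> m = l2 \<and> (\<forall>x. z < x \<and> x < b \<longrightarrow> u1 x * y x - v1 x * w x = 0)" if "z' \<le> z" "l2 \<le> m"
  proof (rule comparison_right[of V l1 z b u1 v1 l2 u2 v2 W w y m s t h])
    show "s z \<ge> 0" using ss(2)[of z] that z sz' by (cases "z = z'") auto
  qed (use sols bcb nz[of b] u1(2) w(2) u2s ss z z' that l12 u2z om in \<open>auto intro: sol_subinterval\<close>)
  have L: "s z = 0 \<and> m = l2 \<and> (\<forall>x. a < x \<and> x < z \<longrightarrow> u1 x * y x - v1 x * w x = 0)" if "z \<le> z'" "l2 \<le> m"
  proof (rule comparison_left[of V l1 a z u1 v1 l2 u2 v2 W w y m s t g])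
    show "s z \<le> 0" using ss(1)[of z] that z sz' by (cases "z = z'") auto
  qed (use sols bca nz[of a] u1(2) w(2) u2s ss z z' that l12 u2z om in \<open>auto intro: sol_subinterval\<close>)
  have both: "m = l2 \<and> (\<forall>x. a < x \<and> x < b \<longrightarrow> u1 x * y x - v1 x * w x = 0)" if "l2 \<le> m"
  proof -
    have sz: "s z = 0" "m = l2" using R L that by (cases "z \<le> z'"; force)+
    have "z = z'" using ss(1)[of z] ss(2)[of z] sz z by (cases z z' rule: linorder_cases) auto
    moreover have "u1 z * y z - v1 z * w z = 0" using om(1)[of z] om(2)[of z] z by auto
    ultimately show ?thesis using R L that
      by (metis linorder_less_linear order_refl)
  qed
  show ?thesis
  proof (cases "l2 \<le> m")
    case True
    then show ?thesis using both by blast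
  qed auto
qed

section \<open>Construction of the step with the same first eigenvalue\<close>

lemma ivp_left_exists:
  assumes q: "tame q" and ab: "a < b"
  shows "\<exists>u v. sol q a b u v \<and> u a = p \<and> v a = p'"
proof -
  obtain r g where rg: "p' = r * cos g" "p = r * sin g" using polar_Ex[of p' p] by auto
  obtain th where th: "pruefer q a b g th" using pruefer_exists[OF q ab] by blast
  obtain R where R: "R a = 1" "sol q a b (\<lambda>x. R x * sin (th x)) (\<lambda>x. R x * cos (th x))"
    by (rule pruefer_sol[OF th q ab]) blast
  have "th a = g" using th by (simp add: pruefer_def)
  then show ?thesis using sol_scale[OF R(2), of r] R(1) rg by fastforce
qed

lemma ivp_right_exists:
  assumes q: "tame q" and ab: "a < b"
  shows "\<exists>u v. sol q a b u v \<and> u b = p \<and> v b = p'"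
proof -
  obtain u v where u: "sol (\<lambda>x. q (- x)) (- b) (- a) u v" "u (- b) = p" "v (- b) = - p'"
    using ivp_left_exists[OF tame_reflect[OF q], of "- b" "- a" p "- p'"] ab by auto
  show ?thesis using sol_reflect[OF u(1)] u(2,3)
    by (intro exI[of _ "\<lambda>x. u (- x)"] exI[of _ "\<lambda>x. - v (- x)"]) simp
qed

lemma angle_exists:
  assumes "p > (0::real)"
  shows "\<exists>r h. r > 0 \<and> 0 < h \<and> h < pi \<and> p = r * sin h \<and> p' = r * cos h"
proof -
  define k where "k = p' / p"
  define h where "h = pi / 2 - arctan k"
  have s: "sin h = 1 / sqrt (1 + k\<^sup>2)" unfolding h_def by (simp add: sin_diff cos_arctan)
  have c: "cos h = k / sqrt (1 + k\<^sup>2)" unfolding h_def by (simp add: cos_diff sin_arctan)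
  have q: "sqrt (1 + k\<^sup>2) > 0" by (simp add: add_pos_nonneg)
  have "0 < h" "h < pi" using arctan_bounded[of k] unfolding h_def by auto
  moreover have "p = p * sqrt (1 + k\<^sup>2) * sin h" unfolding s using q by (simp only: mult.assoc) simp
  moreover have "p' = p * sqrt (1 + k\<^sup>2) * cos h" unfolding c using q assms by (simp add: k_def)
  ultimately show ?thesis using assms q by (intro exI[of _ "p * sqrt (1 + k\<^sup>2)"] exI[of _ h]) auto
qed

lemma ratio_nonincreasing:
  assumes u: "sol q a b u v" and w: "sol r a b w y" and ab: "a \<le> b"
    and pos: "\<And>x. x \<in> {a..b} \<Longrightarrow> u x > 0" and om: "\<And>x. a < x \<Longrightarrow> x < b \<Longrightarrow> u x * y x - v x * w x \<le> 0"
  shows "w b / u b \<le> w a / u a"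
proof (rule nonincreasing_off_countable[OF ab, of "\<lambda>x. w x / u x" "{}"])
  show "continuous_on {a..b} (\<lambda>x. w x / u x)"
    using pos by (intro continuous_intros sol_cont(1)[OF u] sol_cont(1)[OF w]) force
  fix x assume x: "a < x" "x < b"
  have "u x > 0" using pos[of x] x by simp
  then have "((\<lambda>x. w x / u x) has_real_derivative (y x * u x - w x * v x) / (u x * u x)) (at x)"
    by (intro DERIV_divide sol_deriv[OF u x] sol_deriv[OF w x]) simp
  moreover have "(y x * u x - w x * v x) / (u x * u x) \<le> 0"
    using om[OF x] \<open>u x > 0\<close> by (intro divide_nonpos_pos) (auto simp: algebra_simps)
  ultimately show "\<exists>d\<le>0. ((\<lambda>x. w x / u x) has_real_derivative d) (at x)" by blast
qed simp

text \<open>Continuity argument from right to left: while \<open>w\<close> is positive,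
  \<open>V \<le> B\<close> keeps the Wronskian nonpositive, so \<open>w / u\<close> does not fall
  below its value at \<open>z\<close>, and a first zero of \<open>w\<close> met from the right is
  impossible.\<close>

lemma continue_left_positive:
  assumes u: "sol (\<lambda>x. V x - lam) a z u v" and w: "sol (\<lambda>x. B - lam) a z w y" and az: "a \<le> z"
    and pos: "\<And>x. x \<in> {a..z} \<Longrightarrow> u x > 0" and V: "\<And>x. a < x \<Longrightarrow> x < z \<Longrightarrow> V x \<le> B"
    and om: "u z * y z - v z * w z \<le> 0" and wz: "w z > 0" and x: "x \<in> {a..z}"
  shows "w x > 0 \<and> u x * y x - v x * w x \<le> 0"
proof -
  have step: "w c > 0 \<and> u c * y c - v c * w c \<le> 0"
    if c: "c \<in> {a..z}" and wp: "\<And>x. c < x \<Longrightarrow> x \<le> z \<Longrightarrow> w x > 0" for c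
  proof -
    have omc: "u t * y t - v t * w t \<le> 0" if t: "c \<le> t" "t \<le> z" for t
    proof -
      have "u t * y t - v t * w t \<le> u z * y z - v z * w z"
      proof (rule wronskian_le[OF sol_subinterval[OF u] sol_subinterval[OF w]])
        fix e assume e: "t < e" "e < z"
        then have "u e > 0" "w e > 0" "V e \<le> B" using c t wp[of e] pos[of e] V[of e] by auto
        then show "0 \<le> (B - lam - (V e - lam)) * (u e * w e)" by (intro mult_nonneg_nonneg) auto
      qed (use c t in auto)
      then show ?thesis using om by simp
    qed
    have "w z / u z \<le> w c / u c"
      by (rule ratio_nonincreasing[OF sol_subinterval[OF u] sol_subinterval[OF w]])
        (use c pos omc in auto)
    moreover have "w z / u z > 0" using wz pos[of z] az by auto
    ultimately have "w c / u c > 0" by linarith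
    then have "w c > 0" using pos[of c] c by (simp add: zero_less_divide_iff)
    then show ?thesis using omc[of c] c by auto
  qed
  have wpos: "w t > 0" if t: "t \<in> {a..z}" for t
  proof (rule ccontr)
    assume "\<not> w t > 0"
    then obtain c where c: "a \<le> c" "c \<le> z" "w c \<in> {..0}" "\<And>x. c < x \<Longrightarrow> x \<le> z \<Longrightarrow> w x \<notin> {..0}"
      using last_point_in_closed[OF sol_cont(1)[OF w] closed_atMost t, of 0] by auto
    then have "w x > 0" if "c < x" "x \<le> z" for x using c(4)[OF that] by simp
    then have "w c > 0" using step[of c] c by simp
    then show False using c by simp
  qed
  then show ?thesis using step[OF x] x by auto
qed

text \<open>The Wronskian rises as long as \<open>V \<le> B\<close> and falls afterwards, so it dominates its boundary values.\<close>

lemma wronskian_nonneg_increasing_potential: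
  assumes u: "sol (\<lambda>x. V x - lam) z b u v" and w: "sol (\<lambda>x. B - lam) z b w y" and zb: "z < b"
    and pos: "\<And>x. z < x \<Longrightarrow> x < b \<Longrightarrow> u x > 0" "\<And>x. z < x \<Longrightarrow> x < b \<Longrightarrow> w x > 0"
    and V: "\<And>x y. z \<le> x \<Longrightarrow> x \<le> y \<Longrightarrow> y \<le> b \<Longrightarrow> V x \<le> V y"
    and om: "u z * y z - v z * w z \<ge> 0" "u b * y b - v b * w b = 0"
  shows "x \<in> {z..b} \<Longrightarrow> u x * y x - v x * w x \<ge> 0"
    and "u z * y z - v z * w z = 0 \<Longrightarrow> V z \<le> B"
proof -
  assume x: "x \<in> {z..b}"
  show "u x * y x - v x * w x \<ge> 0"
  proof (cases "V x \<le> B")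
    case True
    have "u z * y z - v z * w z \<le> u x * y x - v x * w x"
    proof (rule wronskian_le[OF sol_subinterval[OF u] sol_subinterval[OF w]])
      fix t assume t: "z < t" "t < x"
      then have "V t \<le> B" using V[of t x] True x by auto
      then show "0 \<le> (B - lam - (V t - lam)) * (u t * w t)"
        using pos[of t] t x by (intro mult_nonneg_nonneg) auto
    qed (use x in auto)
    then show ?thesis using om by simp
  next
    case False
    have "u x * y x - v x * w x \<ge> u b * y b - v b * w b"
    proof (rule wronskian_ge[OF sol_subinterval[OF u] sol_subinterval[OF w]])
      fix t assume t: "x < t" "t < b"
      then have "V t \<ge> B" using V[of x t] False x by auto
      then show "(B - lam - (V t - lam)) * (u t * w t) \<le> 0"
        using pos[of t] t x by (intro mult_nonpos_nonneg) auto
    qed (use x in auto)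
    then show ?thesis using om by simp
  qed
next
  assume 0: "u z * y z - v z * w z = 0"
  \<comment> \<open>Otherwise \<open>V > B\<close> on all of the interval by monotonicity, and the
    Wronskian would decrease strictly between two zeros.\<close>
  show "V z \<le> B"
  proof (rule ccontr)
    assume "\<not> V z \<le> B"
    have "u z * y z - v z * w z > u b * y b - v b * w b"
    proof (rule wronskian_greater[OF u w zb])
      fix t assume t: "z < t" "t < b"
      then have "V t > B" using V[of z t] \<open>\<not> V z \<le> B\<close> by auto
      then show "(B - lam - (V t - lam)) * (u t * w t) < 0"
        using pos[of t] t by (intro mult_neg_pos) auto
    qed
    then show False using 0 om by simp
  qed
qed

text \<open>Source of rigidity in the equality case: a vanishing Wronskian has vanishing derivative,
  which is the difference of the potentials times a positive function.\<close>

lemma wronskian_zero_potential_eq: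
  assumes u: "sol (\<lambda>x. V x - lam) a b u v" and w: "sol (\<lambda>x. W x - lam) a b w y"
    and pos: "\<And>x. a < x \<Longrightarrow> x < b \<Longrightarrow> u x > 0" "\<And>x. a < x \<Longrightarrow> x < b \<Longrightarrow> w x > 0"
    and om: "\<And>x. a < x \<Longrightarrow> x < b \<Longrightarrow> u x * y x - v x * w x = 0"
  shows "\<exists>S. countable S \<and> (\<forall>x. a < x \<and> x < b \<and> x \<notin> S \<longrightarrow> V x = W x)"
proof -
  obtain S where S: "countable S"
    "\<And>x. a < x \<Longrightarrow> x < b \<Longrightarrow> x \<notin> S \<Longrightarrow>
       ((\<lambda>x. u x * y x - v x * w x) has_real_derivative (W x - lam - (V x - lam)) * (u x * w x)) (at x)"
    by (rule wronskian_deriv[OF u w]) blast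
  have "V x = W x" if x: "a < x" "x < b" "x \<notin> S" for x
  proof -
    have "((\<lambda>_. 0) has_real_derivative (W x - lam - (V x - lam)) * (u x * w x)) (at x)"
      by (rule has_field_derivative_transform_within_open[OF S(2)[OF x], of "{a<..<b}"]) (use om x in auto)
    then have "(W x - lam - (V x - lam)) * (u x * w x) = 0" by (rule DERIV_unique) simp
    then show ?thesis using pos[of x] x by auto
  qed
  then show ?thesis using S(1) by blast
qed

text \<open>On \<open>{z..l}\<close> and on \<open>{- l..0}\<close> the well crosses the constant
  level at most once, so the Wronskian is controlled by its values at the ends. On
  \<open>{0..z}\<close> the well lies below \<open>b\<close>, which carries the sign from
  \<open>z\<close> back to the centre.\<close>

lemma compare_to_step:
  assumes l: "0 < l" and tV: "tame V" and h: "0 < h" "h \<le> pi"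
    and Vdec: "\<And>x y. - l \<le> x \<Longrightarrow> x \<le> y \<Longrightarrow> y \<le> 0 \<Longrightarrow> V y \<le> V x"
    and Vinc: "\<And>x y. 0 \<le> x \<Longrightarrow> x \<le> y \<Longrightarrow> y \<le> l \<Longrightarrow> V x \<le> V y"
    and G: "ground_state V (- l) l (pi - h) h l1 u1 v1" and S: "second_state V (- l) l (pi - h) h l2 u2 v2 z" and z0: "0 \<le> z"
  shows "\<exists>b c w y m s t z'. ground_state (\<lambda>x. if x < 0 then c else b) (- l) l (pi - h) h l1 w y \<and>
    second_state (\<lambda>x. if x < 0 then c else b) (- l) l (pi - h) h m s t z' \<and> m \<le> l2 \<and>
    (m = l2 \<longrightarrow> (\<exists>S. countable S \<and> (\<forall>x. - l < x \<and> x < l \<and> x \<notin> S \<longrightarrow> V x = (if x < 0 then c else b))))"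
proof -
  note u1 = ground_stateD[OF G]
  have z: "0 \<le> z" "z < l" using z0 second_stateD(3)[OF S] by auto
  have g: "0 \<le> pi - h" "pi - h < pi" using h by auto
  have ll: "- l < l" "- l < z" using l z by auto
  have solu: "sol (\<lambda>x. V x - l1) (- l) l u1 v1" using u1 by (simp add: bvp_def)
  have bcu: "u1 (- l) * cos (pi - h) = v1 (- l) * sin (pi - h)" "u1 l * cos h = v1 l * sin h"
    using u1(1) unfolding bvp_def by blast+
  have l12: "l1 < l2" by (rule bvp_spectrum(1)[OF tV ll(1) g h G S])
  obtain r \<gamma> where r: "r > 0" "0 < \<gamma>" "\<gamma> < pi" "u1 z = r * sin \<gamma>" "v1 z = r * cos \<gamma>"
    using angle_exists[OF u1(2)[OF ll(2) z(2)], of "v1 z"] by auto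
  obtain \<kappa> e1 f1 where e1: "bvp (\<lambda>_. 0) z l \<gamma> h \<kappa> e1 f1" "e1 z = sin \<gamma>" "f1 z = cos \<gamma>"
    "\<And>x. z < x \<Longrightarrow> x < l \<Longrightarrow> e1 x > 0"
    using ground_state_exists[OF tame_const z(2) less_imp_le[OF r(2)] r(3) h, of 0] by (auto simp: ground_state_def)
  \<comment> \<open>A ground state of the zero potential with eigenvalue \<open>\<kappa>\<close>
    satisfies \<open>w'' = - \<kappa> w\<close>, that is \<open>w'' = (b - l1) w\<close>.\<close>
  define b where "b = l1 - \<kappa>"
  have e1s: "sol (\<lambda>_. b - l1) z l (\<lambda>x. r * e1 x) (\<lambda>x. r * f1 x)"
    using sol_scale[of "\<lambda>x. 0 - \<kappa>" z l e1 f1 r] e1(1) by (simp add: bvp_def b_def)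
  have "\<exists>w0 y0. sol (\<lambda>_. b - l1) 0 l w0 y0 \<and> (\<forall>x. z \<le> x \<longrightarrow> w0 x = r * e1 x \<and> y0 x = r * f1 x)"
  proof (cases "z = 0")
    case True
    then show ?thesis using e1s by blast
  next
    case False
    then obtain w0 y0 where w0: "sol (\<lambda>_. b - l1) 0 z w0 y0" "w0 z = r * e1 z" "y0 z = r * f1 z"
      using ivp_right_exists[OF tame_const, of 0 z "b - l1" "r * e1 z" "r * f1 z"] z by auto
    have "sol (\<lambda>_. b - l1) 0 l (\<lambda>x. if x \<le> z then w0 x else r * e1 x) (\<lambda>x. if x \<le> z then y0 x else r * f1 x)"
      by (rule sol_glue[OF w0(1) e1s]) (use z w0 in auto)
    then show ?thesis using w0
      by (intro exI[of _ "\<lambda>x. if x \<le> z then w0 x else r * e1 x"] exI[of _ "\<lambda>x. if x \<le> z then y0 x else r * f1 x"]) auto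
  qed
  then obtain w0 y0 where w0: "sol (\<lambda>_. b - l1) 0 l w0 y0"
    "\<And>x. z \<le> x \<Longrightarrow> w0 x = r * e1 x" "\<And>x. z \<le> x \<Longrightarrow> y0 x = r * f1 x" by blast
  have wz: "w0 z = u1 z" "y0 z = v1 z" using w0(2,3)[of z] e1 r by auto
  have bcw: "w0 l * cos h = y0 l * sin h"
    using w0(2,3)[of l] z e1(1) by (simp add: bvp_def)
  have om_z: "u1 z * y0 z - v1 z * w0 z = 0" by (simp add: wz)
  have om_l: "u1 l * y0 l - v1 l * w0 l = 0" by (rule bc_wronskian_zero[OF bcu(2) bcw])
  have posz: "w0 x > 0" if "z < x" "x < l" for x using w0(2)[of x] e1(4)[OF that] that r(1) by simp
  have uzl: "sol (\<lambda>x. V x - l1) z l u1 v1" by (rule sol_subinterval[OF solu]) (use z l in auto)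
  have wzl: "sol (\<lambda>_. b - l1) z l w0 y0" by (rule sol_subinterval[OF w0(1)]) (use z l in auto)
  have u1pos: "u1 x > 0" if "0 \<le> x" "x < l" for x using u1(2)[of x] that l by simp
  note R = wronskian_nonneg_increasing_potential[OF uzl wzl z(2) u1pos posz Vinc _ om_l]
  have om_right: "u1 x * y0 x - v1 x * w0 x \<ge> 0" if "x \<in> {z..l}" for x
    by (rule R(1)) (use z that om_z in auto)
  \<comment> \<open>The Wronskian vanishes at both \<open>z\<close> and \<open>l\<close>, so the
    level \<open>b\<close> cannot lie below \<open>V z\<close>; hence \<open>V \<le> b\<close> on
    \<open>{0..z}\<close>.\<close>
  have Vz: "V z \<le> b"
    by (rule R(2)) (use z om_z in auto)
  have mid: "w0 x > 0 \<and> u1 x * y0 x - v1 x * w0 x \<le> 0" if "x \<in> {0..z}" for x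
  proof (rule continue_left_positive[OF sol_subinterval[OF solu] sol_subinterval[OF w0(1)] z(1) _ _ _ _ that])
    show "V x \<le> b" if "0 < x" "x < z" for x using Vinc[of x z] Vz that z by auto
  qed (use z l u1pos om_z wz in auto)
  have w00: "w0 0 > 0" "u1 0 * y0 0 - v1 0 * w0 0 \<le> 0" using mid[of 0] z by auto
  \<comment> \<open>The logarithmic derivative of \<open>w\<close> at the centre becomes a boundary
    angle for the left half; its ground state determines the level \<open>c\<close> in the same way
    as \<open>b\<close>.\<close>
  obtain r' h' where r': "r' > 0" "0 < h'" "h' < pi" "w0 0 = r' * sin h'" "y0 0 = r' * cos h'"
    using angle_exists[OF w00(1), of "y0 0"] by auto
  have nl: "- l < 0" using l by simp
  obtain \<kappa>' e2 f2 where e2: "bvp (\<lambda>_. 0) (- l) 0 (pi - h) h' \<kappa>' e2 f2"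
    "\<And>x. - l < x \<Longrightarrow> x < 0 \<Longrightarrow> e2 x > 0"
    using ground_state_exists[OF tame_const nl g r'(2) less_imp_le[OF r'(3)], of 0] by (auto simp: ground_state_def)
  have e2s: "sol (\<lambda>_. 0 - \<kappa>') (- l) 0 e2 f2" using e2(1) by (simp add: bvp_def)
  have bce: "e2 0 * cos h' = f2 0 * sin h'" "e2 (- l) * cos (pi - h) = f2 (- l) * sin (pi - h)"
    using e2(1) unfolding bvp_def by blast+
  have sh': "sin h' > 0" using r' by (intro sin_gt_zero) auto
  have "e2 0 \<noteq> 0"
  proof
    assume "e2 0 = 0"
    then have "f2 0 = 0" using bce(1) sh' by simp
    then have "e2 (- l / 2) = 0"
      using sol_zero[OF e2s tame_const \<open>e2 0 = 0\<close>, of "- l / 2"] l by simp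
    then show False using e2(2)[of "- l / 2"] l by simp
  qed
  moreover have "e2 0 \<ge> 0"
  proof -
    have "(e2 \<longlongrightarrow> e2 0) (at_left 0)"
      using sol_cont(1)[OF e2s] nl by (auto simp: continuous_on_def at_within_Icc_at_left[OF nl, symmetric])
    then show ?thesis
      by (rule tendsto_lowerbound) (use l e2(2) in \<open>auto simp: eventually_at_left[OF nl] intro!: exI[of _ "- l"] less_imp_le\<close>)
  qed
  ultimately have e20: "e2 0 > 0" by simp
  define k where "k = w0 0 / e2 0"
  have k: "k > 0" "k * e2 0 = w0 0" using w00 e20 by (auto simp: k_def)
  \<comment> \<open>Scaling matches the values at 0; the derivatives then agree because both vectors
    have direction \<open>h'\<close>.\<close>
  have k2: "k * f2 0 = y0 0"
  proof -
    have "k * f2 0 * sin h' = (k * e2 0) * cos h'" using bce(1) by simp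
    also have "\<dots> = y0 0 * sin h'" unfolding k(2) r' by simp
    finally show ?thesis using sh' by simp
  qed
  define c where "c = l1 - \<kappa>'"
  define wl yl where "wl x = k * e2 x" and "yl x = k * f2 x" for x
  have wls: "sol (\<lambda>_. c - l1) (- l) 0 wl yl"
    using sol_scale[OF e2s, of k] by (simp add: c_def wl_def[abs_def] yl_def[abs_def])
  have wl0: "wl 0 = w0 0" "yl 0 = y0 0" using k(2) k2 by (auto simp: wl_def yl_def)
  have wlpos: "wl x > 0" if "- l < x" "x < 0" for x using e2(2)[OF that] k by (simp add: wl_def)
  have bcl: "wl (- l) * cos (pi - h) = yl (- l) * sin (pi - h)" by (simp only: wl_def yl_def mult.assoc bce(2))
  have om_ml: "u1 (- l) * yl (- l) - v1 (- l) * wl (- l) = 0" by (rule bc_wronskian_zero[OF bcu(1) bcl])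
  \<comment> \<open>Reflected to \<open>{0..l}\<close> the left branch of the well is nondecreasing,
    and the nonpositive Wronskian at the centre turns nonnegative.\<close>
  have om_left: "u1 x * yl x - v1 x * wl x \<le> 0" if x: "x \<in> {- l..0}" for x
  proof -
    have su: "sol (\<lambda>x. V (- x) - l1) 0 l (\<lambda>x. u1 (- x)) (\<lambda>x. - v1 (- x))"
      by (rule sol_subinterval[OF sol_reflect[OF solu]]) (use l in auto)
    have sw: "sol (\<lambda>_. c - l1) 0 l (\<lambda>x. wl (- x)) (\<lambda>x. - yl (- x))"
      using sol_reflect[OF wls] by simp
    have "u1 (- (- x)) * - yl (- (- x)) - - v1 (- (- x)) * wl (- (- x)) \<ge> 0"
      by (rule wronskian_nonneg_increasing_potential(1)[OF su sw l])
        (use x u1(2) wlpos Vdec w00 om_ml wl0 in auto)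
    then show ?thesis by simp
  qed
  define W where "W x = (if x < 0 then c else b)" for x :: real
  define w y where "w x = (if x \<le> 0 then wl x else w0 x)" and "y x = (if x \<le> 0 then yl x else y0 x)" for x
  have ws: "sol (\<lambda>x. W x - l1) (- l) l w y"
    unfolding w_def y_def
    by (rule sol_glue[OF sol_cong[OF wls, of "{}"] sol_cong[OF w0(1), of "{}"]])
      (use l wl0 in \<open>auto simp: W_def\<close>)
  have w_right: "w x = w0 x" "y x = y0 x" if "x \<ge> 0" for x
    using that wl0 by (cases "x = 0"; simp add: w_def y_def)+
  have w_left: "w x = wl x" "y x = yl x" if "x \<le> 0" for x
    using that by (auto simp: w_def y_def)
  have wpos: "w x > 0" if "- l < x" "x < l" for x
  proof -
    consider "x < 0" | "0 \<le> x" "x \<le> z" | "z < x" by linarith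
    then show ?thesis
      by cases (use wlpos[of x] mid[of x] posz[of x] w_left(1)[of x] w_right(1)[of x] that z in auto)
  qed
  have bw: "bvp W (- l) l (pi - h) h l1 w y"
    unfolding bvp_def
  proof (intro conjI ws bexI[of _ 0])
    have "- l \<le> 0" "0 \<le> l" using l by auto
    then show "w (- l) * cos (pi - h) = y (- l) * sin (pi - h)" "w l * cos h = y l * sin h"
      by (simp_all only: w_left w_right bcl bcw)
    show "w 0 \<noteq> 0" "0 \<in> {- l..l}" using wpos[of 0] l by auto
  qed
  have tW: "tame W" unfolding W_def by (rule tame_step)
  have G': "ground_state W (- l) l (pi - h) h l1 w y" using bw wpos by (simp add: ground_state_def)
  obtain m s t z' where S': "second_state W (- l) l (pi - h) h m s t z'"
    using second_state_exists[OF tW ll(1) g h] by blast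
  have cmp: "m \<le> l2 \<and> (m = l2 \<longrightarrow> (\<forall>x. - l < x \<and> x < l \<longrightarrow> u1 x * y x - v1 x * w x = 0))"
  proof (rule gap_comparison[OF G tV S G' S' l12])
    fix x
    show "0 \<le> u1 x * y x - v1 x * w x" if "z \<le> x" "x \<le> l"
      using om_right[of x] w_right[of x] that z by auto
    show "u1 x * y x - v1 x * w x \<le> 0" if "- l \<le> x" "x \<le> z"
      using om_left[of x] mid[of x] w_right[of x] w_left[of x] that by (cases "x \<le> 0") auto
  qed
  have eq: "\<exists>S. countable S \<and> (\<forall>x. - l < x \<and> x < l \<and> x \<notin> S \<longrightarrow> V x = W x)" if "m = l2"
    by (rule wronskian_zero_potential_eq[OF solu ws u1(2) wpos]) (use cmp that in auto)
  have "ground_state W (- l) l (pi - h) h l1 w y \<and> second_state W (- l) l (pi - h) h m s t z' \<and> m \<le> l2 \<and>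
    (m = l2 \<longrightarrow> (\<exists>S. countable S \<and> (\<forall>x. - l < x \<and> x < l \<and> x \<notin> S \<longrightarrow> V x = W x)))"
    by (intro conjI G' S') (use cmp eq in blast)+
  then show ?thesis unfolding W_def[abs_def] by blast
qed

section \<open>The gap of a step potential\<close>

lemma arctan_midpoint_concave:
  assumes "0 \<le> x" "0 \<le> y"
  shows "arctan x + arctan y \<le> 2 * arctan ((x + y) / 2)"
proof -
  have main: "arctan x + arctan y \<le> 2 * arctan ((x + y) / 2)" if xy: "0 \<le> x" "x < y" for x y :: real
  proof -
    define m where "m = (x + y) / 2"
    have m: "x < m" "m < y" "m - x = y - m" using xy by (auto simp: m_def field_simps)
    obtain p where p: "x < p" "p < m" "arctan m - arctan x = (m - x) * inverse (1 + p\<^sup>2)"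
      using MVT2[OF m(1), of arctan "\<lambda>x. inverse (1 + x\<^sup>2)"] DERIV_arctan by blast
    obtain q where q: "m < q" "q < y" "arctan y - arctan m = (y - m) * inverse (1 + q\<^sup>2)"
      using MVT2[OF m(2), of arctan "\<lambda>x. inverse (1 + x\<^sup>2)"] DERIV_arctan by blast
    have "p\<^sup>2 \<le> q\<^sup>2" using p q xy by (intro power_mono) auto
    then have "inverse (1 + q\<^sup>2) \<le> inverse (1 + p\<^sup>2)" by (intro le_imp_inverse_le) (auto simp: add_pos_nonneg)
    then have "(y - m) * inverse (1 + q\<^sup>2) \<le> (m - x) * inverse (1 + p\<^sup>2)"
      unfolding m(3) using m by (intro mult_left_mono) auto
    then show ?thesis using p q unfolding m_def by linarith
  qed
  show ?thesis
    using main[of x y] main[of y x] assms by (cases x y rule: linorder_cases) (auto simp: add.commute)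
qed

lemma sol_cos: "sol (\<lambda>_. - k\<^sup>2) a b (\<lambda>x. cos (k * x)) (\<lambda>x. - (k * sin (k * x)))"
  by (rule solI[of _ _ _ _ "{}"]) (auto intro!: continuous_intros derivative_eq_intros simp: power2_eq_square)

lemma sol_sin: "sol (\<lambda>_. - k\<^sup>2) a b (\<lambda>x. sin (k * x)) (\<lambda>x. k * cos (k * x))"
  by (rule solI[of _ _ _ _ "{}"]) (auto intro!: continuous_intros derivative_eq_intros simp: power2_eq_square)

lemma sol_deriv_nonneg:
  assumes s: "sol q a b u v" and ab: "a < b" and "u a = 0" and pos: "\<And>x. a < x \<Longrightarrow> x < b \<Longrightarrow> u x > 0"
  shows "v a \<ge> 0"
proof -
  have "((\<lambda>x. u x / (x - a)) \<longlongrightarrow> v a) (at_right a)"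
    using sol_deriv_within[OF s, of a] assms(2,3) by (simp add: has_field_derivative_iff at_within_Icc_at_right)
  then show ?thesis
    by (rule tendsto_lowerbound) (use ab pos in \<open>auto simp: eventually_at_right intro!: exI[of _ b] divide_nonneg_pos less_imp_le\<close>)
qed

section \<open>The Robin phase and its concavity\<close>

text \<open>The solution with \<open>-u'' = k^2 u\<close> satisfying the boundary condition at \<open>l\<close> is a multiple of
  \<open>cos (k (l - x) - \<theta>)\<close> with \<open>\<theta> = arctan (\<alpha> / k)\<close>. The form below also covers \<open>k = 0\<close>, and since
  \<open>tan pi = 0\<close> it gives \<open>\<theta> = pi / 2\<close> in the Dirichlet case \<open>h = pi\<close>.\<close>

definition robin_shift :: "real \<Rightarrow> real \<Rightarrow> real" where
  "robin_shift h k = (if h = pi / 2 then 0 else pi / 2 - arctan (- (k * tan h)))"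

definition robin_phase :: "real \<Rightarrow> real \<Rightarrow> real \<Rightarrow> real" where
  "robin_phase h l k = k * l - robin_shift h k"

context
  fixes h l :: real
  assumes h: "pi / 2 \<le> h" "h \<le> pi" and l: "0 < l"
begin

lemma tan_nonpos: "h \<noteq> pi / 2 \<Longrightarrow> tan h \<le> 0 \<and> cos h < 0"
proof -
  assume "h \<noteq> pi / 2"
  then have "sin (h - pi / 2) > 0" using h pi_gt_zero by (intro sin_gt_zero) linarith+
  then have c: "cos h < 0" by (simp add: sin_diff)
  have "sin h \<ge> 0" using h pi_gt_zero by (intro sin_ge_zero) linarith+
  then show ?thesis using c by (simp add: tan_def divide_nonneg_neg)
qed

lemma robin_shift_nonneg: "0 \<le> robin_shift h k"
  using arctan_ubound[of "- (k * tan h)"] by (auto simp: robin_shift_def)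

lemma robin_shift_le: "0 \<le> k \<Longrightarrow> robin_shift h k \<le> pi / 2"
  using tan_nonpos by (auto simp: robin_shift_def mult_nonneg_nonpos)

lemma robin_shift_bc: "cos (robin_shift h k) * cos h = - (k * sin (robin_shift h k)) * sin h"
proof (cases "h = pi / 2")
  case True
  then have "cos h = 0" by (simp only: cos_pi_half)
  then show ?thesis using True by (simp only: robin_shift_def) simp
next
  case False
  define A where "A = arctan (- (k * tan h))"
  have c: "cos h < 0" using tan_nonpos[OF False] by simp
  have "sin A = tan A * cos A" using cos_arctan_not_zero[of "- (k * tan h)"] by (simp add: tan_def A_def)
  also have "tan A = - (k * tan h)" by (simp add: A_def tan_arctan)
  finally have "sin A * cos h = - (k * (tan h * cos h)) * cos A" by (simp add: algebra_simps)
  also have "tan h * cos h = sin h" using c by (simp add: tan_def)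
  finally have "sin A * cos h = - (k * cos A) * sin h" by (simp add: algebra_simps)
  moreover have "robin_shift h k = pi / 2 - A" using False by (simp add: robin_shift_def A_def)
  ultimately show ?thesis by (simp add: sin_diff cos_diff)
qed

lemma robin_phase_strict_mono:
  assumes "0 \<le> k" "k < k'"
  shows "robin_phase h l k < robin_phase h l k'"
proof -
  have "k * l < k' * l" using assms l by simp
  moreover have "robin_shift h k' \<le> robin_shift h k"
  proof (cases "h = pi / 2")
    case False
    have "k' * tan h \<le> k * tan h" using tan_nonpos[OF False] assms by (intro mult_right_mono_neg) auto
    then show ?thesis using False by (simp add: robin_shift_def arctan_le_iff)
  qed (simp add: robin_shift_def)
  ultimately show ?thesis by (simp add: robin_phase_def)
qed

text \<open>Apart from affine terms the phase is \<open>arctan (- k tan h)\<close>, concave for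
  \<open>k \<ge> 0\<close> because \<open>- tan h \<ge> 0\<close>; this is the use of \<alpha> \<ge>
  0.\<close>

lemma robin_phase_midpoint_concave:
  assumes "0 \<le> k" "0 \<le> k'"
  shows "robin_phase h l k + robin_phase h l k' \<le> 2 * robin_phase h l ((k + k') / 2)"
proof (cases "h = pi / 2")
  case True
  then show ?thesis by (simp add: robin_phase_def robin_shift_def algebra_simps)
next
  case False
  have t: "0 \<le> - tan h" using tan_nonpos[OF False] by simp
  have p: "robin_phase h l x = x * l - pi / 2 + arctan (x * (- tan h))" for x
    using False by (simp add: robin_phase_def robin_shift_def)
  have "arctan (k * (- tan h)) + arctan (k' * (- tan h)) \<le> 2 * arctan ((k * (- tan h) + k' * (- tan h)) / 2)"
    by (rule arctan_midpoint_concave) (use t assms in \<open>auto simp: mult_nonneg_nonpos\<close>)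
  also have "(k * (- tan h) + k' * (- tan h)) / 2 = (k + k') / 2 * (- tan h)" by (simp add: field_simps)
  finally have "arctan (k * (- tan h)) + arctan (k' * (- tan h)) \<le> 2 * arctan ((k + k') / 2 * (- tan h))" .
  moreover have "2 * ((k + k') / 2 * l) = k * l + k' * l" by (simp add: field_simps)
  moreover have "A + B \<le> 2 * C \<Longrightarrow> 2 * m = x + y \<Longrightarrow> x - pi / 2 + A + (y - pi / 2 + B) \<le> 2 * (m - pi / 2 + C)"
    for A B C m x y :: real by simp
  ultimately show ?thesis unfolding p by blast
qed

lemma robin_phase_cont: "continuous_on S (robin_phase h l)"
  unfolding robin_phase_def robin_shift_def by (cases "h = pi / 2") (auto intro!: continuous_intros)

text \<open>At the centre the explicit solution has value \<open>cos\<close> and derivative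
  \<open>k sin\<close> of its phase. Phase 0 thus means a Neumann condition there, and phase
  \<open>pi / 2\<close> a Dirichlet condition: \<open>kN\<close> and \<open>kD\<close> are the
  frequencies of the even ground state and the odd second state of a constant potential.\<close>

lemma robin_frequencies:
  obtains kN kD where "0 \<le> kN" "kN < kD" "robin_phase h l kN = 0" "robin_phase h l kD = pi / 2"
proof -
  have p0: "robin_phase h l 0 \<le> 0" using robin_shift_nonneg[of 0] by (simp add: robin_phase_def)
  \<comment> \<open>Upper brackets for both frequencies, from the bound \<open>pi / 2\<close> on the
    shift.\<close>
  have pu: "robin_phase h l (pi / (2 * l)) \<ge> 0" "robin_phase h l (pi / l) \<ge> pi / 2"
    using robin_shift_le[of "pi / (2 * l)"] robin_shift_le[of "pi / l"] l by (auto simp: robin_phase_def)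
  obtain kN where kN: "0 \<le> kN" "robin_phase h l kN = 0"
    using IVT'[OF p0 pu(1) _ robin_phase_cont] l by auto
  have "robin_phase h l 0 \<le> pi / 2" using p0 pi_gt_zero by linarith
  then obtain kD where kD: "0 \<le> kD" "robin_phase h l kD = pi / 2"
    using IVT'[OF _ pu(2) _ robin_phase_cont, of 0] l by auto
  have "kN < kD"
    using robin_phase_strict_mono[of kD kN] kN kD pi_gt_zero by (cases kN kD rule: linorder_cases) auto
  then show ?thesis using that kN kD by blast
qed

lemma bc_cos:
  assumes "robin_phase h l k = 0"
  shows "cos (k * l) * cos h = - (k * sin (k * l)) * sin h"
  using robin_shift_bc[of k] assms by (simp add: robin_phase_def)

lemma bc_sin:
  assumes "robin_phase h l k = pi / 2"
  shows "sin (k * l) * cos h = (k * cos (k * l)) * sin h"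
proof -
  have "k * l = pi / 2 + robin_shift h k" using assms by (simp add: robin_phase_def)
  then show ?thesis using robin_shift_bc[of k] by (simp add: sin_add cos_add)
qed

lemma cos_pos:
  assumes "robin_phase h l k = 0" "0 \<le> k" "\<bar>x\<bar> < l"
  shows "cos (k * x) > 0"
proof (cases "k = 0")
  case False
  have "\<bar>k * x\<bar> < k * l" using False assms by (simp add: abs_mult)
  also have "\<dots> \<le> pi / 2" using assms robin_shift_le[of k] by (simp add: robin_phase_def)
  finally show ?thesis by (intro cos_gt_zero_pi) (auto simp: abs_less_iff)
qed simp

lemma sin_pos:
  assumes "robin_phase h l k = pi / 2" "0 < k" "0 < x" "x < l"
  shows "sin (k * x) > 0"
proof -
  have "k * x < k * l" using assms by simp
  also have "\<dots> \<le> pi" using assms robin_shift_le[of k] by (simp add: robin_phase_def)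
  finally show ?thesis using assms by (intro sin_gt_zero) auto
qed

text \<open>The boundary condition at \<open>l\<close> leaves a one-parameter family. Its data at
  the centre in terms of the phase are what the two halves of a step have to match.\<close>

lemma sol_explicit:
  assumes s: "sol (\<lambda>_. - k\<^sup>2) 0 l s t" and k: "0 < k" and bc: "s l * cos h = t l * sin h" and nz: "s 0 \<noteq> 0"
  obtains K where "K \<noteq> 0" "s 0 = K * cos (robin_phase h l k)" "t 0 = K * (k * sin (robin_phase h l k))"
proof -
  define \<theta> where "\<theta> = robin_shift h k"
  define f g where "f x = cos (k * (l - x) - \<theta>)" and "g x = k * sin (k * (l - x) - \<theta>)" for x
  have fs: "sol (\<lambda>_. - k\<^sup>2) 0 l f g"
    unfolding f_def g_def
    by (rule solI[of _ _ _ _ "{}"]) (auto intro!: continuous_intros derivative_eq_intros simp: power2_eq_square)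
  have fl: "f l = cos \<theta>" "g l = - (k * sin \<theta>)" by (auto simp: f_def g_def)
  have "f l * cos h = g l * sin h" unfolding fl \<theta>_def by (rule robin_shift_bc)
  from bc_wronskian_zero[OF bc this] have w: "s l * g l = t l * f l" by simp
  define d where "d = (f l)\<^sup>2 + (g l)\<^sup>2"
  have d: "d > 0"
  proof -
    have "cos \<theta> \<noteq> 0 \<or> sin \<theta> \<noteq> 0" using sin_cos_squared_add[of \<theta>] by force
    then show ?thesis using k unfolding d_def fl by (auto simp: sum_power2_gt_zero_iff)
  qed
  define K where "K = (s l * f l + t l * g l) / d"
  have Kl: "s l = K * f l" "t l = K * g l"
  proof -
    have "s l * d = (s l * f l + t l * g l) * f l"
      using w unfolding d_def by (simp add: power2_eq_square algebra_simps)
    then show "s l = K * f l" using d by (simp add: K_def field_simps)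
    have "t l * d = (s l * f l + t l * g l) * g l"
      using w unfolding d_def by (simp add: power2_eq_square algebra_simps)
    then show "t l = K * g l" using d by (simp add: K_def field_simps)
  qed
  have "1 * s 0 + (- K) * f 0 = 0 \<and> 1 * t 0 + (- K) * g 0 = 0"
    using sol_zero[OF sol_lincomb[OF s fs, of 1 "- K"] tame_const, of l 0] Kl l by simp
  then have "s 0 = K * f 0" "t 0 = K * g 0" by auto
  moreover have "f 0 = cos (robin_phase h l k)" "g 0 = k * sin (robin_phase h l k)"
    by (auto simp: f_def g_def robin_phase_def \<theta>_def)
  ultimately show ?thesis using that nz by auto
qed

text \<open>Under the contrary assumption, ground-state comparison gives
  \<open>e \<le> a \<le> a' \<le> e'\<close>, while matching the two halves of the second state at 0
  and concavity of the phase give \<open>e' < e\<close>.\<close>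

lemma step_gap:
  assumes bc: "b < c"
    and gs: "ground_state (\<lambda>x. if x < 0 then c else b) (- l) l (pi - h) h l1 w y"
    and se: "second_state (\<lambda>x. if x < 0 then c else b) (- l) l (pi - h) h m s t z'"
    and kN: "0 \<le> kN" "robin_phase h l kN = 0" and kD: "robin_phase h l kD = pi / 2" "kN < kD"
  shows "kD\<^sup>2 - kN\<^sup>2 < m - l1"
proof (rule ccontr)
  assume "\<not> kD\<^sup>2 - kN\<^sup>2 < m - l1"
  note w = ground_stateD[OF gs]
  note s = second_stateD(1)[OF se] and z' = second_stateD(2,3)[OF se] and ss = second_stateD(4,5)[OF se]
  have contra: "m - l1 \<le> kD\<^sup>2 - kN\<^sup>2" using \<open>\<not> kD\<^sup>2 - kN\<^sup>2 < m - l1\<close> by simp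
  define N D where "N = kN\<^sup>2" and "D = kD\<^sup>2"
  \<comment> \<open>With respect to \<open>N\<close> and \<open>D\<close>, the unprimed numbers are
    excesses of the squared frequency on the low half, the primed ones deficits on the high half.
    Both pairs add up to \<open>c - b\<close>.\<close>
  define a a' where "a = l1 - b - N" and "a' = N - (l1 - c)"
  define e e' where "e = m - b - D" and "e' = D - (m - c)"
  have ee: "e \<le> a" "a' \<le> e'" "e + e' = a + a'" "a + a' > 0"
    using contra bc by (auto simp: e_def e'_def a_def a'_def N_def D_def)
  have sw: "sol (\<lambda>x. (if x < 0 then c else b) - l1) (- l) l w y" and sst: "sol (\<lambda>x. (if x < 0 then c else b) - m) (- l) l s t"
    using w(1) s by (auto simp: bvp_def)
  have bcw: "w l * cos h = y l * sin h" "w (- l) * cos (pi - h) = y (- l) * sin (pi - h)"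
    using w(1) unfolding bvp_def by blast+
  have bcs: "s l * cos h = t l * sin h" "s (- l) * cos (pi - h) = t (- l) * sin (pi - h)"
    using s unfolding bvp_def by blast+
  have wR: "sol (\<lambda>_. b - l1) 0 l w y"
    by (rule sol_cong[OF sol_subinterval[OF sw], of _ _ "{}"]) (use l in auto)
  have sR: "sol (\<lambda>_. b - m) 0 l s t"
    by (rule sol_cong[OF sol_subinterval[OF sst], of _ _ "{}"]) (use l in auto)
  define wt yt where "wt x = w (- x)" and "yt x = - y (- x)" for x
  define sl tl where "sl x = - s (- x)" and "tl x = t (- x)" for x
  have wL: "sol (\<lambda>_. c - l1) 0 l wt yt"
    unfolding wt_def yt_def
    by (rule sol_cong[OF sol_subinterval[OF sol_reflect[OF sw]], of _ _ "{}"]) (use l in auto)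
  have "sol (\<lambda>_. c - m) 0 l (\<lambda>x. s (- x)) (\<lambda>x. - t (- x))"
    by (rule sol_cong[OF sol_subinterval[OF sol_reflect[OF sst]], of _ _ "{}"]) (use l in auto)
  from sol_scale[OF this, of "- 1"] have sL: "sol (\<lambda>_. c - m) 0 l sl tl"
    by (simp add: sl_def[abs_def] tl_def[abs_def])
  have bcwt: "wt l * cos h = yt l * sin h" using reflect_bc[OF bcw(2)] by (simp add: wt_def yt_def)
  have bcsl: "sl l * cos h = tl l * sin h" using reflect_bc[OF bcs(2)] by (simp add: sl_def tl_def)
  have wpos: "w x > 0" "wt x > 0" if "0 \<le> x" "x < l" for x using w(2)[of x] w(2)[of "- x"] that l by (auto simp: wt_def)
  define C C' where "C x = cos (kN * x)" and "C' x = - (kN * sin (kN * x))" for x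
  define S S' where "S x = sin (kD * x)" and "S' x = kD * cos (kD * x)" for x
  have solC: "sol (\<lambda>_. - N) 0 l C C'" unfolding C_def C'_def N_def by (rule sol_cos)
  have solS: "sol (\<lambda>_. - D) 0 l S S'" unfolding S_def S'_def D_def by (rule sol_sin)
  have C0: "C 0 = 1" "C' 0 = 0" and S0: "S 0 = 0" "S' 0 = kD" by (auto simp: C_def C'_def S_def S'_def)
  have kDp: "0 < kD" using kN kD by simp
  have bcC: "C l * cos h = C' l * sin h" unfolding C_def C'_def by (rule bc_cos[OF kN(2)])
  have bcS: "S l * cos h = S' l * sin h" unfolding S_def S'_def by (rule bc_sin[OF kD(1)])
  have Cpos: "C x > 0" if "0 \<le> x" "x < l" for x unfolding C_def by (rule cos_pos[OF kN(2,1)]) (use that in auto)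
  have Spos: "S x > 0" if "0 < x" "x < l" for x unfolding S_def by (rule sin_pos[OF kD(1) kDp that])
  \<comment> \<open>The ground state rises across the centre towards the low half, seen from its
    Wronskian with its own reflection.\<close>
  have y0: "y 0 > 0"
  proof -
    have "wt 0 * y 0 - yt 0 * w 0 > wt l * y l - yt l * w l"
    proof (rule wronskian_greater[OF wL wR l])
      fix x assume x: "0 < x" "x < l"
      then show "(b - l1 - (c - l1)) * (wt x * w x) < 0" using wpos[of x] bc by (intro mult_neg_pos) auto
    qed
    moreover have "wt l * y l - yt l * w l = 0" by (rule bc_wronskian_zero[OF bcwt bcw(1)])
    ultimately have "2 * (w 0 * y 0) > 0" by (simp add: wt_def yt_def)
    then show ?thesis using wpos(1)[of 0] l by (simp add: zero_less_mult_iff)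
  qed
  \<comment> \<open>The ground state is larger on the low half than at the mirror point.\<close>
  have wt_le: "wt x \<le> w x" if x: "0 \<le> x" "x < l" for x
  proof -
    have "wt x / w x \<le> wt 0 / w 0"
    proof (rule ratio_nonincreasing[OF sol_subinterval[OF wR] sol_subinterval[OF wL]])
      fix r assume r: "0 < r" "r < x"
      have "w r * yt r - y r * wt r \<le> w l * yt l - y l * wt l"
      proof (rule wronskian_le[OF sol_subinterval[OF wR] sol_subinterval[OF wL]])
        fix q assume "r < q" "q < l"
        then show "0 \<le> (c - l1 - (b - l1)) * (w q * wt q)" using wpos[of q] r bc by (intro mult_nonneg_nonneg) auto
      qed (use r x in auto)
      also have "\<dots> = 0" by (rule bc_wronskian_zero[OF bcw(1) bcwt])
      finally show "w r * yt r - y r * wt r \<le> 0" .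
    qed (use x wpos in auto)
    also have "wt 0 / w 0 = 1" using wpos[of 0] l by (simp add: wt_def)
    finally show ?thesis using wpos[of x] x by (simp add: divide_le_eq)
  qed
  have CwL: "C l * y l - C' l * w l = 0" "C l * yt l - C' l * wt l = 0"
    by (rule bc_wronskian_zero[OF bcC bcw(1)], rule bc_wronskian_zero[OF bcC bcwt])
  have a'0: "a' > 0"
  proof (rule ccontr)
    assume "\<not> a' > 0"
    have "C 0 * yt 0 - C' 0 * wt 0 \<ge> C l * yt l - C' l * wt l"
    proof (rule wronskian_ge[OF solC wL])
      fix x assume "0 < x" "x < l"
      then show "(c - l1 - - N) * (C x * wt x) \<le> 0"
        using wpos[of x] Cpos[of x] \<open>\<not> a' > 0\<close> by (intro mult_nonpos_nonneg) (auto simp: a'_def)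
    qed (use l in simp)
    then show False using y0 CwL C0 by (simp add: yt_def)
  qed
  \<comment> \<open>In the sum of the two Wronskians with the cosine the contributions of
    \<open>y 0\<close> cancel. So \<open>C (a w - a' wt)\<close> integrates to zero, which
    \<open>wt \<le> w\<close> excludes if \<open>a > a'\<close>.\<close>
  have aa': "a \<le> a'"
  proof (rule ccontr)
    assume "\<not> a \<le> a'"
    obtain S1 where S1: "countable S1" "continuous_on {0..l} (\<lambda>x. C x * y x - C' x * w x)"
      "\<And>x. 0 < x \<Longrightarrow> x < l \<Longrightarrow> x \<notin> S1 \<Longrightarrow>
       ((\<lambda>x. C x * y x - C' x * w x) has_real_derivative (b - l1 - - N) * (C x * w x)) (at x)"
      by (rule wronskian_deriv[OF solC wR]) blast
    obtain S2 where S2: "countable S2" "continuous_on {0..l} (\<lambda>x. C x * yt x - C' x * wt x)"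
      "\<And>x. 0 < x \<Longrightarrow> x < l \<Longrightarrow> x \<notin> S2 \<Longrightarrow>
       ((\<lambda>x. C x * yt x - C' x * wt x) has_real_derivative (c - l1 - - N) * (C x * wt x)) (at x)"
      by (rule wronskian_deriv[OF solC wL]) blast
    let ?P = "\<lambda>x. - (C x * y x - C' x * w x) - (C x * yt x - C' x * wt x)"
    have "?P 0 < ?P l"
    proof (rule increasing_off_countable[OF l, of _ "S1 \<union> S2"])
      show "continuous_on {0..l} ?P" by (intro continuous_intros S1(2) S2(2))
      show "countable (S1 \<union> S2)" using S1 S2 by simp
      fix x assume x: "0 < x" "x < l" "x \<notin> S1 \<union> S2"
      have "(?P has_real_derivative - ((b - l1 - - N) * (C x * w x)) - (c - l1 - - N) * (C x * wt x)) (at x)"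
        using S1(3)[of x] S2(3)[of x] x by (intro DERIV_diff DERIV_minus) auto
      moreover have "- ((b - l1 - - N) * (C x * w x)) - (c - l1 - - N) * (C x * wt x) = C x * (a * w x - a' * wt x)"
        by (simp add: a_def a'_def algebra_simps)
      moreover have "C x * (a * w x - a' * wt x) > 0"
      proof (rule mult_pos_pos)
        have "a' * wt x \<le> a' * w x" using wt_le[of x] x a'0 by simp
        also have "\<dots> < a * w x" using \<open>\<not> a \<le> a'\<close> wpos[of x] x by simp
        finally show "0 < a * w x - a' * wt x" by simp
      qed (use Cpos x in auto)
      ultimately show "\<exists>d>0. (?P has_real_derivative d) (at x)" by auto
    qed
    then show False using CwL C0 by (simp add: yt_def)
  qed
  have aDN: "a < D - N"
  proof (rule ccontr)
    assume "\<not> a < D - N"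
    have "S 0 * y 0 - S' 0 * w 0 \<ge> S l * y l - S' l * w l"
    proof (rule wronskian_ge[OF solS wR])
      fix x assume x: "0 < x" "x < l"
      then show "(b - l1 - - D) * (S x * w x) \<le> 0"
        using wpos[of x] Spos[of x] \<open>\<not> a < D - N\<close> by (intro mult_nonpos_nonneg) (auto simp: a_def)
    qed (use l in simp)
    moreover have "S l * y l - S' l * w l = 0" by (rule bc_wronskian_zero[OF bcS bcw(1)])
    ultimately have "kD * w 0 \<le> 0" using S0 by simp
    then show False using kDp wpos(1)[of 0] l by (simp add: mult_le_0_iff)
  qed
  have e'0: "e' > 0" using a'0 ee by simp
  have sz': "s z' = 0" by (rule second_state_zero[OF se])
  \<comment> \<open>The node lies in the low half: between a node in the other half and
    \<open>- l\<close>, the second state would be a positive solution with squared frequency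
    \<open>D - e'\<close>, too small by comparison with the sine.\<close>
  have z'0: "z' > 0"
  proof (rule ccontr)
    assume "\<not> z' > 0"
    then have nz: "0 \<le> - z'" "- z' < l" using z' by auto
    have sol': "sol (\<lambda>_. c - m) (- z') l sl tl" by (rule sol_subinterval[OF sL]) (use nz in auto)
    have slp: "sl x > 0" if "- z' < x" "x < l" for x using ss(1)[of "- x"] that by (simp add: sl_def)
    have "tl (- z') \<ge> 0"
      by (rule sol_deriv_nonneg[OF sol' nz(2) _ slp]) (simp_all add: sl_def sz')
    moreover have "S (- z') * tl (- z') - S' (- z') * sl (- z') < S l * tl l - S' l * sl l"
    proof (rule wronskian_less[OF sol_subinterval[OF solS] sol' nz(2)])
      fix x assume x: "- z' < x" "x < l"
      then show "0 < (c - m - - D) * (S x * sl x)"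
        using slp[of x] Spos[of x] nz e'0 by (intro mult_pos_pos) (auto simp: e'_def)
    qed (use nz in auto)
    moreover have "S l * tl l - S' l * sl l = 0" by (rule bc_wronskian_zero[OF bcS bcsl])
    moreover have "S (- z') \<ge> 0" using Spos[of "- z'"] nz S0 by (cases "z' = 0") auto
    ultimately have "S (- z') * tl (- z') < 0" "0 \<le> S (- z') * tl (- z')" by (simp_all add: sl_def sz')
    then show False by linarith
  qed
  have tz': "t z' > 0"
  proof -
    have "t z' \<ge> 0" by (rule sol_deriv_nonneg[OF sol_subinterval[OF sR, of z' l] z'(2) sz' ss(2)]) (use z'0 in auto)
    moreover have "t z' \<noteq> 0"
    proof
      assume "t z' = 0"
      then have "s ((z' + l) / 2) = 0" using sol_zero[OF sR tame_const sz', of "(z' + l) / 2"] z'0 z' by simp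
      then show False using ss(2)[of "(z' + l) / 2"] z' by simp
    qed
    ultimately show ?thesis by simp
  qed
  \<comment> \<open>On the interval from the node to \<open>l\<close>, shorter than the half, the
    second state must oscillate faster than the sine with frequency \<open>kD\<close>.\<close>
  have e0: "e > 0"
  proof (rule ccontr)
    assume "\<not> e > 0"
    have "S z' * t z' - S' z' * s z' \<le> S l * t l - S' l * s l"
    proof (rule wronskian_le[OF sol_subinterval[OF solS] sol_subinterval[OF sR]])
      fix x assume x: "z' < x" "x < l"
      then show "0 \<le> (b - m - - D) * (S x * s x)"
        using ss(2)[of x] Spos[of x] z'0 \<open>\<not> e > 0\<close> by (intro mult_nonneg_nonneg) (auto simp: e_def)
    qed (use z'0 z' in auto)
    moreover have "S l * t l - S' l * s l = 0" by (rule bc_wronskian_zero[OF bcS bcs(1)])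
    ultimately have "S z' * t z' \<le> 0" using sz' by simp
    then show False using tz' Spos[OF z'0 z'(2)] by (simp add: mult_le_0_iff)
  qed
  define kR where "kR = sqrt (D + e)"
  have D0: "D > 0" using kDp by (simp add: D_def)
  have kR: "kR\<^sup>2 = D + e" "0 < kR" using D0 e0 by (auto simp: kR_def)
  have kRD: "kD < kR" by (rule power2_less_imp_less) (use kR e0 in \<open>auto simp: D_def\<close>)
  \<comment> \<open>A phase sum above \<open>pi\<close> puts the mean frequency above
    \<open>kD\<close> by concavity of the phase; convexity of the square transfers this to the
    squared frequencies.\<close>
  have mid: "2 * kD\<^sup>2 < k\<^sup>2 + k'\<^sup>2" if "pi < robin_phase h l k + robin_phase h l k'" "0 \<le> k" "0 \<le> k'" for k k'
  proof -
    have "pi / 2 < robin_phase h l ((k + k') / 2)" using robin_phase_midpoint_concave[of k k'] that by simp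
    then have "kD < (k + k') / 2"
      using robin_phase_strict_mono[of "(k + k') / 2" kD] kD that by (cases "(k + k') / 2" kD rule: linorder_cases) auto
    then have "kD\<^sup>2 < ((k + k') / 2)\<^sup>2" using kDp by (intro power_strict_mono) auto
    also have "\<dots> \<le> (k\<^sup>2 + k'\<^sup>2) / 2" using sum_squares_bound[of k k'] by (simp add: power2_eq_square field_simps)
    finally show ?thesis by simp
  qed
  have pR: "pi / 2 < robin_phase h l kR" using robin_phase_strict_mono[OF _ kRD] kD kDp by simp
  \<comment> \<open>If the phase reached \<open>pi\<close>, its midpoint with \<open>kN\<close>,
    whose phase is 0, would give \<open>e \<ge> D - N\<close>, against
    \<open>e \<le> a < D - N\<close>.\<close>
  have pR2: "robin_phase h l kR < pi"
  proof (rule ccontr)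
    assume "\<not> robin_phase h l kR < pi"
    then have "pi / 2 \<le> robin_phase h l ((kR + kN) / 2)" using robin_phase_midpoint_concave[of kR kN] kN kR by simp
    then have "kD \<le> (kR + kN) / 2"
      using robin_phase_strict_mono[of "(kR + kN) / 2" kD] kD kN kR by (cases "(kR + kN) / 2" kD rule: linorder_cases) auto
    then have "kD\<^sup>2 \<le> ((kR + kN) / 2)\<^sup>2" using kDp by (intro power_mono) auto
    also have "\<dots> \<le> (kR\<^sup>2 + kN\<^sup>2) / 2" using sum_squares_bound[of kR kN] by (simp add: power2_eq_square field_simps)
    finally have "2 * D \<le> D + e + N" unfolding kR(1) by (simp add: D_def N_def)
    then show False using aDN ee by simp
  qed
  have s0: "s 0 < 0" using ss(1)[of 0] l z'0 by simp
  have sR': "sol (\<lambda>_. - kR\<^sup>2) 0 l s t" using sR kR by (simp add: e_def)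
  obtain K where K: "K \<noteq> 0" "s 0 = K * cos (robin_phase h l kR)" "t 0 = K * (kR * sin (robin_phase h l kR))"
    by (rule sol_explicit[OF sR' kR(2) bcs(1)]) (use s0 in auto)
  have sA: "sin (robin_phase h l kR) > 0" using pR pR2 pi_gt_zero by (intro sin_gt_zero) linarith+
  have cA: "cos (robin_phase h l kR) < 0"
  proof -
    have "sin (robin_phase h l kR - pi / 2) > 0" using pR pR2 pi_gt_zero by (intro sin_gt_zero) linarith+
    then show ?thesis by (simp add: sin_diff)
  qed
  have "K > 0" using s0 K cA by (simp add: mult_less_0_iff)
  then have t0: "t 0 > 0" using K(3) sA kR by simp
  define \<kappa> where "\<kappa> = m - c"
  \<comment> \<open>The second state rises through the centre. Comparison with the cosine then
    bounds the left squared frequency below by \<open>N\<close>, so the left frequency is real and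
    its phase positive.\<close>
  have \<kappa>N: "\<kappa> > N"
  proof (rule ccontr)
    assume "\<not> \<kappa> > N"
    have "C 0 * tl 0 - C' 0 * sl 0 \<le> C l * tl l - C' l * sl l"
    proof (rule wronskian_le[OF solC sL])
      fix x assume x: "0 < x" "x < l"
      then have "sl x > 0" using ss(1)[of "- x"] z'0 by (simp add: sl_def)
      then show "0 \<le> (c - m - - N) * (C x * sl x)"
        using Cpos[of x] x \<open>\<not> \<kappa> > N\<close> by (intro mult_nonneg_nonneg) (auto simp: \<kappa>_def)
    qed (use l in simp)
    moreover have "C l * tl l - C' l * sl l = 0" by (rule bc_wronskian_zero[OF bcC bcsl])
    ultimately show False using C0 t0 by (simp add: tl_def)
  qed
  define kL where "kL = sqrt \<kappa>"
  have N0: "N \<ge> 0" by (simp add: N_def)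
  have kL: "kL\<^sup>2 = \<kappa>" "0 < kL" using N0 \<kappa>N by (auto simp: kL_def)
  have kNL: "kN < kL" by (rule power2_less_imp_less) (use kL \<kappa>N in \<open>auto simp: N_def\<close>)
  have kLD: "kL < kD" by (rule power2_less_imp_less) (use kL e'0 kDp in \<open>auto simp: D_def e'_def \<kappa>_def\<close>)
  have pL: "0 < robin_phase h l kL" "robin_phase h l kL < pi / 2"
    using robin_phase_strict_mono[OF kN(1) kNL] robin_phase_strict_mono[OF less_imp_le[OF kL(2)] kLD] kN kD by auto
  have sL': "sol (\<lambda>_. - kL\<^sup>2) 0 l sl tl" using sL kL by (simp add: \<kappa>_def)
  obtain J where J: "J \<noteq> 0" "sl 0 = J * cos (robin_phase h l kL)" "tl 0 = J * (kL * sin (robin_phase h l kL))"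
    by (rule sol_explicit[OF sL' kL(2) bcsl]) (use s0 in \<open>auto simp: sl_def\<close>)
  define A B where "A = robin_phase h l kR" and "B = robin_phase h l kL"
  have sB: "sin B > 0" and cB: "cos B > 0"
    using pL pi_gt_zero unfolding B_def by (auto intro!: sin_gt_zero cos_gt_zero)
  \<comment> \<open>Both halves share value and derivative at the centre, up to the sign introduced
    by the reflection.\<close>
  have "tl 0 * s 0 + t 0 * sl 0 = 0" by (simp add: sl_def tl_def)
  then have "(K * J) * (kL * sin B * cos A + kR * sin A * cos B) = 0"
    unfolding K(2,3) J(2,3) A_def B_def by (simp add: algebra_simps)
  then have eq: "kR * sin A * cos B = - (kL * sin B * cos A)" using K J by simp
  \<comment> \<open>With equal frequencies the matching condition would read
    \<open>sin (A + B) = 0\<close>; the larger frequency \<open>kR\<close> on the low half makes the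
    sum negative.\<close>
  have "sin (A + B) < 0"
  proof -
    have "kL * (sin A * cos B) < kR * (sin A * cos B)"
      using kLD kRD sA cB unfolding A_def by (intro mult_strict_right_mono) auto
    also have "\<dots> = kL * (- (sin B * cos A))" using eq by (simp add: algebra_simps)
    finally have "sin A * cos B < - (sin B * cos A)" by (rule mult_left_less_imp_less) (use kL in simp)
    then show ?thesis by (simp add: sin_add mult.commute)
  qed
  then have "pi < A + B"
    using sin_ge_zero[of "A + B"] pL pR pi_gt_zero unfolding A_def B_def by (cases "A + B \<le> pi") (auto simp: A_def B_def)
  from mid[OF this[unfolded A_def B_def]] have "2 * D < (D + e) + \<kappa>"
    using kR kL by (simp add: D_def)
  then have "e' < e" by (simp add: e'_def \<kappa>_def)
  then show False using ee aa' by simp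
qed

end

section \<open>Centered wells\<close>

lemma bvp_shift:
  assumes "bvp q a b g h lam u v"
  shows "bvp (\<lambda>x. q x + c) a b g h (lam + c) u v"
  using assms by (simp add: bvp_def)

lemma bvp_cong:
  assumes "bvp q a b g h lam u v" "countable T" "\<And>x. a < x \<Longrightarrow> x < b \<Longrightarrow> x \<notin> T \<Longrightarrow> q x = r x"
  shows "bvp r a b g h lam u v"
proof -
  have "sol (\<lambda>x. q x - lam) a b u v" using assms(1) by (simp add: bvp_def)
  then have "sol (\<lambda>x. r x - lam) a b u v" by (rule sol_cong[OF _ assms(2)]) (use assms(3) in auto)
  then show ?thesis using assms(1) by (simp add: bvp_def)
qed

lemma bvp_reflect:
  assumes "bvp q (- l) l (pi - h) h lam u v"
  shows "bvp (\<lambda>x. q (- x)) (- l) l (pi - h) h lam (\<lambda>x. u (- x)) (\<lambda>x. - v (- x))"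
proof -
  have s: "sol (\<lambda>x. q x - lam) (- l) l u v" and nz: "\<exists>x\<in>{- l..l}. u x \<noteq> 0"
    and bc: "u (- l) * cos (pi - h) = v (- l) * sin (pi - h)" "u l * cos h = v l * sin h"
    using assms unfolding bvp_def by blast+
  obtain x where "x \<in> {- l..l}" "u x \<noteq> 0" using nz by blast
  then have "\<exists>x\<in>{- l..l}. u (- x) \<noteq> 0" by (intro bexI[of _ "- x"]) auto
  then show ?thesis unfolding bvp_def
    using sol_reflect[OF s] reflect_bc[OF bc(1)] reflect_bc[OF bc(2)] by simp
qed

lemma bvp_minus:
  assumes "bvp q a b g h lam u v"
  shows "bvp q a b g h lam (\<lambda>x. - u x) (\<lambda>x. - v x)"
proof -
  have "sol (\<lambda>x. q x - lam) a b u v" using assms by (simp add: bvp_def)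
  from sol_scale[OF this, of "- 1"] assms show ?thesis by (simp add: bvp_def)
qed

lemma ground_state_reflect:
  assumes "ground_state q (- l) l (pi - h) h lam u v"
  shows "ground_state (\<lambda>x. q (- x)) (- l) l (pi - h) h lam (\<lambda>x. u (- x)) (\<lambda>x. - v (- x))"
  using bvp_reflect ground_stateD[OF assms] by (auto simp: ground_state_def)

lemma second_state_reflect:
  assumes "second_state q (- l) l (pi - h) h lam u v z"
  shows "second_state (\<lambda>x. q (- x)) (- l) l (pi - h) h lam (\<lambda>x. - u (- x)) (\<lambda>x. v (- x)) (- z)"
  using bvp_minus[OF bvp_reflect[OF second_stateD(1)[OF assms]]] second_stateD(2-5)[OF assms]
  by (auto simp: second_state_def)

context
  fixes h l kN kD :: real
  assumes h: "pi / 2 \<le> h" "h \<le> pi" and l: "0 < l"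
    and kN: "0 \<le> kN" "robin_phase h l kN = 0" and kD: "robin_phase h l kD = pi / 2" "kN < kD"
begin

lemma constant_bvp_cos:
  "bvp (\<lambda>_. c) (- l) l (pi - h) h (kN\<^sup>2 + c) (\<lambda>x. cos (kN * x)) (\<lambda>x. - (kN * sin (kN * x)))"
  unfolding bvp_def
proof (intro conjI bexI[of _ 0])
  show "sol (\<lambda>x. c - (kN\<^sup>2 + c)) (- l) l (\<lambda>x. cos (kN * x)) (\<lambda>x. - (kN * sin (kN * x)))"
    using sol_cos[of kN] by simp
  show bc: "cos (kN * l) * cos h = - (kN * sin (kN * l)) * sin h" by (rule bc_cos[OF h l kN(2)])
  show "cos (kN * - l) * cos (pi - h) = - (kN * sin (kN * - l)) * sin (pi - h)"
    using bc by (simp add: cos_diff sin_diff)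
qed (use l in auto)

lemma constant_bvp_sin:
  "bvp (\<lambda>_. c) (- l) l (pi - h) h (kD\<^sup>2 + c) (\<lambda>x. sin (kD * x)) (\<lambda>x. kD * cos (kD * x))"
  unfolding bvp_def
proof (intro conjI bexI[of _ "l / 2"])
  show "sol (\<lambda>x. c - (kD\<^sup>2 + c)) (- l) l (\<lambda>x. sin (kD * x)) (\<lambda>x. kD * cos (kD * x))"
    using sol_sin[of kD] by simp
  show bc: "sin (kD * l) * cos h = kD * cos (kD * l) * sin h" by (rule bc_sin[OF h l kD(1)])
  show "sin (kD * - l) * cos (pi - h) = kD * cos (kD * - l) * sin (pi - h)"
    using bc by (simp add: cos_diff sin_diff)
  show "sin (kD * (l / 2)) \<noteq> 0" using sin_pos[OF h l kD(1), of "l / 2"] kD kN l by simp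
qed (use l in auto)

lemma constant_ground_state:
  "ground_state (\<lambda>_. c) (- l) l (pi - h) h (kN\<^sup>2 + c) (\<lambda>x. cos (kN * x)) (\<lambda>x. - (kN * sin (kN * x)))"
  using constant_bvp_cos cos_pos[OF h l kN(2,1)] by (auto simp: ground_state_def)

lemma constant_second_state:
  "second_state (\<lambda>_. c) (- l) l (pi - h) h (kD\<^sup>2 + c) (\<lambda>x. sin (kD * x)) (\<lambda>x. kD * cos (kD * x)) 0"
proof -
  have "sin (kD * x) > 0" if "0 < x" "x < l" for x using sin_pos[OF h l kD(1) _ that] kN kD by simp
  moreover from this have "sin (kD * x) < 0" if "- l < x" "x < 0" for x
    using that by (force dest: spec[of _ "- x"])
  ultimately show ?thesis using constant_bvp_sin l by (auto simp: second_state_def)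
qed

lemma constant_gap:
  assumes w: "ground_state (\<lambda>_. c) (- l) l (pi - h) h l1 w y" and s: "second_state (\<lambda>_. c) (- l) l (pi - h) h m s t z'"
  shows "m - l1 = kD\<^sup>2 - kN\<^sup>2"
proof -
  have "0 < h" using h(1) pi_gt_zero by linarith
  then have g: "- l < l" "0 \<le> pi - h" "pi - h < pi" "0 < h" using h l by auto
  show ?thesis
    using bvp_spectrum[OF tame_const g h(2) w s]
      bvp_spectrum[OF tame_const g h(2) constant_ground_state constant_second_state] by auto
qed

text \<open>Only the strict inequality for \<open>b < c\<close> has content; the reverse order
  follows by reflection, and equal levels are the constant case.\<close>

lemma step_gap_le:
  assumes w: "ground_state (\<lambda>x. if x < 0 then c else b) (- l) l (pi - h) h l1 w y"
    and s: "second_state (\<lambda>x. if x < 0 then c else b) (- l) l (pi - h) h m s t z'"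
  shows "kD\<^sup>2 - kN\<^sup>2 \<le> m - l1" "kD\<^sup>2 - kN\<^sup>2 = m - l1 \<Longrightarrow> b = c"
proof -
  have "kD\<^sup>2 - kN\<^sup>2 < m - l1 \<or> kD\<^sup>2 - kN\<^sup>2 = m - l1 \<and> b = c"
  proof (cases b c rule: linorder_cases)
    case less
    have "kD\<^sup>2 - kN\<^sup>2 < m - l1" by (rule step_gap[OF h l less w s kN kD])
    then show ?thesis by simp
  next
    case equal
    then have "(\<lambda>x::real. if x < 0 then c else b) = (\<lambda>_. c)" by auto
    then show ?thesis using constant_gap[of c l1 w y m s t z'] w s equal by auto
  next
    case greater
    \<comment> \<open>Reflection maps a step to a step except for the value at 0, which the equation
      does not see.\<close>
    have c: "bvp (\<lambda>x. if x < 0 then b else c) (- l) l (pi - h) h lam f f'"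
      if "bvp (\<lambda>x. if - x < 0 then c else b) (- l) l (pi - h) h lam f f'" for lam f f'
      by (rule bvp_cong[OF that, of "{0}"]) auto
    have "ground_state (\<lambda>x. if x < 0 then b else c) (- l) l (pi - h) h l1 (\<lambda>x. w (- x)) (\<lambda>x. - y (- x))"
      using ground_state_reflect[OF w] unfolding ground_state_def by (blast intro: c)
    moreover have "second_state (\<lambda>x. if x < 0 then b else c) (- l) l (pi - h) h m (\<lambda>x. - s (- x)) (\<lambda>x. t (- x)) (- z')"
      using second_state_reflect[OF s] unfolding second_state_def by (blast intro: c)
    ultimately have "kD\<^sup>2 - kN\<^sup>2 < m - l1" by (rule step_gap[OF h l greater _ _ kN kD])
    then show ?thesis by simp
  qed
  then show "kD\<^sup>2 - kN\<^sup>2 \<le> m - l1" "kD\<^sup>2 - kN\<^sup>2 = m - l1 \<Longrightarrow> b = c" by auto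
qed

lemma centered_well_gap_right:
  assumes tV: "tame V"
    and Vdec: "\<And>x y. - l \<le> x \<Longrightarrow> x \<le> y \<Longrightarrow> y \<le> 0 \<Longrightarrow> V y \<le> V x"
    and Vinc: "\<And>x y. 0 \<le> x \<Longrightarrow> x \<le> y \<Longrightarrow> y \<le> l \<Longrightarrow> V x \<le> V y"
    and G: "ground_state V (- l) l (pi - h) h l1 u1 v1" and S: "second_state V (- l) l (pi - h) h l2 u2 v2 z" and z: "0 \<le> z"
  shows "kD\<^sup>2 - kN\<^sup>2 \<le> l2 - l1 \<and> (kD\<^sup>2 - kN\<^sup>2 = l2 - l1 \<longrightarrow>
     (\<exists>c S. countable S \<and> (\<forall>x. - l < x \<and> x < l \<and> x \<notin> S \<longrightarrow> V x = c)))"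
proof -
  have h0: "0 < h" using h pi_gt_zero by linarith
  have "\<exists>b c w y m s t z'. ground_state (\<lambda>x. if x < 0 then c else b) (- l) l (pi - h) h l1 w y \<and>
    second_state (\<lambda>x. if x < 0 then c else b) (- l) l (pi - h) h m s t z' \<and> m \<le> l2 \<and>
    (m = l2 \<longrightarrow> (\<exists>S. countable S \<and> (\<forall>x. - l < x \<and> x < l \<and> x \<notin> S \<longrightarrow> V x = (if x < 0 then c else b))))"
    by (rule compare_to_step[OF l tV h0 h(2) Vdec Vinc G S z])
  then obtain b c w y m s t z' where w: "ground_state (\<lambda>x. if x < 0 then c else b) (- l) l (pi - h) h l1 w y"
    and s: "second_state (\<lambda>x. if x < 0 then c else b) (- l) l (pi - h) h m s t z'"
    and m: "m \<le> l2" "m = l2 \<Longrightarrow> \<exists>S. countable S \<and> (\<forall>x. - l < x \<and> x < l \<and> x \<notin> S \<longrightarrow> V x = (if x < 0 then c else b))"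
    by blast
  note g = step_gap_le[OF w s]
  show ?thesis
  proof (intro conjI impI)
    show "kD\<^sup>2 - kN\<^sup>2 \<le> l2 - l1" using g(1) m(1) by simp
    assume "kD\<^sup>2 - kN\<^sup>2 = l2 - l1"
    then have "m = l2" using g(1) m(1) by simp
    then have "b = c" using g(2) \<open>kD\<^sup>2 - kN\<^sup>2 = l2 - l1\<close> by simp
    have "\<exists>S. countable S \<and> (\<forall>x. - l < x \<and> x < l \<and> x \<notin> S \<longrightarrow> V x = c)"
      using m(2)[OF \<open>m = l2\<close>] unfolding \<open>b = c\<close> if_cancel .
    then show "\<exists>c S. countable S \<and> (\<forall>x. - l < x \<and> x < l \<and> x \<notin> S \<longrightarrow> V x = c)" by (rule exI)
  qed
qed

lemma centered_well_gap:
  assumes tV: "tame V"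
    and Vdec: "\<And>x y. - l \<le> x \<Longrightarrow> x \<le> y \<Longrightarrow> y \<le> 0 \<Longrightarrow> V y \<le> V x"
    and Vinc: "\<And>x y. 0 \<le> x \<Longrightarrow> x \<le> y \<Longrightarrow> y \<le> l \<Longrightarrow> V x \<le> V y"
    and G: "ground_state V (- l) l (pi - h) h l1 u1 v1" and S: "second_state V (- l) l (pi - h) h l2 u2 v2 z"
  shows "kD\<^sup>2 - kN\<^sup>2 \<le> l2 - l1 \<and> (kD\<^sup>2 - kN\<^sup>2 = l2 - l1 \<longrightarrow>
     (\<exists>c S. countable S \<and> (\<forall>x. - l < x \<and> x < l \<and> x \<notin> S \<longrightarrow> V x = c)))"
proof (cases "0 \<le> z")
  case True
  show ?thesis
    by (rule centered_well_gap_right[OF tV _ _ G S True]; rule Vdec Vinc; assumption)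
next
  case False
  have m1: "kD\<^sup>2 - kN\<^sup>2 \<le> l2 - l1 \<and> (kD\<^sup>2 - kN\<^sup>2 = l2 - l1 \<longrightarrow>
     (\<exists>c S. countable S \<and> (\<forall>x. - l < x \<and> x < l \<and> x \<notin> S \<longrightarrow> V (- x) = c)))"
  proof (rule centered_well_gap_right[OF tame_reflect[OF tV] _ _ ground_state_reflect[OF G] second_state_reflect[OF S]])
    fix x y :: real
    show "V (- y) \<le> V (- x)" if "- l \<le> x" "x \<le> y" "y \<le> 0" using Vinc[of "- y" "- x"] that by simp
    show "V (- x) \<le> V (- y)" if "0 \<le> x" "x \<le> y" "y \<le> l" using Vdec[of "- y" "- x"] that by simp
  qed (use False in simp)
  have m2: "\<exists>c S. countable S \<and> (\<forall>x. - l < x \<and> x < l \<and> x \<notin> S \<longrightarrow> V x = c)"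
    if ex: "\<exists>c S. countable S \<and> (\<forall>x. - l < x \<and> x < l \<and> x \<notin> S \<longrightarrow> V (- x) = c)"
  proof -
    from ex obtain c S where S: "countable S \<and> (\<forall>x. - l < x \<and> x < l \<and> x \<notin> S \<longrightarrow> V (- x) = c)"
      by (elim exE)
    have "V x = c" if x: "- l < x" "x < l" "x \<notin> uminus ` S" for x
    proof -
      have "- x \<notin> S"
      proof
        assume "- x \<in> S"
        then have "- (- x) \<in> uminus ` S" by (rule imageI)
        then show False using x(3) by simp
      qed
      then have "V (- (- x)) = c" using x by (intro S[THEN conjunct2, rule_format]) auto
      then show ?thesis by simp
    qed
    then have "countable (uminus ` S) \<and> (\<forall>x. - l < x \<and> x < l \<and> x \<notin> uminus ` S \<longrightarrow> V x = c)"
      using S by simp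
    then show ?thesis by (intro exI)
  qed
  show ?thesis
  proof (intro conjI impI)
    show "kD\<^sup>2 - kN\<^sup>2 \<le> l2 - l1" using m1 by (rule conjunct1)
    assume "kD\<^sup>2 - kN\<^sup>2 = l2 - l1"
    then show "\<exists>c S. countable S \<and> (\<forall>x. - l < x \<and> x < l \<and> x \<notin> S \<longrightarrow> V x = c)"
      by (intro m2 m1[THEN conjunct2, THEN mp])
  qed
qed

end

section \<open>From Robin conditions and spectral gaps to angles\<close>

text \<open>The condition \<open>v = - \<alpha> u\<close> at the right end means
  \<open>cot h = - \<alpha>\<close>; Dirichlet conditions are the limit \<open>h = pi\<close>. The
  left end receives the angle \<open>pi - h\<close> by symmetry.\<close>

definition robin_angle :: "ereal \<Rightarrow> real" where
  "robin_angle \<alpha> = (if \<alpha> = \<infinity> then pi else pi / 2 + arctan (real_of_ereal \<alpha>))"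

lemma robin_angle_bounds: "0 < robin_angle \<alpha>" "robin_angle \<alpha> \<le> pi" "0 \<le> \<alpha> \<Longrightarrow> pi / 2 \<le> robin_angle \<alpha>"
proof -
  have b: "- (pi / 2) < arctan x \<and> arctan x < pi / 2" for x :: real using arctan_bounded by blast
  show "0 < robin_angle \<alpha>" "robin_angle \<alpha> \<le> pi"
    using b[of "real_of_ereal \<alpha>"] pi_gt_zero by (auto simp: robin_angle_def)
  show "pi / 2 \<le> robin_angle \<alpha>" if "0 \<le> \<alpha>"
    using real_of_ereal_pos[OF that] pi_gt_zero by (auto simp: robin_angle_def)
qed

lemma robin_bc_angle:
  assumes "\<alpha> \<noteq> -\<infinity>"
  shows "robin_bc L \<alpha> u v \<longleftrightarrow> u (- (L / 2)) * cos (pi - robin_angle \<alpha>) = v (- (L / 2)) * sin (pi - robin_angle \<alpha>)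
    \<and> u (L / 2) * cos (robin_angle \<alpha>) = v (L / 2) * sin (robin_angle \<alpha>)"
proof (cases \<alpha>)
  case (real a)
  have sq: "sqrt (1 + a\<^sup>2) > 0" by (simp add: add_pos_nonneg)
  have c: "cos (pi / 2 + arctan a) = - (a / sqrt (1 + a\<^sup>2))" by (simp add: cos_add sin_arctan)
  have s: "sin (pi / 2 + arctan a) = 1 / sqrt (1 + a\<^sup>2)" by (simp add: sin_add cos_arctan)
  have 1: "p * cos (pi / 2 + arctan a) = p' * sin (pi / 2 + arctan a) \<longleftrightarrow> p' = - a * p" for p p'
    unfolding c s using sq by (auto simp: field_simps)
  have 2: "p * cos (pi - (pi / 2 + arctan a)) = p' * sin (pi - (pi / 2 + arctan a)) \<longleftrightarrow> p' = a * p" for p p'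
  proof -
    have "cos (pi - (pi / 2 + arctan a)) = a / sqrt (1 + a\<^sup>2)" "sin (pi - (pi / 2 + arctan a)) = 1 / sqrt (1 + a\<^sup>2)"
      unfolding cos_pi_minus sin_pi_minus c s by simp_all
    then show ?thesis using sq by (simp only:) (auto simp: field_simps)
  qed
  have "robin_angle \<alpha> = pi / 2 + arctan a" using real by (simp add: robin_angle_def)
  then show ?thesis using real by (simp only: robin_bc_def 1 2) simp
qed (use assms in \<open>auto simp: robin_bc_def robin_angle_def\<close>)

text \<open>Only the values of \<open>V\<close> on the interval matter, so \<open>V\<close> may be
  replaced by any tame function agreeing with it there.\<close>

lemma eigenvalues_bvp:
  assumes L: "L > 0" and q: "tame q" and V: "\<And>x. x \<in> {- (L / 2)..L / 2} \<Longrightarrow> V x = q x" and \<alpha>: "\<alpha> \<noteq> -\<infinity>"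
  shows "eigenvalues L V \<alpha> = {lam. \<exists>u v. bvp q (- (L / 2)) (L / 2) (pi - robin_angle \<alpha>) (robin_angle \<alpha>) lam u v}"
proof -
  let ?l = "L / 2"
  have "(\<exists>u. is_eigenpair L V \<alpha> lam u) \<longleftrightarrow> (\<exists>u v. bvp q (- ?l) ?l (pi - robin_angle \<alpha>) (robin_angle \<alpha>) lam u v)" for lam
  proof -
    note tQ = tame_sub_const[OF q, of lam]
    have "((\<forall>x\<in>{- ?l..?l}. (u has_real_derivative v x) (at x within {- ?l..?l})) \<and> continuous_on {- ?l..?l} v \<and>
        (\<forall>x\<in>{- ?l..?l}. ((\<lambda>t. (V t - lam) * u t) has_integral (v x - v (- ?l))) {- ?l..x}))
      \<longleftrightarrow> sol (\<lambda>x. q x - lam) (- ?l) ?l u v" for u v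
    proof -
      have eq: "((\<lambda>t. (V t - lam) * u t) has_integral I) {- ?l..x} \<longleftrightarrow> ((\<lambda>t. (q t - lam) * u t) has_integral I) {- ?l..x}"
        if "x \<in> {- ?l..?l}" for x I
        by (rule has_integral_cong) (use V that in auto)
      have ll: "- ?l \<le> ?l" using L by simp
      show ?thesis
      proof (intro iffI conjI ballI)
        assume A: "(\<forall>x\<in>{- ?l..?l}. (u has_real_derivative v x) (at x within {- ?l..?l})) \<and> continuous_on {- ?l..?l} v \<and>
          (\<forall>x\<in>{- ?l..?l}. ((\<lambda>t. (V t - lam) * u t) has_integral (v x - v (- ?l))) {- ?l..x})"
        show "sol (\<lambda>x. q x - lam) (- ?l) ?l u v"
        proof (rule sol_of_integral[OF tQ ll])
          show "((\<lambda>t. (q t - lam) * u t) has_integral v x - v (- ?l)) {- ?l..x}" if "x \<in> {- ?l..?l}" for x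
            using A eq[OF that] that by blast
        qed (use A in blast)+
      next
        assume S: "sol (\<lambda>x. q x - lam) (- ?l) ?l u v"
        show "continuous_on {- ?l..?l} v" by (rule sol_cont(2)[OF S])
        fix x assume x: "x \<in> {- ?l..?l}"
        show "(u has_real_derivative v x) (at x within {- ?l..?l})" by (rule sol_deriv_within[OF S x])
        show "((\<lambda>t. (V t - lam) * u t) has_integral (v x - v (- ?l))) {- ?l..x}"
          using sol_integral[OF S tQ x] eq[OF x] by blast
      qed
    qed
    then show ?thesis
      unfolding is_eigenpair_def bvp_def robin_bc_angle[OF \<alpha>] minus_divide_left[symmetric] by blast
  qed
  then show ?thesis unfolding eigenvalues_def by simp
qed

lemma spectral_gap_bvp:
  assumes L: "L > 0" and q: "tame q" and V: "\<And>x. x \<in> {- (L / 2)..L / 2} \<Longrightarrow> V x = q x" and \<alpha>: "\<alpha> \<noteq> -\<infinity>"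
    and G: "ground_state q (- (L / 2)) (L / 2) (pi - robin_angle \<alpha>) (robin_angle \<alpha>) l1 u1 v1"
    and S: "second_state q (- (L / 2)) (L / 2) (pi - robin_angle \<alpha>) (robin_angle \<alpha>) l2 u2 v2 z"
  shows "spectral_gap L V \<alpha> = l2 - l1"
proof -
  have g: "- (L / 2) < L / 2" "0 \<le> pi - robin_angle \<alpha>" "pi - robin_angle \<alpha> < pi"
    using L robin_angle_bounds[of \<alpha>] by auto
  note sp = bvp_spectrum[OF q g robin_angle_bounds(1,2) G S]
  have "eigenvalues L V \<alpha> = {lam. \<exists>u v. bvp q (- (L / 2)) (L / 2) (pi - robin_angle \<alpha>) (robin_angle \<alpha>) lam u v}"
    by (rule eigenvalues_bvp[OF L q _ \<alpha>]) (rule V)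
  then show ?thesis unfolding spectral_gap_def lambda2_def lambda1_def using sp by simp
qed

text \<open>The potential is extended by its end values. Cutting at the transition point writes it
  as a difference of monotone functions, each with countably many discontinuities.\<close>

lemma single_well_tame:
  assumes bd: "bounded (V ` {- L/2..L/2})" and sw: "single_well L V \<tau>" and L: "L > 0"
  shows "tame (\<lambda>x. V (max (- (L/2)) (min (L/2) x)))"
proof -
  define p where "p x = max (- (L/2)) (min (L/2) x)" for x
  define q where "q x = V (p x)" for x
  have p: "p x \<in> {- L/2..L/2}" for x using L by (auto simp: p_def)
  have pm: "x \<le> y \<Longrightarrow> p x \<le> p y" for x y by (auto simp: p_def)
  have \<tau>: "\<tau> \<in> {- L/2..L/2}" "p \<tau> = \<tau>" using sw by (auto simp: single_well_def p_def)
  have "mono (\<lambda>x. - q (min x \<tau>))"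
  proof (rule monoI)
    fix x y :: real assume "x \<le> y"
    then have "p (min x \<tau>) \<le> p (min y \<tau>)" "p (min y \<tau>) \<le> p \<tau>" by (auto intro!: pm)
    then show "- q (min x \<tau>) \<le> - q (min y \<tau>)"
      using sw p[of "min x \<tau>"] \<tau>(2) by (auto simp: single_well_def q_def)
  qed
  then have 1: "countable {x. \<not> isCont (\<lambda>x. - q (min x \<tau>)) x}" by (rule mono_ctble_discont)
  have "mono (\<lambda>x. q (max x \<tau>))"
  proof (rule monoI)
    fix x y :: real assume "x \<le> y"
    then have "p (max x \<tau>) \<le> p (max y \<tau>)" "p \<tau> \<le> p (max x \<tau>)" by (auto intro!: pm)
    then show "q (max x \<tau>) \<le> q (max y \<tau>)"
      using sw p[of "max y \<tau>"] \<tau>(2) by (auto simp: single_well_def q_def)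
  qed
  then have 2: "countable {x. \<not> isCont (\<lambda>x. q (max x \<tau>)) x}" by (rule mono_ctble_discont)
  have qe: "(\<lambda>x. q (max x \<tau>) - (- q (min x \<tau>)) - q \<tau>) = q"
    by (rule ext) (simp add: max_def min_def)
  have "isCont q x" if "isCont (\<lambda>x. - q (min x \<tau>)) x" "isCont (\<lambda>x. q (max x \<tau>)) x" for x
  proof -
    have "isCont (\<lambda>x. q (max x \<tau>) - (- q (min x \<tau>)) - q \<tau>) x"
      by (intro continuous_diff that continuous_const)
    then show ?thesis unfolding qe .
  qed
  then have sub: "{x. \<not> isCont q x} \<subseteq> {x. \<not> isCont (\<lambda>x. - q (min x \<tau>)) x} \<union> {x. \<not> isCont (\<lambda>x. q (max x \<tau>)) x}"
    by blast
  have "countable {x. \<not> isCont q x}" by (rule countable_subset[OF sub]) (use 1 2 in simp)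
  moreover have "bounded (range q)"
    by (rule bounded_subset[OF bd]) (use p in \<open>auto simp: q_def\<close>)
  ultimately have "tame q" by (simp add: tame_def)
  then show ?thesis by (simp add: q_def[abs_def] p_def[abs_def])
qed

lemma spectral_gap_constant:
  assumes L: "L > 0" and \<alpha>: "0 \<le> \<alpha>"
    and kN: "0 \<le> kN" "robin_phase (robin_angle \<alpha>) (L/2) kN = 0"
    and kD: "robin_phase (robin_angle \<alpha>) (L/2) kD = pi / 2" "kN < kD"
  shows "spectral_gap L (\<lambda>_. c) \<alpha> = kD\<^sup>2 - kN\<^sup>2"
proof -
  have l: "0 < L / 2" using L by simp
  have \<alpha>': "\<alpha> \<noteq> -\<infinity>" using \<alpha> by auto
  note h = robin_angle_bounds(3)[OF \<alpha>] robin_angle_bounds(2)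
  have "spectral_gap L (\<lambda>_. c) \<alpha> = (kD\<^sup>2 + c) - (kN\<^sup>2 + c)"
    by (rule spectral_gap_bvp[OF L tame_const _ \<alpha>' constant_ground_state[OF h l kN kD] constant_second_state[OF h l kN kD]]) simp
  then show ?thesis by simp
qed

text \<open>The equation uses \<open>V\<close> only under an integral, so changes on a null set are
  invisible. Constancy in the equality case is therefore meant up to null sets.\<close>

lemma spectral_gap_null_cong:
  assumes "{x \<in> {- L/2..L/2}. V x \<noteq> W x} \<in> null_sets lborel"
  shows "spectral_gap L V \<alpha> = spectral_gap L W \<alpha>"
proof -
  let ?Z = "{x \<in> {- L/2..L/2}. V x \<noteq> W x}"
  have neg: "negligible ?Z"
    using assms by (simp add: negligible_iff_null_sets null_sets_completionI)
  have "((\<lambda>t. (V t - lam) * u t) has_integral I) {- L/2..x} \<longleftrightarrow> ((\<lambda>t. (W t - lam) * u t) has_integral I) {- L/2..x}"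
    if "x \<in> {- L/2..L/2}" for x lam I and u :: "real \<Rightarrow> real"
    by (rule has_integral_spike_eq[OF neg]) (use that in auto)
  then have "is_eigenpair L V \<alpha> lam u = is_eigenpair L W \<alpha> lam u" for lam u
    unfolding is_eigenpair_def by (intro ex_cong1 conj_cong refl ball_cong) auto
  then have "eigenvalues L V \<alpha> = eigenvalues L W \<alpha>" by (simp add: eigenvalues_def)
  then show ?thesis by (simp add: spectral_gap_def lambda1_def lambda2_def)
qed

lemma centered_single_well_gap:
  assumes L: "L > 0" and bd: "bounded (V ` {- L/2..L/2})" and sw: "single_well L V 0" and \<alpha>: "0 \<le> \<alpha>"
  shows "spectral_gap L V \<alpha> \<ge> spectral_gap L (\<lambda>_. 0) \<alpha>
    \<and> (spectral_gap L V \<alpha> = spectral_gap L (\<lambda>_. 0) \<alpha> \<longleftrightarrow>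
         (\<exists>c. {x \<in> {- L/2..L/2}. V x \<noteq> c} \<in> null_sets lborel))"
proof -
  define l where "l = L / 2"
  have l: "0 < l" "- l < l" "- L / 2 = - l" "L / 2 = l" using L by (auto simp: l_def)
  define h where "h = robin_angle \<alpha>"
  have \<alpha>': "\<alpha> \<noteq> -\<infinity>" using \<alpha> by auto
  have h: "pi / 2 \<le> h" "h \<le> pi" "0 < h" using robin_angle_bounds[of \<alpha>] \<alpha> by (auto simp: h_def)
  obtain kN kD where k: "0 \<le> kN" "robin_phase h l kN = 0" "robin_phase h l kD = pi / 2" "kN < kD"
    using robin_frequencies[OF h(1,2) l(1)] by metis
  have const: "spectral_gap L (\<lambda>_. c) \<alpha> = kD\<^sup>2 - kN\<^sup>2" for c
    by (rule spectral_gap_constant[OF L \<alpha>]) (use k in \<open>simp_all add: h_def l_def\<close>)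
  define q where "q x = V (max (- l) (min l x))" for x
  have tq: "tame q" using single_well_tame[OF bd sw L] by (simp add: q_def[abs_def] l_def)
  have Vq: "V x = q x" if "x \<in> {- l..l}" for x
  proof -
    have "max (- l) (min l x) = x" using that by auto
    then show ?thesis by (simp add: q_def)
  qed
  have dec: "q y \<le> q x" if "- l \<le> x" "x \<le> y" "y \<le> 0" for x y
  proof -
    have "V y \<le> V x" using sw that by (simp add: single_well_def l_def)
    then show ?thesis using Vq[of x] Vq[of y] that l(1) by auto
  qed
  have inc: "q x \<le> q y" if "0 \<le> x" "x \<le> y" "y \<le> l" for x y
  proof -
    have "V x \<le> V y" using sw that by (simp add: single_well_def l_def)
    then show ?thesis using Vq[of x] Vq[of y] that l(1) by auto
  qed
  have g: "0 \<le> pi - h" "pi - h < pi" using h by auto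
  obtain l1 u1 v1 where G: "ground_state q (- l) l (pi - h) h l1 u1 v1"
    using ground_state_exists[OF tq l(2) g h(3,2)] by blast
  obtain l2 u2 v2 z where S: "second_state q (- l) l (pi - h) h l2 u2 v2 z"
    using second_state_exists[OF tq l(2) g h(3,2)] by blast
  have gap: "spectral_gap L V \<alpha> = l2 - l1"
    by (rule spectral_gap_bvp[OF L tq _ \<alpha>' G[unfolded l_def h_def] S[unfolded l_def h_def]]) (use Vq in \<open>auto simp: l_def\<close>)
  have main: "kD\<^sup>2 - kN\<^sup>2 \<le> l2 - l1 \<and> (kD\<^sup>2 - kN\<^sup>2 = l2 - l1 \<longrightarrow>
     (\<exists>c S. countable S \<and> (\<forall>x. - l < x \<and> x < l \<and> x \<notin> S \<longrightarrow> q x = c)))"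
    by (rule centered_well_gap[OF h(1,2) l(1) k tq dec inc G S])
  have "\<exists>c. {x \<in> {- L/2..L/2}. V x \<noteq> c} \<in> null_sets lborel" if "kD\<^sup>2 - kN\<^sup>2 = l2 - l1"
  proof -
    have "\<exists>c S. countable S \<and> (\<forall>x. - l < x \<and> x < l \<and> x \<notin> S \<longrightarrow> q x = c)"
      using main that by simp
    then obtain c S where S': "countable S \<and> (\<forall>x. - l < x \<and> x < l \<and> x \<notin> S \<longrightarrow> q x = c)" by (elim exE)
    then have S: "countable S" "\<And>x. - l < x \<Longrightarrow> x < l \<Longrightarrow> x \<notin> S \<Longrightarrow> q x = c" by simp_all
    \<comment> \<open>The ends are added because the rigidity statement concerns interior points
      only.\<close>
    have "{x \<in> {- L/2..L/2}. V x \<noteq> c} \<subseteq> S \<union> {- l, l}"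
    proof
      fix x assume "x \<in> {x \<in> {- L/2..L/2}. V x \<noteq> c}"
      then have "- l \<le> x" "x \<le> l" "V x \<noteq> c" by (auto simp: l_def)
      then show "x \<in> S \<union> {- l, l}" using S(2)[of x] Vq[of x] by (cases "x = - l \<or> x = l") auto
    qed
    then have "countable {x \<in> {- L/2..L/2}. V x \<noteq> c}" by (rule countable_subset) (use S(1) in simp)
    then show ?thesis by (blast intro: countable_imp_null_set_lborel)
  qed
  moreover have "spectral_gap L V \<alpha> = kD\<^sup>2 - kN\<^sup>2" if "{x \<in> {- L/2..L/2}. V x \<noteq> c} \<in> null_sets lborel" for c
    using spectral_gap_null_cong[of L V "\<lambda>_. c" \<alpha>] that const[of c] by simp
  ultimately show ?thesis unfolding gap const[of 0] using main by auto
qed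

section \<open>Perturbation off the center\<close>

text \<open>Simplicity of eigenvalues: the left boundary condition makes the initial vectors
  parallel, and \<open>k\<close> is the resulting projection coefficient.\<close>

lemma bvp_proportional:
  assumes B1: "bvp q a b g h lam u v" and B2: "bvp q a b g h lam w y" and q: "tame q" and ab: "a < b"
  shows "\<exists>k. \<forall>x\<in>{a..b}. w x = k * u x"
proof -
  note tQ = tame_sub_const[OF q, of lam]
  have s: "sol (\<lambda>x. q x - lam) a b u v" "sol (\<lambda>x. q x - lam) a b w y"
    and bc: "u a * cos g = v a * sin g" "w a * cos g = y a * sin g" and nz: "\<exists>x\<in>{a..b}. u x \<noteq> 0"
    using B1 B2 unfolding bvp_def by blast+
  have d: "(u a)\<^sup>2 + (v a)\<^sup>2 \<noteq> 0"
    using sol_zero[OF s(1) tQ, of a] nz ab by (auto simp: sum_power2_eq_zero_iff)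
  have wr: "u a * y a = v a * w a" using bc_wronskian_zero[OF bc] by simp
  define k where "k = (u a * w a + v a * y a) / ((u a)\<^sup>2 + (v a)\<^sup>2)"
  have "w a * ((u a)\<^sup>2 + (v a)\<^sup>2) = u a * (u a * w a + v a * y a)"
    using wr by (simp add: power2_eq_square algebra_simps)
  then have ka: "w a = k * u a" using d by (simp add: k_def field_simps)
  have "y a * ((u a)\<^sup>2 + (v a)\<^sup>2) = v a * (u a * w a + v a * y a)"
    using wr by (simp add: power2_eq_square algebra_simps)
  then have kb: "y a = k * v a" using d by (simp add: k_def field_simps)
  have "1 * w x + (- k) * u x = 0" if "x \<in> {a..b}" for x
    using sol_zero[OF sol_lincomb[OF s(2,1), of 1 "- k"] tQ, of a x] ka kb ab that by simp
  then have "\<forall>x\<in>{a..b}. w x = k * u x" by simp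
  then show ?thesis by blast
qed

text \<open>If \<open>l > l'\<close>, the first equation would have the strictly smaller potential
  and hence the strictly larger end angle.\<close>

lemma pruefer_eigenvalue_mono:
  assumes p: "pruefer (\<lambda>x. q x - l) a b g th" "pruefer (\<lambda>x. q' x - l') a b g th'" and ab: "a < b"
    and le: "\<And>x. q x \<le> q' x" and t: "tame q'" and eq: "th b = th' b"
  shows "l \<le> l'"
proof (rule ccontr)
  assume "\<not> l \<le> l'"
  have "th' b < th b"
  proof (rule pruefer_strict[OF p(2,1) _ tame_sub_const[OF t] ab])
    show "q x - l < q' x - l'" for x using le[of x] \<open>\<not> l \<le> l'\<close> by simp
  qed
  then show False using eq by simp
qed

lemma ground_state_mono:
  assumes q: "tame q" "tame q'" "\<And>x. q x \<le> q' x" and ab: "a < b" and g: "0 \<le> g" "g < pi" and h: "0 < h" "h \<le> pi"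
    and B: "ground_state q a b g h l u v" and B': "ground_state q' a b g h l' u' v'"
  shows "l \<le> l'"
proof -
  obtain th where th: "pruefer (\<lambda>x. q x - l) a b g th" using pruefer_exists[OF tame_sub_const[OF q(1)] ab] by blast
  obtain th' where th': "pruefer (\<lambda>x. q' x - l') a b g th'" using pruefer_exists[OF tame_sub_const[OF q(2)] ab] by blast
  have "th b = h" by (rule ground_state_angle[OF B th q(1) ab g h])
  moreover have "th' b = h" by (rule ground_state_angle[OF B' th' q(2) ab g h])
  ultimately show ?thesis using pruefer_eigenvalue_mono[OF th th' ab q(3) q(2)] by simp
qed

lemma second_state_mono:
  assumes q: "tame q" "tame q'" "\<And>x. q x \<le> q' x" and ab: "a < b" and g: "0 \<le> g" "g < pi" and h: "0 < h" "h \<le> pi"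
    and B: "second_state q a b g h l u v z" and B': "second_state q' a b g h l' u' v' z'"
  shows "l \<le> l'"
proof -
  obtain th where th: "pruefer (\<lambda>x. q x - l) a b g th" using pruefer_exists[OF tame_sub_const[OF q(1)] ab] by blast
  obtain th' where th': "pruefer (\<lambda>x. q' x - l') a b g th'" using pruefer_exists[OF tame_sub_const[OF q(2)] ab] by blast
  have "th b = h + pi" by (rule second_state_angle[OF B th q(1) ab g h])
  moreover have "th' b = h + pi" by (rule second_state_angle[OF B' th' q(2) ab g h])
  ultimately show ?thesis using pruefer_eigenvalue_mono[OF th th' ab q(3) q(2)] by simp
qed

lemma integral_mult_tendsto:
  fixes f :: "real \<Rightarrow> real" and F :: "nat \<Rightarrow> real \<Rightarrow> real"
  assumes f: "continuous_on {a..b} f" and F: "\<And>n. continuous_on {a..b} (F n)"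
    and close: "\<And>n x. x \<in> {a..b} \<Longrightarrow> \<bar>F n x - f x\<bar> \<le> t n * E" and t: "t \<longlonglongrightarrow> 0"
  shows "(\<lambda>n. integral {a..b} (\<lambda>x. f x * F n x)) \<longlonglongrightarrow> integral {a..b} (\<lambda>x. f x * f x)"
proof -
  have "bounded (f ` {a..b})" by (intro compact_imp_bounded compact_continuous_image f) simp
  then obtain B where "B > 0" "\<forall>y\<in>f ` {a..b}. norm y \<le> B" unfolding bounded_pos by blast
  then have B: "\<And>x. x \<in> {a..b} \<Longrightarrow> \<bar>f x\<bar> \<le> B" "B > 0" by auto
  have lim: "(\<lambda>n. B * (t n * E)) \<longlonglongrightarrow> B * (0 * E)" by (intro tendsto_intros t)
  have ul: "uniform_limit {a..b} (\<lambda>n x. f x * F n x) (\<lambda>x. f x * f x) sequentially"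
  proof (rule uniform_limitI)
    fix e :: real assume "e > 0"
    then have "\<forall>\<^sub>F n in sequentially. B * (t n * E) < e" using lim by (intro order_tendstoD(2)) auto
    then show "\<forall>\<^sub>F n in sequentially. \<forall>x\<in>{a..b}. dist (f x * F n x) (f x * f x) < e"
    proof eventually_elim
      case (elim n)
      show ?case
      proof
        fix x assume x: "x \<in> {a..b}"
        have "dist (f x * F n x) (f x * f x) = \<bar>f x\<bar> * \<bar>F n x - f x\<bar>"
          by (simp add: dist_real_def abs_mult right_diff_distrib[symmetric])
        also have "\<dots> \<le> B * (t n * E)" using B x close[OF x, of n] by (intro mult_mono) auto
        finally show "dist (f x * F n x) (f x * f x) < e" using elim by simp
      qed
    qed
  qed
  show ?thesis
  proof (rule uniform_limit_integral[OF ul])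
    show "continuous_on {a..b} (\<lambda>x. f x * F n x)" for n by (intro continuous_intros f F)
    fix I J assume "\<And>n. ((\<lambda>x. f x * F n x) has_integral I n) {a..b}" "((\<lambda>x. f x * f x) has_integral J) {a..b}" "I \<longlonglongrightarrow> J"
    moreover from this have "(\<lambda>n. integral {a..b} (\<lambda>x. f x * F n x)) = I" by (intro ext integral_unique)
    ultimately show ?thesis by (simp add: integral_unique)
  qed simp
qed

text \<open>First-order perturbation of an eigenvalue: its slope in the step height is the share of
  the mass of \<open>u^2\<close> to the right of \<open>c\<close>. Equal initial data make the
  perturbed solutions converge uniformly to \<open>u\<close>.\<close>

lemma eigenvalue_slope:
  assumes l: "0 < l" and c: "- l \<le> c" "c \<le> l"
    and u: "bvp (\<lambda>_. 0) (- l) l g h lam u v"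
    and U: "\<And>n. bvp (\<lambda>x. if x < c then 0 else t n) (- l) l g h (m n) (U n) (Y n)"
    and init: "\<And>n. U n (- l) = u (- l)" "\<And>n. Y n (- l) = v (- l)"
    and t: "\<And>n. 0 < t n" "\<And>n. t n \<le> 1" "t \<longlonglongrightarrow> 0"
    and m: "\<And>n. lam \<le> m n" "\<And>n. m n \<le> lam + t n"
  shows "(\<lambda>n. (m n - lam) / t n) \<longlonglongrightarrow> integral {c..l} (\<lambda>x. u x * u x) / integral {- l..l} (\<lambda>x. u x * u x)"
    and "integral {- l..l} (\<lambda>x. u x * u x) > 0"
proof -
  have su: "sol (\<lambda>_. 0 - lam) (- l) l u v" and bcu: "u (- l) * cos g = v (- l) * sin g" "u l * cos h = v l * sin h"
    and nz: "\<exists>x\<in>{- l..l}. u x \<noteq> 0"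
    using u unfolding bvp_def by blast+
  have sU: "sol (\<lambda>x. (if x < c then 0 else t n) - m n) (- l) l (U n) (Y n)"
    and bcU: "U n (- l) * cos g = Y n (- l) * sin g" "U n l * cos h = Y n l * sin h" for n
    using U[of n] unfolding bvp_def by blast+
  note cu = sol_cont(1)[OF su] and cU = sol_cont(1)[OF sU]
  have "bounded (u ` {- l..l})" by (intro compact_imp_bounded compact_continuous_image cu) simp
  then obtain B where "B > 0" "\<forall>y\<in>u ` {- l..l}. norm y \<le> B" unfolding bounded_pos by blast
  then have B: "\<And>x. x \<in> {- l..l} \<Longrightarrow> \<bar>u x\<bar> \<le> B" "B > 0" by auto
  define M where "M = \<bar>lam\<bar> + 2"
  define E where "E = sqrt (B\<^sup>2 * (2 * l) * exp ((M + 2) * (2 * l)))"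
  have close: "\<bar>U n x - u x\<bar> \<le> t n * E" if x: "x \<in> {- l..l}" for n x
  proof -
    have tn: "0 < t n" "t n \<le> 1" "lam \<le> m n" "m n \<le> lam + t n" using t m by auto
    have "(U n x - u x)\<^sup>2 + (Y n x - v x)\<^sup>2 \<le> (t n * B)\<^sup>2 * (x - - l) * exp ((M + 2) * (x - - l))"
    proof (rule sol_close[OF sU su _ _ _ _ _ _ init x])
      show "\<bar>(if y < c then 0 else t n) - m n\<bar> \<le> M" for y using tn by (auto simp: M_def)
      show "\<bar>(if y < c then 0 else t n) - m n - (0 - lam)\<bar> \<le> t n" for y using tn by auto
    qed (use B tn in \<open>auto simp: M_def\<close>)
    also have "\<dots> \<le> (t n * B)\<^sup>2 * (2 * l) * exp ((M + 2) * (2 * l))"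
      using x by (intro mult_mono) (auto simp: M_def intro!: mult_left_mono)
    also have "\<dots> = (t n * E)\<^sup>2" unfolding E_def using l by (simp add: power_mult_distrib)
    finally have "(U n x - u x)\<^sup>2 \<le> (t n * E)\<^sup>2" using zero_le_power2[of "Y n x - v x"] by linarith
    moreover have "0 \<le> t n * E" using tn l by (simp add: E_def)
    ultimately show ?thesis by (simp add: abs_le_square_iff[symmetric])
  qed
  have sub: "{c..l} \<subseteq> {- l..l}" "{- l..c} \<subseteq> {- l..l}" using c by auto
  define A where "A n = integral {- l..l} (\<lambda>x. u x * U n x)" for n
  define C where "C n = integral {c..l} (\<lambda>x. u x * U n x)" for n
  have limA: "A \<longlonglongrightarrow> integral {- l..l} (\<lambda>x. u x * u x)"
    unfolding A_def by (rule integral_mult_tendsto[OF cu cU close t(3)])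
  have limC: "C \<longlonglongrightarrow> integral {c..l} (\<lambda>x. u x * u x)"
    unfolding C_def
    by (rule integral_mult_tendsto[OF continuous_on_subset[OF cu sub(1)] continuous_on_subset[OF cU sub(1)] close t(3)])
      (use sub in auto)
  show pos: "integral {- l..l} (\<lambda>x. u x * u x) > 0"
  proof -
    have "integral {- l..l} (\<lambda>x. u x * u x) \<noteq> 0"
      using nz integral_eq_0_iff[of "- l" l "\<lambda>x. u x * u x"] cu l by (auto intro!: continuous_intros)
    moreover have "integral {- l..l} (\<lambda>x. u x * u x) \<ge> 0"
      by (rule integral_nonneg) (auto intro!: integrable_continuous_real continuous_intros cu)
    ultimately show ?thesis by simp
  qed
  \<comment> \<open>Exact identity from integrating the Wronskian of \<open>u\<close> and
    \<open>U n\<close>, whose boundary values vanish; dividing by \<open>t n\<close> and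
    \<open>A n\<close> gives the difference quotient.\<close>
  have id: "(m n - lam) * A n = t n * C n" for n
  proof -
    obtain S where S: "countable S" "continuous_on {- l..l} (\<lambda>x. u x * Y n x - v x * U n x)"
      "\<And>x. - l < x \<Longrightarrow> x < l \<Longrightarrow> x \<notin> S \<Longrightarrow>
       ((\<lambda>x. u x * Y n x - v x * U n x) has_real_derivative ((if x < c then 0 else t n) - m n - (0 - lam)) * (u x * U n x)) (at x)"
      by (rule wronskian_deriv[OF su sU]) blast
    let ?w = "\<lambda>x. u x * Y n x - v x * U n x"
    have cuU: "continuous_on {- l..l} (\<lambda>x. u x * U n x)" by (intro continuous_intros cu cU)
    have "((\<lambda>x. (lam - m n) * (u x * U n x)) has_integral ?w c - ?w (- l)) {- l..c}"
    proof (rule ftc_off_countable[OF c(1) continuous_on_subset[OF S(2) sub(2)] S(1) tame_const continuous_on_subset[OF cuU sub(2)]])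
      fix x assume x: "- l < x" "x < c" "x \<notin> S"
      then show "(?w has_real_derivative (lam - m n) * (u x * U n x)) (at x)" using S(3)[of x] c by simp
    qed
    moreover have "((\<lambda>x. (t n + lam - m n) * (u x * U n x)) has_integral ?w l - ?w c) {c..l}"
    proof (rule ftc_off_countable[OF c(2) continuous_on_subset[OF S(2) sub(1)] S(1) tame_const continuous_on_subset[OF cuU sub(1)]])
      fix x assume x: "c < x" "x < l" "x \<notin> S"
      then show "(?w has_real_derivative (t n + lam - m n) * (u x * U n x)) (at x)"
        using S(3)[of x] c by (simp add: algebra_simps)
    qed
    ultimately have "(lam - m n) * integral {- l..c} (\<lambda>x. u x * U n x) + (t n + lam - m n) * C n = ?w l - ?w (- l)"
      unfolding C_def by (simp add: integral_unique flip: integral_mult_right)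
    moreover have "?w l = 0" by (rule bc_wronskian_zero[OF bcu(2) bcU(2)])
    moreover have "?w (- l) = 0" by (rule bc_wronskian_zero[OF bcu(1) bcU(1)])
    moreover have "integral {- l..c} (\<lambda>x. u x * U n x) + C n = A n"
      unfolding A_def C_def by (rule Henstock_Kurzweil_Integration.integral_combine[OF c]) (rule integrable_continuous_real[OF cuU])
    ultimately have "(lam - m n) * (A n - C n) + (t n + lam - m n) * C n = 0" by (simp add: eq_diff_eq[symmetric])
    then show ?thesis by (simp add: algebra_simps)
  qed
  have "(\<lambda>n. C n / A n) \<longlonglongrightarrow> integral {c..l} (\<lambda>x. u x * u x) / integral {- l..l} (\<lambda>x. u x * u x)"
    using pos by (intro tendsto_divide limA limC) simp
  moreover have "\<forall>\<^sub>F n in sequentially. C n / A n = (m n - lam) / t n"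
  proof -
    have "\<forall>\<^sub>F n in sequentially. A n > 0" using limA pos by (rule order_tendstoD(1))
    then show ?thesis
    proof eventually_elim
      case (elim n)
      then show ?case using id[of n] t(1)[of n] by (simp add: field_simps)
    qed
  qed
  ultimately show "(\<lambda>n. (m n - lam) / t n) \<longlonglongrightarrow> integral {c..l} (\<lambda>x. u x * u x) / integral {- l..l} (\<lambda>x. u x * u x)"
    by (rule Lim_transform_eventually)
qed

text \<open>Reflection preserves the eigenspace, so it acts by a factor \<open>k\<close>; applying
  it twice gives \<open>k^2 = 1\<close>.\<close>

lemma zero_potential_square_even:
  assumes l: "0 < l" and u: "bvp (\<lambda>_. 0) (- l) l (pi - h) h lam u v" and x: "x \<in> {- l..l}"
  shows "u (- x) * u (- x) = u x * u x" "\<bar>u (- x)\<bar> = \<bar>u x\<bar>"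
proof -
  have "- l < l" using l by simp
  then obtain k where "\<forall>x\<in>{- l..l}. u (- x) = k * u x"
    using bvp_proportional[OF u bvp_reflect[OF u] tame_const] by blast
  then have k: "\<And>x. x \<in> {- l..l} \<Longrightarrow> u (- x) = k * u x" by blast
  obtain p where p: "p \<in> {- l..l}" "u p \<noteq> 0" using u by (auto simp: bvp_def)
  have "u p = k * (k * u p)" using k[of p] k[of "- p"] p by simp
  then have k2: "k * k = 1" using p by simp
  then have "\<bar>k\<bar> = 1" using square_eq_1_iff[of k] by auto
  then show "\<bar>u (- x)\<bar> = \<bar>u x\<bar>" using k[OF x] by (simp add: abs_mult)
  have "u (- x) * u (- x) = (k * k) * (u x * u x)" unfolding k[OF x] by (simp only: ac_simps)
  then show "u (- x) * u (- x) = u x * u x" by (simp only: k2 mult_1_left)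
qed

lemma integral_half_even:
  fixes f :: "real \<Rightarrow> real"
  assumes l: "0 \<le> l" and f: "continuous_on {- l..l} f" and even: "\<And>x. x \<in> {- l..l} \<Longrightarrow> f (- x) = f x"
  shows "integral {- l..l} f = 2 * integral {0..l} f"
proof -
  have "integral {- l..0} f = integral {- l..0} (\<lambda>x. f (- x))"
    by (rule integral_cong) (use even in auto)
  also have "\<dots> = integral {0..l} f"
    using Henstock_Kurzweil_Integration.integral_reflect_real[of l 0 f] by simp
  finally have "integral {- l..0} f = integral {0..l} f" .
  moreover have "integral {- l..0} f + integral {0..l} f = integral {- l..l} f"
    by (rule Henstock_Kurzweil_Integration.integral_combine) (use l f in \<open>auto intro: integrable_continuous_real\<close>)
  ultimately show ?thesis by simp
qed

text \<open>For a step at 0 both eigenvalues have slope 1/2, since the squared states are even.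
  Moving the step left adds mass near 0, where the ground state has some and the second state to
  leading order none, so the first eigenvalue rises faster.\<close>

lemma off_center_step_gap:
  assumes l: "0 < l" and h: "0 < h" "h \<le> pi"
    and G: "ground_state (\<lambda>_. 0) (- l) l (pi - h) h l1 u1 v1" "u1 (- l) = sin (pi - h)" "v1 (- l) = cos (pi - h)"
    and S: "second_state (\<lambda>_. 0) (- l) l (pi - h) h l2 u2 v2 z" "u2 (- l) = - sin (pi - h)" "v2 (- l) = - cos (pi - h)"
  shows "\<exists>c t m1 w1 y1 m2 w2 y2 z'. - l < c \<and> 0 < t \<and>
     ground_state (\<lambda>x. if x < c then 0 else t) (- l) l (pi - h) h m1 w1 y1 \<and>
     second_state (\<lambda>x. if x < c then 0 else t) (- l) l (pi - h) h m2 w2 y2 z' \<and> m2 - m1 < l2 - l1"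
proof -
  note u1 = ground_stateD[OF G(1)] and u2 = second_stateD[OF S(1)]
  have g: "0 \<le> pi - h" "pi - h < pi" and ll: "- l < l" using h l by auto
  have cu: "continuous_on {- l..l} u1" "continuous_on {- l..l} u2"
    using u1(1) u2(1) by (auto simp: bvp_def dest: sol_cont)
  \<comment> \<open>The absolute value is even, so \<open>- z\<close> is a zero too; as
    \<open>z\<close> is the only interior zero, it equals 0.\<close>
  have u20: "u2 0 = 0"
  proof (rule ccontr)
    assume n0: "u2 0 \<noteq> 0"
    have ev: "\<bar>u2 (- x)\<bar> = \<bar>u2 x\<bar>" if "x \<in> {- l..l}" for x by (rule zero_potential_square_even(2)[OF l u2(1) that])
    have uz: "u2 z = 0" by (rule second_state_zero[OF S(1)])
    then have "u2 (- z) = 0" using ev[of z] u2(2,3) by simp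
    then have "- z = z" using u2(4)[of "- z"] u2(5)[of "- z"] u2(2,3) by (cases "- z" z rule: linorder_cases) auto
    then show False using uz n0 by simp
  qed
  define P where "P c = integral {c..l} (\<lambda>x. u1 x * u1 x)" for c
  define Q where "Q c = integral {c..l} (\<lambda>x. u2 x * u2 x)" for c
  \<comment> \<open>The integral of \<open>f\<close> over \<open>{c..0}\<close> is the difference of
    the two slopes at \<open>c\<close> times both total masses.\<close>
  define f where "f x = (u2 x * u2 x) * P (- l) - (u1 x * u1 x) * Q (- l)" for x
  have cc: "continuous_on {- l..l} (\<lambda>x. u1 x * u1 x)" "continuous_on {- l..l} (\<lambda>x. u2 x * u2 x)"
    by (intro continuous_intros cu)+
  have int: "(\<lambda>x. u1 x * u1 x) integrable_on {a..b}" "(\<lambda>x. u2 x * u2 x) integrable_on {a..b}" if "{a..b} \<subseteq> {- l..l}" for a b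
    using that by (auto intro!: integrable_continuous_real continuous_on_subset[OF cc(1)] continuous_on_subset[OF cc(2)])
  have cf: "continuous_on {- l..l} f" unfolding f_def by (intro continuous_intros cu)
  have half: "P (- l) = 2 * P 0" "Q (- l) = 2 * Q 0"
    unfolding P_def Q_def using zero_potential_square_even(1)[OF l u1(1)] zero_potential_square_even(1)[OF l u2(1)] l
    by (intro integral_half_even cc; simp)+
  define tn where "tn n = 1 / (real n + 1)" for n
  have tn: "0 < tn n" "tn n \<le> 1" for n by (auto simp: tn_def)
  have tlim: "tn \<longlonglongrightarrow> 0" unfolding tn_def using LIMSEQ_inverse_real_of_nat by (simp add: inverse_eq_divide add.commute)
  have ex1: "\<exists>m w y. ground_state (\<lambda>x. if x < c then 0 else tn n) (- l) l (pi - h) h m w y \<and>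
      w (- l) = sin (pi - h) \<and> y (- l) = cos (pi - h)" for c n
    by (rule ground_state_exists[OF tame_step ll g h])
  have ex2: "\<exists>m w y z. second_state (\<lambda>x. if x < c then 0 else tn n) (- l) l (pi - h) h m w y z \<and>
      w (- l) = - sin (pi - h) \<and> y (- l) = - cos (pi - h)" for c n
    by (rule second_state_exists[OF tame_step ll g h])
  obtain m1 w1 y1 where E1: "\<And>c n. ground_state (\<lambda>x. if x < c then 0 else tn n) (- l) l (pi - h) h (m1 c n) (w1 c n) (y1 c n)"
      "\<And>c n. w1 c n (- l) = sin (pi - h)" "\<And>c n. y1 c n (- l) = cos (pi - h)"
    using ex1 by metis
  obtain m2 w2 y2 zz where E2: "\<And>c n. second_state (\<lambda>x. if x < c then 0 else tn n) (- l) l (pi - h) h (m2 c n) (w2 c n) (y2 c n) (zz c n)"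
      "\<And>c n. w2 c n (- l) = - sin (pi - h)" "\<And>c n. y2 c n (- l) = - cos (pi - h)"
    using ex2 by metis
  have shift: "ground_state (\<lambda>_. 0 + d) (- l) l (pi - h) h (l1 + d) u1 v1" "second_state (\<lambda>_. 0 + d) (- l) l (pi - h) h (l2 + d) u2 v2 z" for d
    using G(1) S(1) bvp_shift[OF u1(1), of d] bvp_shift[OF u2(1), of d] by (simp_all add: ground_state_def second_state_def)
  \<comment> \<open>The step lies between the constants 0 and \<open>tn n\<close>, and adding a
    constant shifts eigenvalues by it.\<close>
  have b1: "l1 \<le> m1 c n" "m1 c n \<le> l1 + tn n" for c n
    by (rule ground_state_mono[OF tame_const tame_step _ ll g h G(1) E1(1)], use tn(1)[of n] in simp)
      (rule ground_state_mono[OF tame_step tame_const _ ll g h E1(1) shift(1)], use tn(1)[of n] in simp)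
  have b2: "l2 \<le> m2 c n" "m2 c n \<le> l2 + tn n" for c n
    by (rule second_state_mono[OF tame_const tame_step _ ll g h S(1) E2(1)], use tn(1)[of n] in simp)
      (rule second_state_mono[OF tame_step tame_const _ ll g h E2(1) shift(2)], use tn(1)[of n] in simp)
  have s1: "(\<lambda>n. (m1 c n - l1) / tn n) \<longlonglongrightarrow> P c / P (- l)" "P (- l) > 0" if "- l \<le> c" "c \<le> l" for c
    unfolding P_def using eigenvalue_slope[OF l that u1(1), of tn "m1 c" "w1 c" "y1 c"] ground_stateD(1)[OF E1(1)] E1(2,3) G(2,3) tn tlim b1 by auto
  have s2: "(\<lambda>n. (m2 c n - l2) / tn n) \<longlonglongrightarrow> Q c / Q (- l)" "Q (- l) > 0" if "- l \<le> c" "c \<le> l" for c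
    unfolding Q_def using eigenvalue_slope[OF l that u2(1), of tn "m2 c" "w2 c" "y2 c"] second_stateD(1)[OF E2(1)] E2(2,3) S(2,3) tn tlim b2 by auto
  have PQ: "P (- l) > 0" "Q (- l) > 0" using s1(2)[of 0] s2(2)[of 0] l by auto
  have f0: "f 0 < 0" using PQ u1(2)[of 0] l u20 by (simp add: f_def)
  have "isCont f 0" using continuous_on_interior[OF cf, of 0] l by simp
  then have "f \<midarrow>0\<rightarrow> f 0" by (simp add: isCont_def)
  then have "\<forall>\<^sub>F x in at 0. f x < f 0 / 2" using f0 by (intro order_tendstoD(2)) auto
  then obtain d where d: "d > 0" "\<And>x. x \<noteq> 0 \<Longrightarrow> dist x 0 < d \<Longrightarrow> f x < f 0 / 2" by (auto simp: eventually_at)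
  \<comment> \<open>Close enough to 0 that \<open>f\<close> stays below half its negative value at
    0, and still inside the interval.\<close>
  define c where "c = - (min d l / 2)"
  have c: "- l < c" "c < 0" "- d < c" using d l by (auto simp: c_def min_def)
  have fle: "f x \<le> f 0 / 2" if "x \<in> {c..0}" for x
    using d(2)[of x] that c f0 by (cases "x = 0") (auto simp: dist_real_def)
  have "integral {c..0} f \<le> integral {c..0} (\<lambda>_. f 0 / 2)"
    by (intro integral_le integrable_continuous_real continuous_on_subset[OF cf] fle) (use c in auto)
  also have "\<dots> < 0" using c f0 by (simp add: mult_neg_neg)
  finally have neg: "integral {c..0} f < 0" .
  have split: "integral {c..0} (\<lambda>x. u1 x * u1 x) = P c - P 0" "integral {c..0} (\<lambda>x. u2 x * u2 x) = Q c - Q 0"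
    using Henstock_Kurzweil_Integration.integral_combine[of c 0 l "\<lambda>x. u1 x * u1 x"]
      Henstock_Kurzweil_Integration.integral_combine[of c 0 l "\<lambda>x. u2 x * u2 x"] int[of c l] c l
    by (auto simp: P_def Q_def)
  have "integral {c..0} f = (Q c - Q 0) * P (- l) - (P c - P 0) * Q (- l)"
    unfolding f_def split[symmetric] using int[of c 0] c l
    by (subst integral_diff) (auto intro!: integrable_on_mult_left)
  also have "\<dots> = Q c * P (- l) - P c * Q (- l)" unfolding half by (simp add: algebra_simps)
  finally have "Q c * P (- l) < P c * Q (- l)" using neg by simp
  then have lt: "Q c / Q (- l) < P c / P (- l)" using PQ by (simp add: divide_simps)
  have cl: "- l \<le> c" "c \<le> l" using c l by auto
  have "(\<lambda>n. (m2 c n - l2) / tn n - (m1 c n - l1) / tn n) \<longlonglongrightarrow> Q c / Q (- l) - P c / P (- l)"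
    by (intro tendsto_diff s1(1) s2(1) cl)
  then have "\<forall>\<^sub>F n in sequentially. (m2 c n - l2) / tn n - (m1 c n - l1) / tn n < 0"
    by (rule order_tendstoD(2)) (use lt in simp)
  then obtain n where "(m2 c n - l2) / tn n - (m1 c n - l1) / tn n < 0"
    by (auto simp: eventually_sequentially)
  then have "((m2 c n - l2) - (m1 c n - l1)) / tn n < 0" by (simp only: diff_divide_distrib)
  then have gap: "m2 c n - m1 c n < l2 - l1" using tn(1)[of n] by (simp add: divide_less_0_iff)
  with E1(1)[of c n] E2(1)[of c n] c(1) tn(1)[of n] show ?thesis by blast
qed

theorem theorem1p1:
  fixes L :: real
  assumes "L > 0"
  shows "(\<forall>(V :: real \<Rightarrow> real) (\<alpha> :: ereal).
            bounded (V ` {-L/2..L/2}) \<and> single_well L V 0 \<and> 0 \<le> \<alpha> \<longrightarrow>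
              spectral_gap L V \<alpha> \<ge> spectral_gap L (\<lambda>_. 0) \<alpha>
              \<and> (spectral_gap L V \<alpha> = spectral_gap L (\<lambda>_. 0) \<alpha> \<longleftrightarrow>
                   (\<exists>c. {x \<in> {-L/2..L/2}. V x \<noteq> c} \<in> null_sets lborel)))
       \<and> (\<forall>\<alpha> :: ereal. \<alpha> \<noteq> -\<infinity> \<longrightarrow>
            (\<exists>(V :: real \<Rightarrow> real) \<tau>. bounded (V ` {-L/2..L/2}) \<and> single_well L V \<tau> \<and> \<tau> \<noteq> 0
                \<and> spectral_gap L V \<alpha> < spectral_gap L (\<lambda>_. 0) \<alpha>))"
proof (intro conjI allI impI)
  fix V :: "real \<Rightarrow> real" and \<alpha> :: ereal
  assume A: "bounded (V ` {-L/2..L/2}) \<and> single_well L V 0 \<and> 0 \<le> \<alpha>"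
  then have B: "bounded (V ` {-L/2..L/2})" "single_well L V 0" "0 \<le> \<alpha>" by blast+
  note main = centered_single_well_gap[OF assms B]
  show "spectral_gap L V \<alpha> \<ge> spectral_gap L (\<lambda>_. 0) \<alpha>" using main by (rule conjunct1)
  show "spectral_gap L V \<alpha> = spectral_gap L (\<lambda>_. 0) \<alpha> \<longleftrightarrow>
      (\<exists>c. {x \<in> {-L/2..L/2}. V x \<noteq> c} \<in> null_sets lborel)" using main by (rule conjunct2)
next
  fix \<alpha> :: ereal
  assume \<alpha>: "\<alpha> \<noteq> -\<infinity>"
  define l h where "l = L / 2" and "h = robin_angle \<alpha>"
  have l: "0 < l" "- l < l" using assms by (auto simp: l_def)
  have h: "0 < h" "h \<le> pi" using robin_angle_bounds[of \<alpha>] by (auto simp: h_def)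
  have g: "0 \<le> pi - h" "pi - h < pi" using h by auto
  obtain l1 u1 v1 where G: "ground_state (\<lambda>_. 0) (- l) l (pi - h) h l1 u1 v1" "u1 (- l) = sin (pi - h)" "v1 (- l) = cos (pi - h)"
    using ground_state_exists[OF tame_const l(2) g h, of 0] by blast
  obtain l2 u2 v2 z where S: "second_state (\<lambda>_. 0) (- l) l (pi - h) h l2 u2 v2 z" "u2 (- l) = - sin (pi - h)" "v2 (- l) = - cos (pi - h)"
    using second_state_exists[OF tame_const l(2) g h, of 0] by blast
  obtain c t m1 w1 y1 m2 w2 y2 z' where w: "- l < c" "0 < t"
     "ground_state (\<lambda>x. if x < c then 0 else t) (- l) l (pi - h) h m1 w1 y1"
     "second_state (\<lambda>x. if x < c then 0 else t) (- l) l (pi - h) h m2 w2 y2 z'" and gap: "m2 - m1 < l2 - l1"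
    using off_center_step_gap[OF l(1) h G S] by blast
  define V :: "real \<Rightarrow> real" where "V = (\<lambda>x. if x < c then 0 else t)"
  have "spectral_gap L V \<alpha> = m2 - m1"
    by (rule spectral_gap_bvp[OF assms tame_step _ \<alpha> w(3,4)[unfolded l_def h_def]]) (auto simp: V_def)
  moreover have "spectral_gap L (\<lambda>_. 0) \<alpha> = l2 - l1"
    by (rule spectral_gap_bvp[OF assms tame_const _ \<alpha> G(1)[unfolded l_def h_def] S(1)[unfolded l_def h_def]]) simp
  moreover have "bounded (V ` {-L/2..L/2})"
    by (rule bounded_subset[of "{0, t}"]) (auto simp: V_def)
  \<comment> \<open>The step is nondecreasing on the whole interval, so the left end is a transition
    point.\<close>
  moreover have "single_well L V (- L / 2)"
    using assms w(1,2) by (auto simp: single_well_def V_def l_def)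
  moreover have "- L / 2 \<noteq> 0" using assms by simp
  ultimately show "\<exists>(V :: real \<Rightarrow> real) \<tau>. bounded (V ` {-L/2..L/2}) \<and> single_well L V \<tau> \<and> \<tau> \<noteq> 0
                \<and> spectral_gap L V \<alpha> < spectral_gap L (\<lambda>_. 0) \<alpha>"
    using gap by (intro exI[of _ V] exI[of _ "- L / 2"]) simp
qed

end
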